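(* Let $(\ell,f):(\mathbf C^2,0)\to(\mathbf C^2,0)$ be a germ of a holomorphic mapping such that $\ell=0$ is a smooth curve, $f=0$ has an isolated singularity at $0\in\mathbf C^2$, and $\ell=0$ is not a branch of $f=0$. Suppose that $f=0$ is a branch (i.e. $f$ is irreducible in $\mathbf C\{x,y\}$). Then the discriminant $\mathcal D(u,v)$ of $(\ell,f)$ is non-degenerate if and only if there are no lattice points inside (i.e. in the relative interior of) the compact edges of its Newton diagram.
   Context: Discriminant: for a morphism $(\ell,f)$ given by $u=\ell(x,y)$, $v=f(x,y)$, the polar curve is $\frac{\partial \ell}{\partial x}\frac{\partial f}{\partial y}-\frac{\partial \ell}{\partial y}\frac{\partial f}{\partial x}=0$, and its direct image $\mathcal D(u,v)=0$ (with multiplicities) under $(\ell,f)$ is the discriminant curve; the power series $\mathcal D(u,v)$, defined up to multiplication by an invertible power series, is the discriminant. Analytic changes of coordinates in the source do not change it. In coordinates with $\ell(x,y)=x$, put $p=\mathrm{ord}\, f(0,y)$ and write $\frac{\partial f}{\partial y}(x,y)=\tilde u(x,y)\prod_{j=1}^{p-1}[y-\gamma_j(x)]$ with $\tilde u$ a unit and $\gamma_j$ Puiseux series of positive order; then $\mathcal D(u,v)=\prod_{j=1}^{p-1}(v-f(u,\gamma_j(u)))$ up to a unit. Newton diagram: for a nonzero $g=\sum a_{ij}x^iy^j$, $\Delta_g$ is the convex hull of $\{(i,j):a_{ij}\ne0\}+\mathbf R_{\ge 0}^2$. For a compact edge $S$ of $\Delta_g$, let $g_S=\sum_{(i,j)\in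 S}a_{ij}x^iy^j$. It factors as $g_S=c\,x^ky^l\prod_{i=1}^r(y^{q_0}-a_ix^{p_0})^{s_i}$ with $p_0,q_0$ coprime positive integers ($p_0/q_0$ being the inclination of $S$), $k,l\geq 0$ integers, $c,a_i$ nonzero complex numbers and $a_i\neq a_j$ for $i\ne j$. The series $g$ is non-degenerate on $S$ if all $s_i=1$; $g$ is non-degenerate if it is non-degenerate on every compact edge of $\Delta_g$. For $\mathcal D(u,v)$ the variables $(u,v)$ play the role of $(x,y)$. *)

theory Defs
  imports "HOL-Analysis.Analysis"
begin

section \<open>The ring of convergent power series in two complex variables\<close>

text \<open>A formal series in $x, y$ is a series in $y$ whose coefficients are series in $x$: the
  coefficient of $x^i y^j$ in \<open>F\<close> is \<open>fps_nth (fps_nth F j) i\<close>.\<close>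

definition convergent2 :: "complex fps fps \<Rightarrow> bool" where
  "convergent2 F \<longleftrightarrow>
     (\<exists>r>0. (\<lambda>(i, j). norm (fps_nth (fps_nth F j) i) * r ^ i * r ^ j) summable_on UNIV)"

lemma convergent2_iff_bound:
  "convergent2 F \<longleftrightarrow> (\<exists>C R. C > 0 \<and> R > 0 \<and> (\<forall>i j. norm (fps_nth (fps_nth F j) i) \<le> C * R ^ (i + j)))"
proof
  assume "convergent2 F"
  then obtain r where r: "r > 0"
    and s: "(\<lambda>(i, j). norm (fps_nth (fps_nth F j) i) * r ^ i * r ^ j) summable_on UNIV" (is "?f summable_on _")
    unfolding convergent2_def by blast
  define C where "C = infsum ?f UNIV"
  have le: "norm (fps_nth (fps_nth F j) i) * r ^ i * r ^ j \<le> C" for i j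
    using finite_sum_le_infsum[OF s, of "{(i, j)}"] r by (auto simp: C_def)
  have "norm (fps_nth (fps_nth F j) i) \<le> (max C 1) * (1 / r) ^ (i + j)" for i j
  proof -
    have "norm (fps_nth (fps_nth F j) i) * (r ^ i * r ^ j) \<le> max C 1"
      using le[of j i] by (simp add: mult.assoc)
    then show ?thesis using r by (simp add: field_simps power_add)
  qed
  then show "\<exists>C R. C > 0 \<and> R > 0 \<and> (\<forall>i j. norm (fps_nth (fps_nth F j) i) \<le> C * R ^ (i + j))"
    using r by (intro exI[of _ "max C 1"] exI[of _ "1 / r"]) auto
next
  assume "\<exists>C R. C > 0 \<and> R > 0 \<and> (\<forall>i j. norm (fps_nth (fps_nth F j) i) \<le> C * R ^ (i + j))"
  then obtain C R where CR: "C > 0" "R > (0::real)"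
    and b: "\<And>i j. norm (fps_nth (fps_nth F j) i) \<le> C * R ^ (i + j)" by blast
  define r where "r = 1 / (2 * R)"
  have r: "r > 0" using CR by (simp add: r_def)
  have g: "((\<lambda>n. (1/2 :: real) ^ n) has_sum 2) UNIV"
    using geometric_sums[of "1/2 :: real"] by (simp add: sums_nonneg_imp_has_sum_strong)
  have "(\<lambda>(i, j). norm ((1/2 :: real) ^ i * (1/2) ^ j)) summable_on (SIGMA i:UNIV. UNIV)"
  proof (rule summable_on_SigmaI)
    fix i :: nat
    show "((\<lambda>j. case (i, j) of (i, j) \<Rightarrow> norm ((1/2 :: real) ^ i * (1/2) ^ j)) has_sum ((1/2) ^ i * 2)) UNIV"
      using has_sum_cmult_right[OF g, of "(1/2) ^ i"] by (simp add: norm_mult norm_power)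
  next
    show "(\<lambda>i. (1/2 :: real) ^ i * 2) summable_on UNIV"
      using has_sum_cmult_left[OF g, of 2] has_sum_imp_summable by blast
  qed auto
  then have "(\<lambda>(i, j). norm ((1/2 :: real) ^ i * (1/2) ^ j)) summable_on UNIV" by simp
  then have "(\<lambda>p. C * (case p of (i, j) \<Rightarrow> norm ((1/2 :: real) ^ i * (1/2) ^ j))) summable_on UNIV"
    by (intro summable_on_cmult_right) auto
  then have "(\<lambda>(i, j). norm (fps_nth (fps_nth F j) i) * r ^ i * r ^ j) summable_on UNIV"
  proof (rule summable_on_comparison_test)
    fix p :: "nat \<times> nat"
    obtain i j where p: "p = (i, j)" by force
    have "norm (fps_nth (fps_nth F j) i) * (r ^ i * r ^ j) \<le> C * R ^ (i + j) * (r ^ i * r ^ j)"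
      by (rule mult_right_mono[OF b]) (use r in auto)
    also have "\<dots> = C * ((R * r) ^ i * (R * r) ^ j)"
      by (simp add: power_mult_distrib power_add)
    also have "R * r = 1 / 2" using CR by (simp add: r_def)
    finally show "(case p of (i, j) \<Rightarrow> norm (fps_nth (fps_nth F j) i) * r ^ i * r ^ j)
        \<le> C * (case p of (i, j) \<Rightarrow> norm ((1/2 :: real) ^ i * (1/2) ^ j))"
      by (simp add: p norm_mult norm_power mult.assoc)
    show "0 \<le> (case p of (i, j) \<Rightarrow> norm (fps_nth (fps_nth F j) i) * r ^ i * r ^ j)"
      using r by (simp add: p)
  qed
  then show "convergent2 F" unfolding convergent2_def using r by blast
qed

lemma convergent2I:
  assumes "C > 0" "R > 0" "\<And>i j. norm (fps_nth (fps_nth F j) i) \<le> C * R ^ (i + j)"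
  shows "convergent2 F"
  using assms unfolding convergent2_iff_bound by blast

lemma convergent2_bounded:
  assumes "\<And>i j. norm (fps_nth (fps_nth F j) i) \<le> C"
  shows "convergent2 F"
  by (rule convergent2I[of "max C 1" 1]) (use assms in \<open>auto simp: le_max_iff_disj\<close>)

lemma convergent2E:
  assumes "convergent2 F"
  obtains C R where "C > 0" "R \<ge> 1" "\<And>i j. norm (fps_nth (fps_nth F j) i) \<le> C * R ^ (i + j)"
proof -
  obtain C R where *: "C > 0" "R > (0::real)" "\<And>i j. norm (fps_nth (fps_nth F j) i) \<le> C * R ^ (i + j)"
    using assms unfolding convergent2_iff_bound by blast
  have "C * R ^ n \<le> C * (max R 1) ^ n" for n
    using * by (intro mult_left_mono power_mono) auto
  with * show ?thesis by (meson that[of C "max R 1"] max.cobounded2 order_trans)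
qed

lemma convergent2_mono:
  assumes "convergent2 F" "\<And>i j. norm (fps_nth (fps_nth G j) i) \<le> norm (fps_nth (fps_nth F j) i)"
  shows "convergent2 G"
  using assms unfolding convergent2_iff_bound by (meson order_trans)

lemma convergent2_add:
  assumes "convergent2 F" "convergent2 G"
  shows "convergent2 (F + G)"
proof -
  obtain C R where F: "C > 0" "R \<ge> 1" "\<And>i j. norm (fps_nth (fps_nth F j) i) \<le> C * R ^ (i + j)"
    using assms(1) by (rule convergent2E) blast
  obtain D S where G: "D > 0" "S \<ge> 1" "\<And>i j. norm (fps_nth (fps_nth G j) i) \<le> D * S ^ (i + j)"
    using assms(2) by (rule convergent2E) blast
  show ?thesis
  proof (rule convergent2I[of "C + D" "max R S"])
    fix i j
    have "norm (fps_nth (fps_nth (F + G) j) i) \<le> C * R ^ (i + j) + D * S ^ (i + j)"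
      using F(3)[of j i] G(3)[of j i] norm_triangle_ineq[of "fps_nth (fps_nth F j) i" "fps_nth (fps_nth G j) i"]
      by simp
    also have "\<dots> \<le> C * max R S ^ (i + j) + D * max R S ^ (i + j)"
      using F G by (intro add_mono mult_left_mono power_mono) auto
    finally show "norm (fps_nth (fps_nth (F + G) j) i) \<le> (C + D) * max R S ^ (i + j)"
      by (simp add: algebra_simps)
  qed (use F G in auto)
qed

lemma convergent2_mult:
  assumes "convergent2 F" "convergent2 G"
  shows "convergent2 (F * G)"
proof -
  obtain C R where F: "C > 0" "R \<ge> 1" "\<And>i j. norm (fps_nth (fps_nth F j) i) \<le> C * R ^ (i + j)"
    using assms(1) by (rule convergent2E) blast
  obtain D S where G: "D > 0" "S \<ge> 1" "\<And>i j. norm (fps_nth (fps_nth G j) i) \<le> D * S ^ (i + j)"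
    using assms(2) by (rule convergent2E) blast
  define M where "M = max R S"
  have M: "M \<ge> 1" using F by (simp add: M_def)
  have F': "norm (fps_nth (fps_nth F j) i) \<le> C * M ^ (i + j)" for i j
    using F by (intro order_trans[OF F(3)] mult_left_mono power_mono) (auto simp: M_def)
  have G': "norm (fps_nth (fps_nth G j) i) \<le> D * M ^ (i + j)" for i j
    using G by (intro order_trans[OF G(3)] mult_left_mono power_mono) (auto simp: M_def)
  show ?thesis
  proof (rule convergent2I[of "C * D" "2 * M"])
    fix i j
    have "norm (fps_nth (fps_nth (F * G) j) i) =
        norm (\<Sum>b=0..j. \<Sum>a=0..i. fps_nth (fps_nth F b) a * fps_nth (fps_nth G (j - b)) (i - a))"
      by (simp add: fps_mult_nth fps_sum_nth)
    also have "\<dots> \<le> (\<Sum>b=0..j. \<Sum>a=0..i. C * D * M ^ (i + j))"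
    proof (intro sum_norm_le)
      fix b a assume b: "b \<in> {0..j}" and a: "a \<in> {0..i}"
      have "norm (fps_nth (fps_nth F b) a * fps_nth (fps_nth G (j - b)) (i - a))
          \<le> (C * M ^ (a + b)) * (D * M ^ ((i - a) + (j - b)))"
        unfolding norm_mult using F G M by (intro mult_mono F' G') auto
      also have "\<dots> = C * D * M ^ ((a + b) + ((i - a) + (j - b)))"
        by (simp add: power_add)
      also have "(a + b) + ((i - a) + (j - b)) = i + j" using a b by auto
      finally show "norm (fps_nth (fps_nth F b) a * fps_nth (fps_nth G (j - b)) (i - a)) \<le> C * D * M ^ (i + j)" .
    qed
    also have "\<dots> = C * D * M ^ (i + j) * (real (Suc i) * real (Suc j))"
      by (simp add: algebra_simps)
    also have "\<dots> \<le> C * D * M ^ (i + j) * (2 ^ i * 2 ^ j)"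
    proof -
      have "real (Suc n) \<le> 2 ^ n" for n
        using less_exp[of n] by (metis Suc_leI of_nat_le_iff of_nat_numeral of_nat_power)
      then show ?thesis using F G M by (intro mult_left_mono mult_mono) auto
    qed
    also have "\<dots> = C * D * (2 * M) ^ (i + j)"
      by (simp add: power_add power_mult_distrib)
    finally show "norm (fps_nth (fps_nth (F * G) j) i) \<le> C * D * (2 * M) ^ (i + j)" .
  qed (use F G M in auto)
qed

lemma convergent2_uminus: "convergent2 F \<Longrightarrow> convergent2 (- F)"
  by (erule convergent2_mono) simp

lemma convergent2_deriv_bound:
  assumes "convergent2 F"
  shows "convergent2 (Abs_fps (\<lambda>j. fps_deriv (fps_nth F j)))" "convergent2 (fps_deriv F)"
proof -
  obtain C R where F: "C > 0" "R \<ge> 1" "\<And>i j. norm (fps_nth (fps_nth F j) i) \<le> C * R ^ (i + j)"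
    using assms by (rule convergent2E) blast
  have pow: "real (Suc m) \<le> 2 ^ (m + n)" for m n
  proof -
    have "real (Suc m) \<le> 2 ^ m"
      using less_exp[of m] by (metis Suc_leI of_nat_le_iff of_nat_numeral of_nat_power)
    also have "(2::real) ^ m \<le> 2 ^ (m + n)" by (rule power_increasing) auto
    finally show ?thesis .
  qed
  have key: "real (Suc m) * (C * R ^ Suc (m + n)) \<le> C * R * (2 * R) ^ (m + n)" for m n
  proof -
    have "real (Suc m) * (C * R ^ Suc (m + n)) \<le> 2 ^ (m + n) * (C * R ^ Suc (m + n))"
      using F by (intro mult_right_mono pow) auto
    then show ?thesis by (simp add: power_mult_distrib algebra_simps)
  qed
  show "convergent2 (Abs_fps (\<lambda>j. fps_deriv (fps_nth F j)))"
  proof (rule convergent2I[of "C * R" "2 * R"])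
    fix i j
    have "norm (fps_nth (fps_nth (Abs_fps (\<lambda>j. fps_deriv (fps_nth F j))) j) i)
        = real (Suc i) * norm (fps_nth (fps_nth F j) (Suc i))"
      by (simp add: norm_mult del: of_nat_Suc)
    also have "\<dots> \<le> real (Suc i) * (C * R ^ Suc (i + j))"
      using F(3)[of j "Suc i"] by (intro mult_left_mono) auto
    also note key
    finally show "norm (fps_nth (fps_nth (Abs_fps (\<lambda>j. fps_deriv (fps_nth F j))) j) i)
        \<le> C * R * (2 * R) ^ (i + j)" .
  qed (use F in auto)
  show "convergent2 (fps_deriv F)"
  proof (rule convergent2I[of "C * R" "2 * R"])
    fix i j
    have *: "of_nat n * G = fps_const (of_nat n) * G" for n and G :: "complex fps"
      by (simp add: fps_of_nat)
    have "norm (fps_nth (fps_nth (fps_deriv F) j) i)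
        = real (Suc j) * norm (fps_nth (fps_nth F (Suc j)) i)"
      by (simp only: fps_deriv_nth Suc_eq_plus1[symmetric] * fps_mult_left_const_nth norm_mult norm_of_nat)
    also have "\<dots> \<le> real (Suc j) * (C * R ^ Suc (j + i))"
      using F(3)[of "Suc j" i] by (intro mult_left_mono) (auto simp: add.commute)
    also note key
    finally show "norm (fps_nth (fps_nth (fps_deriv F) j) i) \<le> C * R * (2 * R) ^ (i + j)"
      by (simp add: add.commute)
  qed (use F in auto)
qed

lemma convergent2_const: "convergent2 (fps_const (fps_const c))"
  by (rule convergent2_bounded[of _ "norm c"]) (simp add: fps_const_def)

lemma convergent2_X: "convergent2 (fps_const fps_X)" "convergent2 fps_X"
  by (rule convergent2_bounded[of _ 1], simp add: fps_const_def fps_X_def fps_one_nth)+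

typedef cps2 = "{F. convergent2 F}"
  using convergent2_const[of 0] by blast

setup_lifting type_definition_cps2

instantiation cps2 :: idom
begin

lift_definition zero_cps2 :: cps2 is 0
  using convergent2_const[of 0] by simp
lift_definition one_cps2 :: cps2 is 1
  using convergent2_const[of 1] by simp
lift_definition plus_cps2 :: "cps2 \<Rightarrow> cps2 \<Rightarrow> cps2" is "(+)"
  by (rule convergent2_add)
lift_definition uminus_cps2 :: "cps2 \<Rightarrow> cps2" is uminus
  by (rule convergent2_uminus)
lift_definition minus_cps2 :: "cps2 \<Rightarrow> cps2 \<Rightarrow> cps2" is "(-)"
  using convergent2_add convergent2_uminus by (metis add_uminus_conv_diff)
lift_definition times_cps2 :: "cps2 \<Rightarrow> cps2 \<Rightarrow> cps2" is "(*)"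
  by (rule convergent2_mult)

instance
  by standard (transfer; simp add: algebra_simps)+

end

lift_definition const2 :: "complex \<Rightarrow> cps2" is "\<lambda>c. fps_const (fps_const c)"
  by (rule convergent2_const)
lift_definition X2 :: cps2 is "fps_const fps_X"
  by (rule convergent2_X)
lift_definition Y2 :: cps2 is fps_X
  by (rule convergent2_X)

lift_definition coeff2 :: "cps2 \<Rightarrow> nat \<Rightarrow> nat \<Rightarrow> complex" is
  "\<lambda>F i j. fps_nth (fps_nth F j) i" .

lift_definition deriv_x :: "cps2 \<Rightarrow> cps2" is "\<lambda>F. Abs_fps (\<lambda>j. fps_deriv (fps_nth F j))"
  by (rule convergent2_deriv_bound)
lift_definition deriv_y :: "cps2 \<Rightarrow> cps2" is fps_deriv
  by (rule convergent2_deriv_bound)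

text \<open>The value of the germ at a point; meaningful only for $(x, y)$ close to the origin (the
  junk value outside the domain of convergence is $0$).\<close>

definition eval2 :: "cps2 \<Rightarrow> complex \<Rightarrow> complex \<Rightarrow> complex" where
  "eval2 F x y = (\<Sum>\<^sub>\<infinity>(i, j)\<in>UNIV. coeff2 F i j * x ^ i * y ^ j)"

text \<open>The series $F(a(t), b(t))$, for $a$ and $b$ without constant term. Since $b^j$ has order at
  least $j$, only the terms with $j \le n$ contribute to the coefficient of $t^n$.\<close>

definition subst2 :: "cps2 \<Rightarrow> complex fps \<Rightarrow> complex fps \<Rightarrow> complex fps" where
  "subst2 F a b =
     Abs_fps (\<lambda>n. \<Sum>j\<le>n. fps_nth (fps_compose (Abs_fps (\<lambda>i. coeff2 F i j)) a * b ^ j) n)"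


section \<open>Plane curve germs\<close>

definition singular_at :: "cps2 \<Rightarrow> complex \<Rightarrow> complex \<Rightarrow> bool" where
  "singular_at f x y \<longleftrightarrow> eval2 f x y = 0 \<and> eval2 (deriv_x f) x y = 0 \<and> eval2 (deriv_y f) x y = 0"

definition isolated_singularity :: "cps2 \<Rightarrow> bool" where
  "isolated_singularity f \<longleftrightarrow>
     singular_at f 0 0 \<and>
     (\<exists>\<epsilon>>0. \<forall>x y. norm x < \<epsilon> \<and> norm y < \<epsilon> \<and> (x, y) \<noteq> (0, 0) \<longrightarrow> \<not> singular_at f x y)"

definition smooth_curve :: "cps2 \<Rightarrow> bool" where
  "smooth_curve l \<longleftrightarrow> eval2 l 0 0 = 0 \<and> \<not> singular_at l 0 0"

definition jacobian :: "cps2 \<Rightarrow> cps2 \<Rightarrow> cps2" where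
  "jacobian l f = deriv_x l * deriv_y f - deriv_y l * deriv_x f"


section \<open>Direct images and the discriminant\<close>

definition local_param :: "complex fps \<Rightarrow> bool" where
  "local_param a \<longleftrightarrow> fps_conv_radius a > 0 \<and> fps_nth a 0 = 0"

text \<open>\<open>t \<mapsto> (a t, b t)\<close> is a primitive parametrization of the branch \<open>h = 0\<close>: it does not
  factor through a change of parameter of order greater than one, i.e. it is generically
  one-to-one. (This excludes \<open>a = b = 0\<close>.)\<close>

definition primitive_param :: "cps2 \<Rightarrow> complex fps \<Rightarrow> complex fps \<Rightarrow> bool" where
  "primitive_param h a b \<longleftrightarrow>
     local_param a \<and> local_param b \<and> subst2 h a b = 0 \<and>
     \<not> (\<exists>A B \<tau>. local_param A \<and> local_param B \<and> local_param \<tau> \<and> subdegree \<tau> \<ge> 2 \<and>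
          a = fps_compose A \<tau> \<and> b = fps_compose B \<tau>)"

text \<open>The direct image of a branch \<open>h = 0\<close> under \<open>(u, v) = (l, f)\<close> is its image branch \<open>g = 0\<close>
  counted with the degree of the induced map of branches. With primitive parametrizations of
  both branches, that map is a change of parameter \<open>\<tau>\<close>, and its degree is the order of \<open>\<tau>\<close>.\<close>

definition direct_image_branch :: "cps2 \<Rightarrow> cps2 \<Rightarrow> cps2 \<Rightarrow> cps2 \<Rightarrow> bool" where
  "direct_image_branch l f h G \<longleftrightarrow>
     (\<exists>a b g A B \<tau>. irreducible h \<and> primitive_param h a b \<and>
        irreducible g \<and> primitive_param g A B \<and>
        local_param \<tau> \<and> \<tau> \<noteq> 0 \<and>
        subst2 l a b = fps_compose A \<tau> \<and> subst2 f a b = fps_compose B \<tau> \<and>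
        G = g ^ subdegree \<tau>)"

text \<open>\<open>D = 0\<close> is the direct image of the curve \<open>J = 0\<close>, every branch of \<open>J\<close> being repeated in the
  list \<open>hs\<close> according to its multiplicity.\<close>

definition direct_image :: "cps2 \<Rightarrow> cps2 \<Rightarrow> cps2 \<Rightarrow> cps2 \<Rightarrow> bool" where
  "direct_image l f J D \<longleftrightarrow>
     (\<exists>hs Gs e e'. e dvd 1 \<and> e' dvd 1 \<and> J = e * prod_list hs \<and> D = e' * prod_list Gs \<and>
        list_all2 (direct_image_branch l f) hs Gs)"

definition is_discriminant :: "cps2 \<Rightarrow> cps2 \<Rightarrow> cps2 \<Rightarrow> bool" where
  "is_discriminant l f D \<longleftrightarrow> direct_image l f (jacobian l f) D"


section \<open>Newton diagrams and non-degeneracy\<close>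

definition newton_diagram :: "cps2 \<Rightarrow> (real \<times> real) set" where
  "newton_diagram g =
     convex hull {(real i + s, real j + t) | i j s t. coeff2 g i j \<noteq> 0 \<and> s \<ge> 0 \<and> t \<ge> 0}"

definition compact_edges :: "cps2 \<Rightarrow> (real \<times> real) set set" where
  "compact_edges g = {S. S edge_of newton_diagram g \<and> compact S}"

lift_definition restrict_to :: "cps2 \<Rightarrow> (real \<times> real) set \<Rightarrow> cps2" is
  "\<lambda>F S. Abs_fps (\<lambda>j. Abs_fps (\<lambda>i. if (real i, real j) \<in> S then fps_nth (fps_nth F j) i else 0))"
  by (erule convergent2_mono) simp

text \<open>The factorization $g_S = c\,x^k y^l \prod_{a \in A} (y^{q} - a x^{p})^{s(a)}$ of the part of
  $g$ on the edge $S$; it is unique, \<open>s\<close> being relevant only on \<open>A\<close>.\<close>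

definition edge_factorization ::
    "cps2 \<Rightarrow> (real \<times> real) set \<Rightarrow> complex \<Rightarrow> nat \<Rightarrow> nat \<Rightarrow> nat \<Rightarrow> nat \<Rightarrow>
     complex set \<Rightarrow> (complex \<Rightarrow> nat) \<Rightarrow> bool" where
  "edge_factorization g S c k l p q A s \<longleftrightarrow>
     c \<noteq> 0 \<and> p > 0 \<and> q > 0 \<and> coprime p q \<and> finite A \<and> 0 \<notin> A \<and> (\<forall>a\<in>A. s a > 0) \<and>
     restrict_to g S = const2 c * X2 ^ k * Y2 ^ l * (\<Prod>a\<in>A. (Y2 ^ q - const2 a * X2 ^ p) ^ s a)"

definition non_degenerate_on :: "cps2 \<Rightarrow> (real \<times> real) set \<Rightarrow> bool" where
  "non_degenerate_on g S \<longleftrightarrow>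
     (\<exists>c k l p q A s. edge_factorization g S c k l p q A s \<and> (\<forall>a\<in>A. s a = 1))"

definition non_degenerate :: "cps2 \<Rightarrow> bool" where
  "non_degenerate g \<longleftrightarrow> (\<forall>S\<in>compact_edges g. non_degenerate_on g S)"

end

theory Submission
  imports Defs "HOL-Computational_Algebra.Computational_Algebra"
begin

unbundle no vec_syntax
unbundle fps_syntax

text \<open>In coordinates with \<open>l = x\<close>, the branch \<open>f = 0\<close> has conjugate Puiseux roots, and \<open>f\<close> is a unit times
  the product of the factors \<open>y - \<alpha>\<close> over these roots. Let \<open>\<gamma>\<close> be a root of the derivative of \<open>f\<close> with
  respect to \<open>y\<close>, let \<open>K\<close> be its maximal order of contact with a root of \<open>f\<close>, attained at \<open>\<alpha>\<close>, let \<open>c\<close> be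
  the coefficient of \<open>\<gamma>\<close> at \<open>x^K\<close>, and let \<open>b\<close> run through the coefficients at \<open>x^K\<close> of the conjugates that
  agree with \<open>\<alpha>\<close> below \<open>K\<close>. The vanishing of the logarithmic derivative at \<open>\<gamma>\<close> gives
  \<open>\<Sum> 1 / (c - b) = 0\<close>; as the \<open>b\<close> are stable under a group of roots of unity that acts transitively on
  them, \<open>c = 0\<close>. Hence \<open>K\<close> determines the leading term of \<open>f(x, \<gamma>)\<close> up to conjugation, and since the order
  of \<open>f(x, \<gamma>)\<close> is strictly increasing in \<open>K\<close>, so does this order. Therefore the part of the discriminant
  on an edge has the form \<open>c u^k v^l (v^q - a u^p)^s\<close> with a single \<open>a\<close>, and both conditions of the theorem
  say that \<open>s = 1\<close>.

  Convergence enters only through the fact that an irreducible convergent series remains irreducible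
  among formal series, which rests on the convergent Newton-Puiseux theorem.\<close>

section \<open>Substitution into power series in two variables\<close>

text \<open>The discriminant enters only through the nonzero roots of its lowest-weight parts. These
  parts are multiplicative, so the single \<open>a\<close> amounts to an equality of q-th powers for
  roots belonging to any two branches of the discriminant; degrees and multiplicities of the direct
  image never have to be computed. Puiseux series are replaced by power series in t after x = t^m,
  and conjugation by t -> \<omega> t with \<omega>^m = 1; a common multiple of the ramification
  indices allows two polar roots to be compared. The logarithmic derivative alone confines c only to
  the critical points, off the roots, of the product of all z - b, and two such points could give
  different leading terms. Irreducibility removes this freedom: if the coefficient of \<alpha> at
  x^K is not 0, the product is a power of a binomial z^e - const, which has no critical point off
  its roots other than 0. Formal irreducibility is needed because arcs are reparametrized and series
  are factored formally, whereas the branches are given as irreducible convergent series.\<close>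

lemma fps_pow_mult_nth_eq_0:
  fixes b c :: "'a::comm_ring_1 fps"
  assumes "fps_nth b 0 = 0" "n < j"
  shows "fps_nth (c * b ^ j) n = 0"
proof -
  have "\<forall>n<j. fps_nth (b ^ j) n = 0" by (rule startsby_zero_power_prefix[OF assms(1)])
  then show ?thesis using assms(2) unfolding fps_mult_nth by (intro sum.neutral) auto
qed

text \<open>Substitution of \<open>b\<close> for the outer variable y. The cut at n is exact as soon
  as \<open>b\<close> has no constant term, because the j-th term then has order at least j.\<close>

definition ev :: "'a::comm_ring_1 fps fps \<Rightarrow> 'a fps \<Rightarrow> 'a fps" where
  "ev G b = Abs_fps (\<lambda>n. \<Sum>j\<le>n. fps_nth (fps_nth G j * b ^ j) n)"

lemma ev_nth:
  assumes "fps_nth b 0 = 0" "n \<le> N"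
  shows "fps_nth (ev G b) n = fps_nth (\<Sum>j\<le>N. fps_nth G j * b ^ j) n"
proof -
  have "(\<Sum>j\<le>N. fps_nth (fps_nth G j * b ^ j) n) = (\<Sum>j\<le>n. fps_nth (fps_nth G j * b ^ j) n)"
    by (rule sum.mono_neutral_right) (use assms fps_pow_mult_nth_eq_0[OF assms(1)] in auto)
  then show ?thesis by (simp add: ev_def fps_sum_nth)
qed

lemma ev_add [simp]: "ev (F + G) b = ev F b + ev G b"
  by (rule fps_ext) (simp add: ev_def sum.distrib ring_distribs)

lemma ev_uminus [simp]: "ev (- F) b = - ev F b"
  by (rule fps_ext) (simp add: ev_def sum_negf)

lemma ev_diff [simp]: "ev (F - G) b = ev F b - ev G b"
  using ev_add[of F "- G" b] by simp

lemma ev_const [simp]: "ev (fps_const c) b = c"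
proof (rule fps_ext)
  fix n
  have "fps_nth (ev (fps_const c) b) n = (\<Sum>j\<le>n. if j = 0 then fps_nth c n else 0)"
    unfolding ev_def fps_nth_Abs_fps by (rule sum.cong) auto
  then show "fps_nth (ev (fps_const c) b) n = fps_nth c n" by simp
qed

lemma ev_0 [simp]: "ev 0 b = 0" using ev_const[of 0] by simp
lemma ev_1 [simp]: "ev 1 b = 1" using ev_const[of 1] by simp

lemma ev_X [simp]:
  assumes "fps_nth b 0 = 0"
  shows "ev fps_X b = b"
proof (rule fps_ext)
  fix n
  have "fps_nth (ev fps_X b) n = fps_nth (\<Sum>j\<le>Suc n. fps_nth fps_X j * b ^ j) n"
    by (rule ev_nth) (use assms in auto)
  also have "(\<Sum>j\<le>Suc n. fps_nth fps_X j * b ^ j) = (\<Sum>j\<in>{1}. fps_nth fps_X j * b ^ j)"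
    by (rule sum.mono_neutral_right) (auto simp: fps_X_def)
  finally show "fps_nth (ev fps_X b) n = fps_nth b n" by simp
qed

lemma sum_square_triangle:
  fixes f :: "nat \<Rightarrow> nat \<Rightarrow> 'a::comm_monoid_add"
  assumes "\<And>j k. j + k > n \<Longrightarrow> f j k = 0"
  shows "(\<Sum>j\<le>n. \<Sum>k\<le>n. f j k) = (\<Sum>m\<le>n. \<Sum>j\<le>m. f j (m - j))"
proof -
  have le: "j + k \<le> n" if "f j k \<noteq> 0" for j k
    using assms[of j k] that by (meson not_le)
  have "(\<Sum>j\<le>n. \<Sum>k\<le>n. f j k) = (\<Sum>(j, k)\<in>{..n} \<times> {..n}. f j k)"
    by (simp add: sum.cartesian_product)
  also have "\<dots> = (\<Sum>(j, k)\<in>{(j, k). j + k \<le> n}. f j k)"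
    by (rule sum.mono_neutral_right) (auto dest: le)
  also have "\<dots> = (\<Sum>m\<le>n. \<Sum>j\<le>m. f j (m - j))"
    by (rule sum.triangle_reindex_eq)
  finally show ?thesis .
qed

lemma ev_mult [simp]:
  assumes b: "fps_nth b 0 = 0"
  shows "ev (F * G) b = ev F b * ev G b"
proof (rule fps_ext)
  fix n
  define SF where "SF = (\<Sum>j\<le>n. fps_nth F j * b ^ j)"
  define SG where "SG = (\<Sum>j\<le>n. fps_nth G j * b ^ j)"
  have "fps_nth (ev F b * ev G b) n = fps_nth (SF * SG) n"
    unfolding fps_mult_nth SF_def SG_def
    by (intro sum.cong refl arg_cong2[of _ _ _ _ "(*)"] ev_nth[OF b]) auto
  also have "SF * SG = (\<Sum>j\<le>n. \<Sum>k\<le>n. fps_nth F j * fps_nth G k * b ^ (j + k))"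
    unfolding SF_def SG_def by (simp add: sum_product power_add mult_ac)
  also have "fps_nth \<dots> n = (\<Sum>j\<le>n. \<Sum>k\<le>n. fps_nth (fps_nth F j * fps_nth G k * b ^ (j + k)) n)"
    by (simp add: fps_sum_nth)
  \<comment> \<open>A term with j + k > n has order above n, so the square of index pairs may be cut
    down to the triangle that forms the Cauchy product.\<close>
  also have "\<dots> = (\<Sum>m\<le>n. \<Sum>j\<le>m. fps_nth (fps_nth F j * fps_nth G (m - j) * b ^ (j + (m - j))) n)"
    by (rule sum_square_triangle) (rule fps_pow_mult_nth_eq_0[OF b])
  also have "\<dots> = (\<Sum>m\<le>n. fps_nth (fps_nth (F * G) m * b ^ m) n)"
    by (rule sum.cong[OF refl]) (simp add: fps_mult_nth sum_distrib_right fps_sum_nth atMost_atLeast0)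
  finally show "fps_nth (ev (F * G) b) n = fps_nth (ev F b * ev G b) n" by (simp add: ev_def)
qed

lemma ev_sum: "ev (\<Sum>i\<in>A. F i) b = (\<Sum>i\<in>A. ev (F i) b)"
  by (induction A rule: infinite_finite_induct) auto

lemma ev_prod: "fps_nth b 0 = 0 \<Longrightarrow> ev (\<Prod>i\<in>A. F i) b = (\<Prod>i\<in>A. ev (F i) b)"
  by (induction A rule: infinite_finite_induct) auto

lemma ev_nth_0 [simp]: "fps_nth (ev G b) 0 = fps_nth (fps_nth G 0) 0"
  by (simp add: ev_def)

text \<open>Unfolding the recursion N times leaves the remainder \<open>A N * L ^ N\<close> of order
  at least N, which does not reach the coefficient of index n < N. It serves to evaluate the
  expansion of a germ by powers of l.\<close>

lemma ev_recursion:
  assumes "\<And>k. A k = \<alpha> k + L * A (Suc k)" "fps_nth L 0 = 0"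
  shows "A 0 = ev (Abs_fps \<alpha>) L"
proof (rule fps_ext)
  fix n
  have *: "A 0 = (\<Sum>k<N. \<alpha> k * L ^ k) + A N * L ^ N" for N
  proof (induction N)
    case (Suc N)
    have "A N * L ^ N = \<alpha> N * L ^ N + A (Suc N) * L ^ Suc N"
      by (subst assms(1)) (simp add: algebra_simps)
    then show ?case using Suc by (simp add: algebra_simps)
  qed simp
  have "fps_nth (A 0) n = fps_nth (\<Sum>k<Suc n. \<alpha> k * L ^ k) n"
    by (subst *[of "Suc n"]) (simp add: fps_pow_mult_nth_eq_0[OF assms(2)] del: sum.lessThan_Suc power_Suc)
  then show "fps_nth (A 0) n = fps_nth (ev (Abs_fps \<alpha>) L) n"
    using ev_nth[OF assms(2), of n n "Abs_fps \<alpha>"] by (simp add: lessThan_Suc_atMost)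
qed

text \<open>Substitution of \<open>c\<close> for the inner variable x. With
  \<open>c = fps_X ^ m\<close> it is the ramified cover x = t^m, with
  \<open>c = rot \<omega>\<close> conjugation, and with \<open>c = 0\<close> restriction to x =
  0.\<close>

definition sx :: "'a::idom fps \<Rightarrow> 'a fps fps \<Rightarrow> 'a fps fps" where
  "sx c G = Abs_fps (\<lambda>j. fps_nth G j oo c)"

lemma sx_nth [simp]: "fps_nth (sx c G) j = fps_nth G j oo c"
  by (simp add: sx_def)

lemma sx_add [simp]: "sx c (F + G) = sx c F + sx c G"
  by (rule fps_ext) (simp add: fps_compose_add_distrib)
lemma sx_uminus [simp]: "sx c (- F) = - sx c F"
  by (rule fps_ext) (simp add: fps_compose_uminus)
lemma sx_diff [simp]: "sx c (F - G) = sx c F - sx c G"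
  by (rule fps_ext) (simp add: fps_compose_sub_distrib)
lemma sx_mult [simp]:
  assumes "fps_nth c 0 = 0"
  shows "sx c (F * G) = sx c F * sx c G"
  by (rule fps_ext) (simp add: fps_mult_nth fps_compose_sum_distrib fps_compose_mult_distrib[OF assms])
lemma sx_const [simp]: "sx c (fps_const a) = fps_const (a oo c)"
  by (rule fps_ext) (simp add: fps_const_def)
lemma sx_0 [simp]: "sx c 0 = 0" using sx_const[of c 0] by simp
lemma sx_1 [simp]: "sx c 1 = 1" by (rule fps_ext) (simp add: fps_one_nth)
lemma sx_X [simp]: "sx c fps_X = fps_X"
  by (rule fps_ext) (simp add: fps_X_def)
lemma sx_prod: "fps_nth c 0 = 0 \<Longrightarrow> sx c (\<Prod>i\<in>A. F i) = (\<Prod>i\<in>A. sx c (F i))"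
  by (induction A rule: infinite_finite_induct) auto
lemma sx_deriv: "sx c (fps_deriv F) = fps_deriv (sx c F)"
  for F :: "'a::idom fps fps"
proof (rule fps_ext)
  fix n
  have *: "(of_nat m :: 'a fps) * a = fps_const (of_nat m) * a" for m and a :: "'a fps"
    by (simp add: fps_of_nat)
  have "(fps_const k * a) oo c = fps_const k * (a oo c)" for k and a :: "'a fps"
    by (rule fps_ext) (simp add: fps_compose_nth sum_distrib_left mult_ac)
  then show "fps_nth (sx c (fps_deriv F)) n = fps_nth (fps_deriv (sx c F)) n"
    by (simp only: fps_deriv_nth sx_nth *)
qed
lemma sx_X_id [simp]: "sx fps_X F = F"
  by (rule fps_ext) simp

lemma compose_ev:
  fixes b c :: "'a::idom fps"
  assumes b: "fps_nth b 0 = 0" and c: "fps_nth c 0 = 0"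
  shows "ev G b oo c = ev (sx c G) (b oo c)"
proof (rule fps_ext)
  fix n
  have bc: "fps_nth (b oo c) 0 = 0" using b by simp
  have "fps_nth (ev G b oo c) n = (\<Sum>i=0..n. fps_nth (ev G b) i * fps_nth (c ^ i) n)"
    by (simp add: fps_compose_nth)
  also have "\<dots> = (\<Sum>i=0..n. fps_nth (\<Sum>j\<le>n. fps_nth G j * b ^ j) i * fps_nth (c ^ i) n)"
    by (intro sum.cong refl arg_cong2[of _ _ _ _ "(*)"] ev_nth[OF b]) auto
  also have "\<dots> = fps_nth ((\<Sum>j\<le>n. fps_nth G j * b ^ j) oo c) n"
    by (simp add: fps_compose_nth)
  also have "(\<Sum>j\<le>n. fps_nth G j * b ^ j) oo c = (\<Sum>j\<le>n. fps_nth (sx c G) j * (b oo c) ^ j)"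
    by (simp add: fps_compose_sum_distrib fps_compose_mult_distrib[OF c] fps_compose_power[OF c])
  also have "fps_nth \<dots> n = fps_nth (ev (sx c G) (b oo c)) n"
    by (rule ev_nth[OF bc, symmetric]) simp
  finally show "fps_nth (ev G b oo c) n = fps_nth (ev (sx c G) (b oo c)) n" .
qed

text \<open>The series F(a, b) over any integral domain. The generality matters: it is also applied
  over polynomial rings.\<close>

definition psubst :: "'a::idom fps fps \<Rightarrow> 'a fps \<Rightarrow> 'a fps \<Rightarrow> 'a fps" where
  "psubst F a b = ev (sx a F) b"

lemma psubst_add [simp]: "psubst (F + G) a b = psubst F a b + psubst G a b"
  and psubst_diff [simp]: "psubst (F - G) a b = psubst F a b - psubst G a b"
  and psubst_uminus [simp]: "psubst (- F) a b = - psubst F a b"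
  and psubst_const [simp]: "psubst (fps_const c) a b = c oo a"
  and psubst_0 [simp]: "psubst 0 a b = 0"
  and psubst_1 [simp]: "psubst 1 a b = 1"
  by (simp_all add: psubst_def)

lemma psubst_mult [simp]:
  "fps_nth a 0 = 0 \<Longrightarrow> fps_nth b 0 = 0 \<Longrightarrow> psubst (F * G) a b = psubst F a b * psubst G a b"
  by (simp add: psubst_def)

lemma psubst_X [simp]: "fps_nth b 0 = 0 \<Longrightarrow> psubst fps_X a b = b"
  by (simp add: psubst_def)

lemma psubst_nth_0 [simp]: "fps_nth (psubst F a b) 0 = fps_nth (fps_nth F 0) 0"
  by (simp add: psubst_def)

lemma psubst_sx: "fps_nth a 0 = 0 \<Longrightarrow> fps_nth c 0 = 0 \<Longrightarrow> psubst (sx c F) a b = psubst F (c oo a) b"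
  unfolding psubst_def by (rule arg_cong2[of _ _ _ _ ev]) (auto intro!: fps_ext simp: fps_compose_assoc)

lemma compose_psubst:
  fixes a b c :: "'a::idom fps"
  assumes "fps_nth a 0 = 0" "fps_nth b 0 = 0" "fps_nth c 0 = 0"
  shows "psubst F a b oo c = psubst F (a oo c) (b oo c)"
proof -
  have "sx c (sx a F) = sx (a oo c) F"
    by (rule fps_ext) (simp add: fps_compose_assoc assms)
  then show ?thesis using assms by (simp add: psubst_def compose_ev)
qed

lemma subst2_eq_psubst: "subst2 F a b = psubst (Rep_cps2 F) a b"
proof -
  have *: "Abs_fps (coeff2 F' j) = X" if "\<And>i. coeff2 F' j i = fps_nth X i" for F' j X
    using that by (auto intro: fps_ext)
  have "Abs_fps (\<lambda>i. coeff2 F i j) = fps_nth (Rep_cps2 F) j" for j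
    by (rule fps_ext) (simp add: coeff2.rep_eq)
  then show ?thesis by (simp add: subst2_def psubst_def ev_def)
qed

section \<open>Weierstrass division\<close>

lemma fps2_mult_nth:
  "(F * G) $ J $ I = (\<Sum>(a, b)\<in>{..I} \<times> {..J}. F $ b $ a * G $ (J - b) $ (I - a))"
  for F G :: "'a::comm_ring_1 fps fps"
proof -
  have "(F * G) $ J $ I = (\<Sum>b\<le>J. \<Sum>a\<le>I. F $ b $ a * G $ (J - b) $ (I - a))"
    by (simp add: fps_mult_nth fps_sum_nth atMost_atLeast0)
  also have "\<dots> = (\<Sum>a\<le>I. \<Sum>b\<le>J. F $ b $ a * G $ (J - b) $ (I - a))"
    by (rule sum.swap)
  finally show ?thesis by (simp add: sum.cartesian_product)
qed

text \<open>Regularity in the sense of Weierstrass: n is the order of h(0, y).\<close>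

definition regular :: "nat \<Rightarrow> 'a::zero fps fps \<Rightarrow> bool" where
  "regular n h \<longleftrightarrow> (\<forall>b<n. h $ b $ 0 = 0) \<and> h $ n $ 0 \<noteq> 0"

text \<open>Isolates the coefficient of \<open>Q\<close> that meets the first nonzero coefficient of
  h(0, y). Pairs with a = 0 and b < n drop out by regularity, and the remaining sum involves only
  coefficients of \<open>Q\<close> of smaller weight.\<close>

lemma regular_mult_nth:
  fixes h Q :: "'a::field fps fps"
  assumes "regular n h"
  shows "(Q * h) $ (j + n) $ i = h $ n $ 0 * Q $ j $ i +
    (\<Sum>(a, b)\<in>{(a, b). a \<le> i \<and> b \<le> j + n \<and> (a \<ge> 1 \<or> b > n)}. h $ b $ a * Q $ (j + n - b) $ (i - a))"
proof -
  define T where "T = {(a, b). a \<le> i \<and> b \<le> j + n \<and> (a \<ge> 1 \<or> b > n)}"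
  have sub: "insert (0, n) T \<subseteq> {..i} \<times> {..j + n}" by (auto simp: T_def)
  then have "finite (insert (0, n) T)" by (rule finite_subset) simp
  then have fin: "finite T" by simp
  have "(Q * h) $ (j + n) $ i = (h * Q) $ (j + n) $ i" by (simp add: mult.commute)
  also have "\<dots> = (\<Sum>(a, b)\<in>{..i} \<times> {..j + n}. h $ b $ a * Q $ (j + n - b) $ (i - a))"
    by (rule fps2_mult_nth)
  also have "\<dots> = (\<Sum>(a, b)\<in>insert (0, n) T. h $ b $ a * Q $ (j + n - b) $ (i - a))"
  proof (rule sum.mono_neutral_right[OF _ sub])
    show "\<forall>p\<in>{..i} \<times> {..j + n} - insert (0, n) T. (case p of (a, b) \<Rightarrow> h $ b $ a * Q $ (j + n - b) $ (i - a)) = 0"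
    proof
      fix p assume p: "p \<in> {..i} \<times> {..j + n} - insert (0, n) T"
      obtain a b where ab: "p = (a, b)" by force
      have "a = 0" "b < n" using p by (auto simp: T_def ab)
      then show "(case p of (a, b) \<Rightarrow> h $ b $ a * Q $ (j + n - b) $ (i - a)) = 0"
        using assms by (simp add: regular_def ab)
    qed
  qed simp
  also have "\<dots> = h $ n $ 0 * Q $ j $ i + (\<Sum>(a, b)\<in>T. h $ b $ a * Q $ (j + n - b) $ (i - a))"
    using fin by (subst sum.insert) (auto simp: T_def)
  finally show ?thesis unfolding T_def .
qed

text \<open>Lowering the x-exponent may raise the y-exponent by as much as n, hence the factor n + 1
  on i.\<close>

lemma weight_decreases:
  fixes a b i j n :: nat
  assumes "a \<le> i" "b \<le> j + n" "a \<ge> 1 \<or> b > n"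
  shows "(n + 1) * (i - a) + (j + n - b) < (n + 1) * i + j"
proof (cases "a \<ge> 1")
  case True
  then have "(n + 1) * (i - a) + (n + 1) \<le> (n + 1) * i"
    using assms(1) mult_le_mono2[of "i - a + 1" i "n + 1"] by (simp add: algebra_simps)
  then show ?thesis using assms(2) by linarith
next
  case False
  then have "a = 0" "b > n" using assms(3) by auto
  then show ?thesis using assms(2) by simp
qed

text \<open>Comparing coefficients determines the quotient by recursion along the weight \<open>(n + 1) i + j\<close>
  of the monomial \<open>x^i y^j\<close>.\<close>

lemma weierstrass_division:
  fixes h g :: "'a::field fps fps"
  assumes "regular n h"
  obtains Q where "\<And>j. j \<ge> n \<Longrightarrow> (g - Q * h) $ j = 0"
proof -
  define R where "R = Wellfounded.measure (\<lambda>(i, j). (n + 1) * i + j)"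
  define \<Phi> where "\<Phi> q = (\<lambda>(i, j). (g $ (j + n) $ i -
    (\<Sum>(a, b)\<in>{(a, b). a \<le> i \<and> b \<le> j + n \<and> (a \<ge> 1 \<or> b > n)}. h $ b $ a * q (i - a, j + n - b))) / h $ n $ 0)"
    for q :: "nat \<times> nat \<Rightarrow> 'a"
  have "adm_wf R \<Phi>" unfolding adm_wf_def
  proof (intro allI impI)
    fix f f' :: "nat \<times> nat \<Rightarrow> 'a" and x
    assume eq: "\<forall>z. (z, x) \<in> R \<longrightarrow> f z = f' z"
    obtain i j where x: "x = (i, j)" by force
    have "f (i - a, j + n - b) = f' (i - a, j + n - b)"
      if "a \<le> i" "b \<le> j + n" "a \<ge> 1 \<or> b > n" for a b
    proof -
      have "(n + 1) * (i - a) + (j + n - b) < (n + 1) * i + j"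
        by (rule weight_decreases) (use that in auto)
      then show ?thesis using eq by (simp add: R_def x)
    qed
    then have "(\<Sum>(a, b)\<in>{(a, b). a \<le> i \<and> b \<le> j + n \<and> (a \<ge> 1 \<or> b > n)}. h $ b $ a * f (i - a, j + n - b))
       = (\<Sum>(a, b)\<in>{(a, b). a \<le> i \<and> b \<le> j + n \<and> (a \<ge> 1 \<or> b > n)}. h $ b $ a * f' (i - a, j + n - b))"
      by (intro sum.cong) auto
    then show "\<Phi> f x = \<Phi> f' x" by (simp add: \<Phi>_def x)
  qed
  then have fp: "wfrec R \<Phi> = \<Phi> (wfrec R \<Phi>)"
    by (intro wfrec_fixpoint) (auto simp: R_def)
  define q where "q = wfrec R \<Phi>"
  define Q where "Q = Abs_fps (\<lambda>j. Abs_fps (\<lambda>i. q (i, j)))"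
  have "(Q * h) $ (j + n) $ i = g $ (j + n) $ i" for i j
  proof -
    have "q (i, j) = \<Phi> q (i, j)" using fp by (simp add: q_def)
    then have "h $ n $ 0 * q (i, j) = g $ (j + n) $ i -
      (\<Sum>(a, b)\<in>{(a, b). a \<le> i \<and> b \<le> j + n \<and> (a \<ge> 1 \<or> b > n)}. h $ b $ a * q (i - a, j + n - b))"
      using assms by (simp add: \<Phi>_def regular_def)
    then show ?thesis unfolding regular_mult_nth[OF assms] by (simp add: Q_def)
  qed
  then have "(g - Q * h) $ (j + n) = 0" for j by (intro fps_ext) simp
  then show ?thesis by (intro that[of Q]) (metis le_add_diff_inverse2)
qed

section \<open>Convergence of the Weierstrass quotient\<close>

lemma sum_geometric_le:
  fixes x :: real
  assumes "0 \<le> x" "x \<le> 1 / 2"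
  shows "(\<Sum>a=m..<N. x ^ a) \<le> 2 * x ^ m"
proof (cases "m \<le> N")
  case True
  then have "(\<Sum>a=m..<N. x ^ a) + 2 * x ^ N \<le> 2 * x ^ m"
  proof (induction rule: dec_induct)
    case (step k)
    have "x * x ^ k \<le> 1 / 2 * x ^ k" using assms by (intro mult_right_mono) auto
    then show ?case using step by simp
  qed simp
  then show ?thesis using assms by (smt (verit) zero_le_power)
qed (use assms in simp)

text \<open>Division determines each coefficient of \<open>Q\<close> from those of smaller weight,
  so the same recursion propagates a geometric bound. This covers every formal quotient whose
  remainder has degree below n in y, in particular exact quotients.\<close>

lemma convergent2_quotient:
  fixes g h Q :: "complex fps fps"
  assumes reg: "regular n h" and g: "convergent2 g" and h: "convergent2 h"
    and Q: "\<And>j. j \<ge> n \<Longrightarrow> (g - Q * h) $ j = 0"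
  shows "convergent2 Q"
proof -
  define c where "c = norm (h $ n $ 0)"
  have c: "c > 0" using reg by (simp add: c_def regular_def)
  obtain C1 R1 where 1: "C1 > 0" "R1 \<ge> 1" "\<And>i j. norm (h $ j $ i) \<le> C1 * R1 ^ (i + j)"
    using h by (rule convergent2E) blast
  obtain C2 R2 where 2: "C2 > 0" "R2 \<ge> 1" "\<And>i j. norm (g $ j $ i) \<le> C2 * R2 ^ (i + j)"
    using g by (rule convergent2E) blast
  define C where "C = max C1 C2"
  define R where "R = max R1 R2"
  have C: "C > 0" and R: "R \<ge> 1" using 1 2 by (auto simp: C_def R_def)
  have hb: "norm (h $ j $ i) \<le> C * R ^ (i + j)" for i j
    by (rule order_trans[OF 1(3)], intro mult_mono power_mono) (use 1 2 in \<open>auto simp: C_def R_def\<close>)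
  have gb: "norm (g $ j $ i) \<le> C * R ^ (i + j)" for i j
    by (rule order_trans[OF 2(3)], intro mult_mono power_mono) (use 1 2 in \<open>auto simp: C_def R_def\<close>)
  \<comment> \<open>\<open>B\<close> is fixed first, so that the terms with a = 0 and b > n, which
    carry the factor B^n (R / B)^(n + 1), contribute at most c / 4. Then \<open>A\<close> may depend
    on \<open>B\<close> and makes the terms with a \<ge> 1 contribute at most c / 4.
    \<open>K\<close> fits the bound for \<open>g\<close> into the remaining half.\<close>
  define B where "B = max (2 * R) (8 * C * R ^ (n + 1) / c)"
  define A where "A = max (2 * R) (16 * C * B ^ n * R / c)"
  define K where "K = 2 * C * R ^ n / c"
  have B: "B \<ge> 2 * R" "B \<ge> 8 * C * R ^ (n + 1) / c" and A: "A \<ge> 2 * R" "A \<ge> 16 * C * B ^ n * R / c"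
    by (auto simp: A_def B_def)
  have pos: "A > 0" "B > 0" "K > 0" using A B R C c by (auto simp: K_def)
  define x where "x = R / A"
  define y where "y = R / B"
  have xy: "0 \<le> x" "x \<le> 1/2" "0 \<le> y" "y \<le> 1/2"
    using A B R pos by (auto simp: x_def y_def field_simps)
  have tail: "C * B ^ n * (4 * x + 2 * y ^ (n + 1)) \<le> c / 2"
  proof -
    have "C * B ^ n * 4 * x \<le> c / 4" using A(2) pos c by (simp add: x_def field_simps)
    moreover have "C * B ^ n * 2 * y ^ (n + 1) \<le> c / 4"
      using B(2) pos c by (simp add: y_def field_simps power_divide)
    ultimately show ?thesis by (simp add: algebra_simps)
  qed
  have bound: "norm (Q $ j $ i) \<le> K * A ^ i * B ^ j" for i j
  proof (induction "(n + 1) * i + j" arbitrary: i j rule: less_induct)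
    case less
    define T where "T = {(a, b). a \<le> i \<and> b \<le> j + n \<and> (a \<ge> 1 \<or> b > n)}"
    \<comment> \<open>The two ways of lowering the weight: \<open>T1\<close> collects a \<ge> 1, and
      \<open>T2\<close> collects a = 0 with b > n.\<close>
    define T1 where "T1 = {1..<Suc i} \<times> {0..<Suc (j + n)}"
    define T2 where "T2 = {0::nat} \<times> {n + 1..<Suc (j + n)}"
    have TT: "T \<subseteq> T1 \<union> T2" by (auto simp: T_def T1_def T2_def)
    define M where "M = K * A ^ i * B ^ j * C * B ^ n"
    have M: "M \<ge> 0" using pos C by (simp add: M_def)
    have bnd: "norm (h $ b $ a * Q $ (j + n - b) $ (i - a)) \<le> M * (x ^ a * y ^ b)" if "(a, b) \<in> T" for a b
    proof -
      have ab: "a \<le> i" "b \<le> j + n" "a \<ge> 1 \<or> b > n" using that by (auto simp: T_def)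
      have "(n + 1) * (i - a) + (j + n - b) < (n + 1) * i + j"
        by (rule weight_decreases) (use ab in auto)
      then have "norm (Q $ (j + n - b) $ (i - a)) \<le> K * A ^ (i - a) * B ^ (j + n - b)"
        by (rule less)
      then have "norm (h $ b $ a * Q $ (j + n - b) $ (i - a))
          \<le> (C * R ^ (a + b)) * (K * A ^ (i - a) * B ^ (j + n - b))"
        unfolding norm_mult using C R by (intro mult_mono hb) auto
      also have "\<dots> = K * C * (R ^ a * A ^ (i - a)) * (R ^ b * B ^ (j + n - b))"
        by (simp add: power_add algebra_simps)
      also have "R ^ a * A ^ (i - a) = A ^ i * x ^ a"
        using ab(1) pos by (simp add: x_def power_divide field_simps flip: power_add)
      also have "R ^ b * B ^ (j + n - b) = B ^ (j + n) * y ^ b"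
        using ab(2) pos by (simp add: y_def power_divide field_simps flip: power_add)
      finally show ?thesis by (simp add: M_def power_add algebra_simps)
    qed
    have "norm (\<Sum>(a, b)\<in>T. h $ b $ a * Q $ (j + n - b) $ (i - a)) \<le> (\<Sum>(a, b)\<in>T. M * (x ^ a * y ^ b))"
      by (rule sum_norm_le) (use bnd in auto)
    also have "\<dots> \<le> (\<Sum>(a, b)\<in>T1 \<union> T2. M * (x ^ a * y ^ b))"
      by (rule sum_mono2[OF _ TT]) (use M xy in \<open>auto simp: T1_def T2_def\<close>)
    also have "\<dots> = (\<Sum>(a, b)\<in>T1. M * (x ^ a * y ^ b)) + (\<Sum>(a, b)\<in>T2. M * (x ^ a * y ^ b))"
      by (rule sum.union_disjoint) (auto simp: T1_def T2_def)
    also have "(\<Sum>(a, b)\<in>T1. M * (x ^ a * y ^ b)) = M * ((\<Sum>a=1..<Suc i. x ^ a) * (\<Sum>b=0..<Suc (j + n). y ^ b))"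
      unfolding T1_def by (subst sum_product) (auto simp only: sum_distrib_left sum.cartesian_product intro!: sum.cong split: prod.splits)
    also have "\<dots> \<le> M * ((2 * x ^ 1) * (2 * y ^ 0))"
      using M xy by (intro mult_left_mono mult_mono sum_geometric_le sum_nonneg) auto
    also have "(\<Sum>(a, b)\<in>T2. M * (x ^ a * y ^ b)) = M * (\<Sum>b=n+1..<Suc (j + n). y ^ b)"
      unfolding T2_def by (simp add: sum.cartesian_product[symmetric] sum_distrib_left del: sum.op_ivl_Suc)
    also have "\<dots> \<le> M * (2 * y ^ (n + 1))"
      using M xy by (intro mult_left_mono sum_geometric_le) auto
    finally have S: "norm (\<Sum>(a, b)\<in>T. h $ b $ a * Q $ (j + n - b) $ (i - a)) \<le> M * (4 * x + 2 * y ^ (n + 1))"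
      by (simp add: algebra_simps)
    have "M * (4 * x + 2 * y ^ (n + 1)) = (K * A ^ i * B ^ j) * (C * B ^ n * (4 * x + 2 * y ^ (n + 1)))"
      by (simp add: M_def)
    also have "\<dots> \<le> (K * A ^ i * B ^ j) * (c / 2)"
      by (rule mult_left_mono[OF tail]) (use pos in auto)
    finally have S': "norm (\<Sum>(a, b)\<in>T. h $ b $ a * Q $ (j + n - b) $ (i - a)) \<le> (K * A ^ i * B ^ j) * (c / 2)"
      using S by linarith
    have "norm (g $ (j + n) $ i) \<le> C * R ^ n * (R ^ i * R ^ j)"
      using gb[of "j + n" i] by (simp add: power_add algebra_simps)
    also have "\<dots> \<le> C * R ^ n * (A ^ i * B ^ j)"
      using A B R C pos by (intro mult_left_mono mult_mono power_mono) auto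
    also have "\<dots> = (K * A ^ i * B ^ j) * (c / 2)"
      using c by (simp add: K_def)
    finally have G: "norm (g $ (j + n) $ i) \<le> (K * A ^ i * B ^ j) * (c / 2)" .
    have "(Q * h) $ (j + n) $ i = g $ (j + n) $ i"
      using Q[of "j + n"] by simp
    then have "h $ n $ 0 * Q $ j $ i = g $ (j + n) $ i - (\<Sum>(a, b)\<in>T. h $ b $ a * Q $ (j + n - b) $ (i - a))"
      unfolding regular_mult_nth[OF reg] T_def by (simp add: algebra_simps)
    then have "c * norm (Q $ j $ i) = norm (g $ (j + n) $ i - (\<Sum>(a, b)\<in>T. h $ b $ a * Q $ (j + n - b) $ (i - a)))"
      by (metis c_def norm_mult)
    also have "\<dots> \<le> (K * A ^ i * B ^ j) * (c / 2) + (K * A ^ i * B ^ j) * (c / 2)"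
      using norm_triangle_ineq4 G S' by (meson add_mono order_trans)
    finally have "c * norm (Q $ j $ i) \<le> c * (K * A ^ i * B ^ j)" by (simp add: algebra_simps)
    then show ?case using c by (metis mult_le_cancel_left_pos)
  qed
  show ?thesis
  proof (rule convergent2I[of K "max A B"])
    fix i j
    have "K * A ^ i * B ^ j \<le> K * max A B ^ i * max A B ^ j"
      using pos by (intro mult_mono power_mono) auto
    then show "norm (Q $ j $ i) \<le> K * max A B ^ (i + j)"
      using bound[of j i] by (simp add: power_add mult.assoc)
  qed (use pos in auto)
qed

section \<open>Convergent Puiseux roots\<close>

lemma convergent2_0 [simp]: "convergent2 0" and convergent2_1 [simp]: "convergent2 1"
  using convergent2_const[of 0] convergent2_const[of 1] by simp_all

lemma convergent2_sum: "(\<And>i. i \<in> A \<Longrightarrow> convergent2 (F i)) \<Longrightarrow> convergent2 (\<Sum>i\<in>A. F i)"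
  by (induction A rule: infinite_finite_induct) (auto intro: convergent2_add)

lemma convergent2_prod: "(\<And>i. i \<in> A \<Longrightarrow> convergent2 (F i)) \<Longrightarrow> convergent2 (\<Prod>i\<in>A. F i)"
  by (induction A rule: infinite_finite_induct) (auto intro: convergent2_mult)

lemma convergent2_power: "convergent2 F \<Longrightarrow> convergent2 (F ^ n)"
  by (induction n) (auto intro: convergent2_mult)

lemma convergent2_diff: "convergent2 F \<Longrightarrow> convergent2 G \<Longrightarrow> convergent2 (F - G)"
  using convergent2_add[of F "- G"] convergent2_uminus[of G] by simp

text \<open>Read off the series that is constant in y, so that closure under sums and products is
  inherited from two variables.\<close>

definition convergent1 :: "complex fps \<Rightarrow> bool" where
  "convergent1 a \<longleftrightarrow> convergent2 (fps_const a)"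

lemma convergent1_iff_bound:
  "convergent1 a \<longleftrightarrow> (\<exists>C R. C > 0 \<and> R > 0 \<and> (\<forall>i. norm (a $ i) \<le> C * R ^ i))"
proof
  assume "convergent1 a"
  then obtain C R where *: "C > 0" "R > (0::real)"
    "\<And>i j. norm (fps_const a $ j $ i) \<le> C * R ^ (i + j)"
    unfolding convergent1_def convergent2_iff_bound by blast
  show "\<exists>C R. C > 0 \<and> R > 0 \<and> (\<forall>i. norm (a $ i) \<le> C * R ^ i)"
    using * *(3)[of 0] by auto
next
  assume "\<exists>C R. C > 0 \<and> R > 0 \<and> (\<forall>i. norm (a $ i) \<le> C * R ^ i)"
  then obtain C R where *: "C > 0" "R > (0::real)" "\<And>i. norm (a $ i) \<le> C * R ^ i" by blast
  then show "convergent1 a" unfolding convergent1_def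
    by (intro convergent2I[of C R]) auto
qed

lemma convergent1_const: "convergent1 (fps_const c)"
  by (simp add: convergent1_def convergent2_const)

lemma convergent1_of_nat: "convergent1 (of_nat n)"
  by (simp add: fps_of_nat[symmetric] convergent1_const)

lemma convergent1_add: "convergent1 a \<Longrightarrow> convergent1 b \<Longrightarrow> convergent1 (a + b)"
  using convergent2_add[of "fps_const a" "fps_const b"] by (simp add: convergent1_def)

lemma convergent1_mult: "convergent1 a \<Longrightarrow> convergent1 b \<Longrightarrow> convergent1 (a * b)"
  using convergent2_mult[of "fps_const a" "fps_const b"] by (simp add: convergent1_def)

lemma convergent1_power: "convergent1 a \<Longrightarrow> convergent1 (a ^ n)"
  using convergent1_const[of 1] by (induction n) (auto intro: convergent1_mult)

lemma convergent1_X_power: "convergent1 (fps_X ^ n)"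
  using convergent2_X(1) by (intro convergent1_power) (simp add: convergent1_def)

lemma convergent1_sum: "(\<And>i. i \<in> A \<Longrightarrow> convergent1 (a i)) \<Longrightarrow> convergent1 (\<Sum>i\<in>A. a i)"
  using convergent1_const[of 0] by (induction A rule: infinite_finite_induct) (auto intro: convergent1_add)

lemma convergent1_nth:
  assumes "convergent2 F"
  shows "convergent1 (F $ j)"
proof -
  obtain C R where *: "C > 0" "R > (0::real)" "\<And>i j. norm (F $ j $ i) \<le> C * R ^ (i + j)"
    using assms unfolding convergent2_iff_bound by blast
  have "norm (F $ j $ i) \<le> C * R ^ j * R ^ i" for i using *(3)[of j i] by (simp add: power_add mult_ac)
  with * show ?thesis unfolding convergent1_iff_bound
    by (intro exI[of _ "C * R ^ j"] exI[of _ R]) auto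
qed

lemma convergent1_shift:
  assumes "convergent1 a"
  shows "convergent1 (fps_shift k a)"
proof -
  obtain C R where *: "C > 0" "R > (0::real)" "\<And>i. norm (a $ i) \<le> C * R ^ i"
    using assms unfolding convergent1_iff_bound by blast
  have "norm (fps_shift k a $ i) \<le> C * R ^ k * R ^ i" for i using *(3)[of "i + k"] by (simp add: power_add mult_ac)
  with * show ?thesis unfolding convergent1_iff_bound
    by (intro exI[of _ "C * R ^ k"] exI[of _ R]) auto
qed

lemma convergent1_compose_X_power:
  assumes "convergent1 a" "m \<ge> 1"
  shows "convergent1 (a oo fps_X ^ m)"
proof -
  obtain C R where *: "C > 0" "R > (0::real)" "\<And>i. norm (a $ i) \<le> C * R ^ i"
    using assms unfolding convergent1_iff_bound by blast
  have "norm ((a oo fps_X ^ m) $ i) \<le> C * max R 1 ^ i" for i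
  proof (cases "m dvd i")
    case True
    then have "(a oo fps_X ^ m) $ i = a $ (i div m)"
      using assms(2) by (simp add: fps_nth_compose_X_power)
    also have "norm \<dots> \<le> C * R ^ (i div m)" by (rule *)
    also have "\<dots> \<le> C * max R 1 ^ (i div m)"
      using * by (intro mult_left_mono power_mono) auto
    also have "\<dots> \<le> C * max R 1 ^ i"
      using * by (intro mult_left_mono power_increasing) auto
    finally show ?thesis .
  next
    case False
    then show ?thesis using * assms(2) by (simp add: fps_nth_compose_X_power)
  qed
  then show ?thesis unfolding convergent1_iff_bound using *
    by (intro exI[of _ C] exI[of _ "max R 1"]) auto
qed

lemma fps_finite_expansion:
  fixes W :: "'a::comm_ring_1 fps"
  assumes "\<And>j. j > n \<Longrightarrow> W $ j = 0"
  shows "W = (\<Sum>j\<le>n. fps_const (W $ j) * fps_X ^ j)"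
  by (rule fps_ext) (use assms in \<open>auto simp: fps_sum_nth fps_X_power_nth if_distrib not_le cong: if_cong\<close>)

lemma convergent2_finite:
  assumes "\<And>j. j > n \<Longrightarrow> W $ j = 0" "\<And>j. convergent1 (W $ j)"
  shows "convergent2 W"
proof -
  have "convergent2 (\<Sum>j\<le>n. fps_const (W $ j) * fps_X ^ j)"
    using assms(2) by (intro convergent2_sum convergent2_mult convergent2_power convergent2_X)
      (auto simp: convergent1_def)
  then show ?thesis using fps_finite_expansion[OF assms(1)] by metis
qed

lemma psubst_finite:
  fixes W :: "'a::idom fps fps"
  assumes "\<And>j. j > n \<Longrightarrow> W $ j = 0" "a $ 0 = 0" "b $ 0 = 0"
  shows "psubst W a b = (\<Sum>j\<le>n. (W $ j oo a) * b ^ j)"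
proof -
  have "psubst W a b = psubst (\<Sum>j\<le>n. fps_const (W $ j) * fps_X ^ j) a b"
    using fps_finite_expansion[OF assms(1)] by metis
  also have "\<dots> = (\<Sum>j\<le>n. (W $ j oo a) * b ^ j)"
  proof -
    have "psubst (sum F A) a b = (\<Sum>i\<in>A. psubst (F i) a b)" for F :: "nat \<Rightarrow> 'a fps fps" and A
      by (induction A rule: infinite_finite_induct) auto
    moreover have "psubst (F ^ k) a b = psubst F a b ^ k" for F :: "'a fps fps" and k
      by (induction k) (auto simp: assms)
    ultimately show ?thesis by (simp add: assms)
  qed
  finally show ?thesis .
qed

text \<open>Divide y^n by \<open>h\<close>: then \<open>Q * h\<close> is a monic polynomial of
  degree n in y. Its coefficient at x^0 y^n shows that \<open>Q\<close> is a unit, so every root of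
  the polynomial is a root of \<open>h\<close>.\<close>

lemma weierstrass_polynomial:
  fixes h :: "complex fps fps"
  assumes "convergent2 h" "regular n h"
  obtains W where "convergent2 W" "\<And>j. j > n \<Longrightarrow> W $ j = 0" "W $ n = 1" "\<And>j. j < n \<Longrightarrow> W $ j $ 0 = 0"
    "\<And>a b. a $ 0 = 0 \<Longrightarrow> b $ 0 = 0 \<Longrightarrow> psubst W a b = 0 \<Longrightarrow> psubst h a b = 0"
proof -
  obtain Q where Q: "\<And>j. j \<ge> n \<Longrightarrow> (fps_X ^ n - Q * h) $ j = 0"
    using weierstrass_division[OF assms(2)] by metis
  have cQ: "convergent2 Q"
    by (rule convergent2_quotient[OF assms(2) _ assms(1) Q]) (auto intro: convergent2_power convergent2_X)
  define W where "W = Q * h"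
  have ge: "W $ j = (fps_X ^ n :: complex fps fps) $ j" if "j \<ge> n" for j
    using Q[OF that] by (simp add: W_def)
  have "W $ n $ 0 = h $ n $ 0 * Q $ 0 $ 0"
  proof -
    have none: "{(a, b). a \<le> (0::nat) \<and> b \<le> 0 + n \<and> (a \<ge> 1 \<or> b > n)} = {}" by auto
    show ?thesis using regular_mult_nth[OF assms(2), of Q 0 0] unfolding none by (simp add: W_def)
  qed
  then have Q0: "Q $ 0 $ 0 \<noteq> 0" using ge[of n] by auto
  show ?thesis
  proof
    show "convergent2 W" unfolding W_def by (rule convergent2_mult[OF cQ assms(1)])
    show "W $ j = 0" if "j > n" for j using ge[of j] that by simp
    show "W $ n = 1" using ge[of n] by simp
    show "W $ j $ 0 = 0" if "j < n" for j
      using assms(2) that unfolding W_def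
      by (auto simp: mult.commute[of Q] fps2_mult_nth regular_def intro!: sum.neutral)
    show "psubst h a b = 0" if "a $ 0 = 0" "b $ 0 = 0" "psubst W a b = 0" for a b
    proof -
      have "psubst Q a b * psubst h a b = 0" using that by (simp add: W_def)
      moreover have "psubst Q a b \<noteq> 0" using Q0 psubst_nth_0[of Q a b] by (metis fps_zero_nth)
      ultimately show ?thesis by auto
    qed
  qed
qed

section \<open>Taylor shifts and the Newton-Puiseux induction\<close>

lemma sum_binomial_shift:
  fixes w :: "nat \<Rightarrow> 'a::comm_ring_1"
  shows "(\<Sum>j\<le>n. w j * (\<eta> + z) ^ j) =
    (\<Sum>k\<le>n. (\<Sum>j\<le>n. of_nat (j choose k) * w j * \<eta> ^ (j - k)) * z ^ k)"
proof -
  have "(\<eta> + z) ^ j = (\<Sum>k\<le>n. of_nat (j choose k) * \<eta> ^ (j - k) * z ^ k)" if "j \<le> n" for j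
  proof -
    have "(\<eta> + z) ^ j = (z + \<eta>) ^ j" by (simp add: add.commute)
    also have "\<dots> = (\<Sum>k\<le>j. of_nat (j choose k) * z ^ k * \<eta> ^ (j - k))" by (rule binomial_ring)
    also have "\<dots> = (\<Sum>k\<le>n. of_nat (j choose k) * \<eta> ^ (j - k) * z ^ k)"
      by (rule sum.mono_neutral_cong_left) (use that in \<open>auto simp: mult_ac binomial_eq_0\<close>)
    finally show ?thesis .
  qed
  then have "(\<Sum>j\<le>n. w j * (\<eta> + z) ^ j) = (\<Sum>j\<le>n. \<Sum>k\<le>n. of_nat (j choose k) * w j * \<eta> ^ (j - k) * z ^ k)"
    by (intro sum.cong) (auto simp: sum_distrib_left mult_ac)
  also have "\<dots> = (\<Sum>k\<le>n. \<Sum>j\<le>n. of_nat (j choose k) * w j * \<eta> ^ (j - k) * z ^ k)"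
    by (rule sum.swap)
  finally show ?thesis by (simp add: sum_distrib_right)
qed

text \<open>The sums are the Taylor coefficients at \<open>a\<close> of the polynomial with coefficients \<open>c\<close>; the missing
  term of degree \<open>n - 1\<close> excludes that \<open>a\<close> is a root of multiplicity \<open>n\<close>.\<close>

lemma root_of_small_multiplicity:
  fixes c :: "nat \<Rightarrow> complex"
  assumes n: "n \<ge> 1" and cn: "c n = 1" and cn1: "c (n - 1) = 0" and j: "j < n" "c j \<noteq> 0"
  obtains a k where "1 \<le> k" "k < n"
    "(\<Sum>j\<le>n. of_nat (j choose k) * c j * a ^ (j - k)) \<noteq> 0"
    "\<And>i. i < k \<Longrightarrow> (\<Sum>j\<le>n. of_nat (j choose i) * c j * a ^ (j - i)) = 0"
proof -
  define p where "p = (\<Sum>j\<le>n. monom (c j) j)"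
  have cp: "coeff p i = (if i \<le> n then c i else 0)" for i
    by (simp add: p_def coeff_sum if_distrib cong: if_cong)
  have pp: "poly p z = (\<Sum>j\<le>n. c j * z ^ j)" for z
    by (simp add: p_def poly_sum poly_monom)
  have "degree p > 0"
    using le_degree[of p n] cn n by (simp add: cp)
  then have "\<not> constant (poly p)" by (simp add: constant_degree)
  then obtain a where a: "poly p a = 0" using fundamental_theorem_of_algebra by blast
  define e where "e k = (\<Sum>j\<le>n. of_nat (j choose k) * c j * a ^ (j - k))" for k
  have e0: "e 0 = 0" using a by (simp add: e_def pp)
  have "\<exists>k<n. e k \<noteq> 0"
  proof (rule ccontr)
    assume "\<not> (\<exists>k<n. e k \<noteq> 0)"
    then have z: "e k = 0" if "k < n" for k using that by blast
    have en: "e n = 1"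
    proof -
      have "e n = (\<Sum>j\<in>{n}. of_nat (j choose n) * c j * a ^ (j - n))"
        unfolding e_def by (rule sum.mono_neutral_right) (auto simp: binomial_eq_0)
      then show ?thesis by (simp add: cn)
    qed
    have "poly p w = poly ([:- a, 1:] ^ n) w" for w
    proof -
      have "poly p w = (\<Sum>j\<le>n. c j * (a + (w - a)) ^ j)" by (simp add: pp)
      also have "\<dots> = (\<Sum>k\<le>n. e k * (w - a) ^ k)" unfolding e_def by (rule sum_binomial_shift)
      also have "\<dots> = (\<Sum>k\<in>{n}. e k * (w - a) ^ k)"
        by (rule sum.mono_neutral_right) (auto simp: z)
      finally show ?thesis by (simp add: en)
    qed
    then have "poly p = poly ([:- a, 1:] ^ n)" by (rule ext)
    then have p: "p = [:- a, 1:] ^ n" by (simp only: poly_eq_poly_eq_iff)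
    have "coeff p (n - 1) = of_nat n * (- a)"
      unfolding p using n by (subst coeff_linear_poly_power) (auto simp: binomial_symmetric[of "n - Suc 0"])
    then have "a = 0" using cn1 n by (simp add: cp)
    moreover have "coeff p j = of_nat (n choose j) * (- a) ^ (n - j)"
      unfolding p using j by (subst coeff_linear_poly_power) auto
    ultimately show False using j by (simp add: cp)
  qed
  define k where "k = (LEAST k. e k \<noteq> 0)"
  obtain k' where k': "k' < n" "e k' \<noteq> 0" using \<open>\<exists>k<n. e k \<noteq> 0\<close> by blast
  have "e k \<noteq> 0" unfolding k_def by (rule LeastI[of _ k']) (rule k')
  moreover have "k < n" using Least_le[of "\<lambda>k. e k \<noteq> 0" k'] k' by (simp add: k_def)
  moreover have "\<And>i. i < k \<Longrightarrow> e i = 0" unfolding k_def using not_less_Least by blast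
  moreover have "k \<noteq> 0" using \<open>e k \<noteq> 0\<close> e0 by (intro notI) simp
  ultimately show ?thesis using that[of k a] by (simp add: e_def)
qed

lemma X_power_nth_0: "m \<ge> 1 \<Longrightarrow> (fps_X ^ m :: 'a::comm_ring_1 fps) $ 0 = 0"
  by simp

text \<open>Induction on the order n of h(0, y). The shift by \<open>\<eta>\<close> removes the term
  of degree n - 1. Passing to x = t^q, z = t^p (a + z') along the least slope then gives a series of
  order k < n at z' = 0, because a polynomial without term of degree n - 1 is no n-th power of a
  linear factor unless it is the pure power. Only algebraic operations on finitely many coefficient
  series occur, so convergence is preserved.\<close>

theorem newton_puiseux:
  fixes h :: "complex fps fps"
  assumes "convergent2 h" "regular n h" "n \<ge> 1"
  shows "\<exists>m y. m \<ge> 1 \<and> y $ 0 = 0 \<and> convergent1 y \<and> psubst h (fps_X ^ m) y = 0"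
  using assms
proof (induction n arbitrary: h rule: less_induct)
  case (less n)
  obtain W where W: "convergent2 W" "\<And>j. j > n \<Longrightarrow> W $ j = 0" "W $ n = 1" "\<And>j. j < n \<Longrightarrow> W $ j $ 0 = 0"
    and root: "\<And>a b. a $ 0 = 0 \<Longrightarrow> b $ 0 = 0 \<Longrightarrow> psubst W a b = 0 \<Longrightarrow> psubst h a b = 0"
    using weierstrass_polynomial[OF less.prems(1,2)] by metis
  \<comment> \<open>The mean of the roots of \<open>W\<close>; moving it to 0 excludes a root of
    full multiplicity further on.\<close>
  define \<eta> where "\<eta> = fps_const (- 1 / of_nat n) * W $ (n - 1)"
  have c\<eta>: "convergent1 \<eta>" unfolding \<eta>_def
    by (intro convergent1_mult convergent1_const convergent1_nth W(1))
  have \<eta>0: "\<eta> $ 0 = 0" using W(4)[of "n - 1"] less.prems(3) by (simp add: \<eta>_def)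
  define v where "v k = (\<Sum>j\<le>n. of_nat (j choose k) * W $ j * \<eta> ^ (j - k))" for k
  have cv: "convergent1 (v k)" for k unfolding v_def
    by (intro convergent1_sum convergent1_mult convergent1_power convergent1_of_nat c\<eta> convergent1_nth W(1))
  have vn: "v n = 1"
  proof -
    have "v n = (\<Sum>j\<in>{n}. of_nat (j choose n) * W $ j * \<eta> ^ (j - n))"
      unfolding v_def by (rule sum.mono_neutral_right) (auto simp: binomial_eq_0)
    then show ?thesis by (simp add: W)
  qed
  have vn1: "v (n - 1) = 0"
  proof -
    obtain N where N: "n = Suc N" using less.prems(3) by (cases n) auto
    have "v N = (\<Sum>j\<in>{N, n}. of_nat (j choose N) * W $ j * \<eta> ^ (j - N))"
      unfolding v_def by (rule sum.mono_neutral_right) (auto simp: N binomial_eq_0 le_Suc_eq)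
    also have "\<dots> = W $ N + of_nat n * \<eta>" using W(3) by (simp add: N)
    also have "of_nat n * \<eta> = - W $ N"
    proof -
      have "of_nat n * \<eta> = fps_const (of_nat n) * (fps_const (- 1 / of_nat n) * W $ N)"
        by (simp add: \<eta>_def N fps_of_nat del: of_nat_Suc)
      also have "\<dots> = fps_const (of_nat n * (- 1 / of_nat n)) * W $ N"
        by (simp add: mult.assoc[symmetric] del: of_nat_Suc)
      also have "of_nat n * (- 1 / of_nat n) = (- 1 :: complex)" using less.prems(3) by simp
      finally show ?thesis by (simp add: fps_eq_iff)
    qed
    finally show ?thesis by (simp add: N)
  qed
  have v0: "v k $ 0 = 0" if "k < n" for k
  proof -
    have "(of_nat (j choose k) * W $ j * \<eta> ^ (j - k)) $ 0 = 0" if "j \<le> n" for j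
    proof (cases "j = n")
      case True
      then show ?thesis using \<open>k < n\<close> by (simp add: \<eta>0 power_0_left)
    next
      case False
      then show ?thesis using that W(4)[of j] by simp
    qed
    then show ?thesis unfolding v_def fps_sum_nth by (intro sum.neutral) blast
  qed
  text \<open>After the substitution \<open>y = \<eta> + z\<close> the polynomial \<open>W\<close> becomes \<open>\<Sum> v k z^k\<close>.\<close>
  have Wroot: "psubst h (fps_X ^ m) ((\<eta> oo fps_X ^ m) + z) = 0"
    if m: "m \<ge> 1" and z: "z $ 0 = 0" and vz: "(\<Sum>k\<le>n. (v k oo fps_X ^ m) * z ^ k) = 0" for m z
  proof (rule root)
    have m0: "(fps_X ^ m :: complex fps) $ 0 = 0" using m by (rule X_power_nth_0)
    show "(fps_X ^ m :: complex fps) $ 0 = 0" by (rule m0)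
    show e0: "((\<eta> oo fps_X ^ m) + z) $ 0 = 0" using z \<eta>0 by simp
    have vk: "v k oo fps_X ^ m = (\<Sum>j\<le>n. of_nat (j choose k) * (W $ j oo fps_X ^ m) * (\<eta> oo fps_X ^ m) ^ (j - k))" for k
      unfolding v_def using m0
      by (simp add: fps_compose_sum_distrib fps_compose_mult_distrib fps_compose_power fps_of_nat[symmetric])
    have "psubst W (fps_X ^ m) ((\<eta> oo fps_X ^ m) + z) = (\<Sum>j\<le>n. (W $ j oo fps_X ^ m) * ((\<eta> oo fps_X ^ m) + z) ^ j)"
      using W(2) m0 e0 by (rule psubst_finite)
    also have "\<dots> = (\<Sum>k\<le>n. (v k oo fps_X ^ m) * z ^ k)"
      unfolding vk by (rule sum_binomial_shift)
    finally show "psubst W (fps_X ^ m) ((\<eta> oo fps_X ^ m) + z) = 0" using vz by simp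
  qed
  show ?case
  proof (cases "\<exists>j<n. v j \<noteq> 0")
    \<comment> \<open>Then \<open>W\<close> is the n-th power of y - \<open>\<eta>\<close>, and
      \<open>\<eta>\<close> is a root without ramification.\<close>
    case False
    have "(\<Sum>k\<le>n. (v k oo fps_X ^ 1) * 0 ^ k) = v 0" by (simp add: power_0_left if_distrib cong: if_cong)
    then have "psubst h (fps_X ^ 1) ((\<eta> oo fps_X ^ 1) + 0) = 0"
      using False less.prems(3) by (intro Wroot) auto
    then show ?thesis using c\<eta> \<eta>0 by (intro exI[of _ 1] exI[of _ \<eta>]) simp
  next
    case True
    define J where "J = {j. j < n \<and> v j \<noteq> 0}"
    \<comment> \<open>The slope from the lowest exponent of \<open>v j * z ^ j\<close> to that of
      z^n. The least one, attained at \<open>i\<close>, is written p / q below, not necessarily in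
      lowest terms.\<close>
    define \<theta> where "\<theta> j = real (subdegree (v j)) / real (n - j)" for j
    have J: "finite J" "J \<noteq> {}" using True by (auto simp: J_def)
    then obtain i where i: "i \<in> J" "\<And>j. j \<in> J \<Longrightarrow> \<theta> i \<le> \<theta> j"
      using arg_min_if_finite[of J \<theta>] by (metis not_le_imp_less)
    define p where "p = subdegree (v i)"
    define q where "q = n - i"
    have "i < n" "v i \<noteq> 0" using i by (auto simp: J_def)
    then have q: "q \<ge> 1" and p: "p \<ge> 1"
      using v0[of i] subdegree_eq_0_iff[of "v i"] by (auto simp: q_def p_def Suc_le_eq)
    have slope: "p * (n - j) \<le> subdegree (v j) * q" if "j < n" "v j \<noteq> 0" for j
    proof -
      have "\<theta> i \<le> \<theta> j" using i(2)[of j] that by (simp add: J_def)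
      then have "real p * real (n - j) \<le> real (subdegree (v j)) * real q"
        using that \<open>i < n\<close> by (simp add: \<theta>_def p_def q_def field_simps del: of_nat_diff)
      then show ?thesis by (simp only: of_nat_mult[symmetric] of_nat_le_iff)
    qed
    have q0: "(fps_X ^ q :: complex fps) $ 0 = 0" using q by (rule X_power_nth_0)
    \<comment> \<open>After x = t^q and z = t^p w the whole polynomial is divisible by t^(p n). The
      \<open>u j\<close> are the coefficients of the quotient, and \<open>slope\<close> makes the
      shifts exact.\<close>
    define u where "u j = fps_shift (p * (n - j)) (v j oo fps_X ^ q)" for j
    have cu: "convergent1 (u j)" for j
      unfolding u_def by (intro convergent1_shift convergent1_compose_X_power cv q)
    have uv: "v j oo fps_X ^ q = u j * fps_X ^ (p * (n - j))" if "j \<le> n" for j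
    proof (cases "v j = 0 \<or> j = n")
      case False
      have "subdegree (v j oo fps_X ^ q) = subdegree (v j) * q" using q0 by (subst subdegree_fps_compose) auto
      then have "p * (n - j) \<le> subdegree (v j oo fps_X ^ q)" using slope[of j] False that by simp
      then show ?thesis unfolding u_def by (rule fps_shift_times_fps_X_power[symmetric])
    qed (auto simp: u_def vn)
    have un: "u n = 1" by (simp add: u_def vn)
    have un1: "u (n - 1) = 0" using vn1 by (simp add: u_def)
    have ui: "u i $ 0 \<noteq> 0"
    proof -
      have "u i $ 0 = v i $ p" using q by (simp add: u_def q_def[symmetric] fps_nth_compose_X_power)
      then show ?thesis using \<open>v i \<noteq> 0\<close> by (simp add: p_def)
    qed
    obtain a k where k: "1 \<le> k" "k < n"
      "(\<Sum>j\<le>n. of_nat (j choose k) * u j $ 0 * a ^ (j - k)) \<noteq> 0"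
      "\<And>l. l < k \<Longrightarrow> (\<Sum>j\<le>n. of_nat (j choose l) * u j $ 0 * a ^ (j - l)) = 0"
      by (rule root_of_small_multiplicity[of n "\<lambda>j. u j $ 0" i])
        (use less.prems(3) un un1 ui \<open>i < n\<close> in auto)
    \<comment> \<open>The polynomial with coefficients \<open>u j\<close>, expanded at w =
      \<open>a\<close>. The choice of \<open>a\<close> makes it regular of order k < n, so the
      induction hypothesis applies.\<close>
    define g where "g = Abs_fps (\<lambda>l. if l \<le> n then \<Sum>j\<le>n. of_nat (j choose l) * u j * fps_const a ^ (j - l) else 0)"
    have g0: "g $ l $ 0 = (\<Sum>j\<le>n. of_nat (j choose l) * u j $ 0 * a ^ (j - l))" if "l \<le> n" for l
      using that by (simp add: g_def fps_sum_nth fps_const_power fps_of_nat[symmetric])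
    have "convergent2 g"
    proof (rule convergent2_finite[of n])
      show "convergent1 (g $ l)" for l
        using convergent1_const[of 0]
        by (auto simp: g_def intro!: convergent1_sum convergent1_mult convergent1_of_nat cu convergent1_power convergent1_const)
    qed (simp add: g_def)
    moreover have "regular k g" using k by (auto simp: regular_def g0)
    ultimately obtain m z where z: "m \<ge> 1" "z $ 0 = 0" "convergent1 z" "psubst g (fps_X ^ m) z = 0"
      using less.IH[of k g] k by blast
    have m0: "(fps_X ^ m :: complex fps) $ 0 = 0" using z(1) by (rule X_power_nth_0)
    have gk: "g $ l oo fps_X ^ m = (\<Sum>j\<le>n. of_nat (j choose l) * (u j oo fps_X ^ m) * fps_const a ^ (j - l))" if "l \<le> n" for l
      using that m0 unfolding g_def
      by (simp add: fps_compose_sum_distrib fps_compose_mult_distrib fps_compose_power fps_of_nat[symmetric])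
    have "0 = (\<Sum>l\<le>n. (g $ l oo fps_X ^ m) * z ^ l)"
      using z(2,4) m0 psubst_finite[of n g "fps_X ^ m" z] by (simp add: g_def)
    also have "\<dots> = (\<Sum>j\<le>n. (u j oo fps_X ^ m) * (fps_const a + z) ^ j)"
      unfolding sum_binomial_shift by (intro sum.cong refl) (simp add: gk)
    finally have uz: "(\<Sum>j\<le>n. (u j oo fps_X ^ m) * (fps_const a + z) ^ j) = 0" by simp
    define y where "y = fps_X ^ (m * p) * (fps_const a + z)"
    have y0: "y $ 0 = 0" using z(1) p by (simp add: y_def)
    have "(\<Sum>j\<le>n. (v j oo fps_X ^ (q * m)) * y ^ j) = 0"
    proof -
      have "(v j oo fps_X ^ (q * m)) * y ^ j = fps_X ^ (m * p * n) * ((u j oo fps_X ^ m) * (fps_const a + z) ^ j)"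
        if "j \<le> n" for j
      proof -
        have "v j oo fps_X ^ (q * m) = v j oo fps_X ^ q oo fps_X ^ m"
          using q0 m0 by (simp add: fps_compose_assoc[symmetric] fps_X_power_compose mult.commute flip: power_mult)
        also have "\<dots> = (u j oo fps_X ^ m) * fps_X ^ (m * (p * (n - j)))"
          unfolding uv[OF that] using m0 by (simp add: fps_compose_mult_distrib fps_X_power_compose flip: power_mult)
        finally have vj: "v j oo fps_X ^ (q * m) = (u j oo fps_X ^ m) * fps_X ^ (m * (p * (n - j)))" .
        have yj: "y ^ j = fps_X ^ (m * p * j) * (fps_const a + z) ^ j"
          unfolding y_def power_mult_distrib by (simp only: power_mult)
        have "(v j oo fps_X ^ (q * m)) * y ^ j =
            (u j oo fps_X ^ m) * (fps_const a + z) ^ j * fps_X ^ (m * (p * (n - j)) + m * p * j)"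
          unfolding vj yj power_add by (simp only: mult_ac)
        also have "m * (p * (n - j)) + m * p * j = m * p * n"
          using that by (simp add: diff_mult_distrib2 mult.assoc)
        finally show ?thesis by (simp add: mult_ac)
      qed
      then have "(\<Sum>j\<le>n. (v j oo fps_X ^ (q * m)) * y ^ j)
          = fps_X ^ (m * p * n) * (\<Sum>j\<le>n. (u j oo fps_X ^ m) * (fps_const a + z) ^ j)"
        by (simp add: sum_distrib_left)
      then show ?thesis by (simp add: uz)
    qed
    then have "psubst h (fps_X ^ (q * m)) ((\<eta> oo fps_X ^ (q * m)) + y) = 0"
      using q z(1) y0 by (intro Wroot) auto
    moreover have "convergent1 ((\<eta> oo fps_X ^ (q * m)) + y)" unfolding y_def
      using q z(1,3) c\<eta> by (intro convergent1_add convergent1_compose_X_power convergent1_mult convergent1_X_power convergent1_const) auto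
    moreover have "((\<eta> oo fps_X ^ (q * m)) + y) $ 0 = 0" using \<eta>0 y0 by simp
    moreover have "q * m \<ge> 1" using q z(1) by simp
    ultimately show ?thesis by blast
  qed
qed

section \<open>Conjugate roots and irreducibility\<close>

lemma fps2_unit_iff: "G dvd 1 \<longleftrightarrow> G $ 0 $ 0 \<noteq> 0" for G :: "'a::field fps fps"
proof
  assume "G dvd 1"
  then obtain H where "1 = G * H" by (rule dvdE)
  then have "(G * H) $ 0 $ 0 = 1" by (metis fps_one_nth)
  then show "G $ 0 $ 0 \<noteq> 0" by auto
next
  assume "G $ 0 $ 0 \<noteq> 0"
  then have "1 = G $ 0 * inverse (G $ 0)" by (simp add: inverse_mult_eq_1')
  then show "G dvd 1" using fps_is_left_unit_iff_zeroth_is_left_unit[of G] by (metis dvd_triv_left)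
qed

text \<open>Division by y - b leaves a remainder that does not involve y, and evaluation at
  \<open>b\<close> shows that it vanishes.\<close>

lemma linear_factor:
  fixes G :: "'a::field fps fps"
  assumes b: "b $ 0 = 0" and G: "ev G b = 0"
  shows "fps_X - fps_const b dvd G"
proof -
  have "regular 1 (fps_X - fps_const b)" using b by (auto simp: regular_def)
  then obtain Q where Q: "\<And>j. j \<ge> 1 \<Longrightarrow> (G - Q * (fps_X - fps_const b)) $ j = 0"
    by (rule weierstrass_division[of _ _ G]) blast
  define R where "R = G - Q * (fps_X - fps_const b)"
  have R: "R = fps_const (R $ 0)"
    by (rule fps_ext) (use Q in \<open>auto simp: R_def\<close>)
  have "ev R b = 0" using b G by (simp add: R_def)
  then have "R = 0" using R by (metis ev_const fps_const_0_eq_0)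
  then show ?thesis by (auto simp: R_def)
qed

lemma linear_factors:
  fixes G :: "'a::field fps fps"
  assumes "finite B" "\<And>b. b \<in> B \<Longrightarrow> b $ 0 = 0 \<and> ev G b = 0"
  shows "(\<Prod>b\<in>B. fps_X - fps_const b) dvd G"
  using assms
proof (induction B rule: finite_induct)
  case (insert b B)
  then obtain U where U: "G = (\<Prod>b\<in>B. fps_X - fps_const b) * U" by (metis dvdE insertCI)
  have b: "b $ 0 = 0" "ev G b = 0" using insert.prems by auto
  have "(\<Prod>c\<in>B. b - c) * ev U b = 0" using b by (simp add: U ev_prod)
  moreover have "(\<Prod>c\<in>B. b - c) \<noteq> 0" using insert.hyps by auto
  ultimately have "fps_X - fps_const b dvd U" using b(1) by (intro linear_factor) auto
  then show ?case using insert.hyps by (simp add: U mult.commute mult_dvd_mono)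
qed simp

text \<open>The substitution t -> \<omega> t. For \<omega>^m = 1 these are the conjugations of
  series in t over series in x = t^m.\<close>

definition rot :: "complex \<Rightarrow> complex fps" where
  "rot \<omega> = fps_const \<omega> * fps_X"

lemma rot_nth_0 [simp]: "rot \<omega> $ 0 = 0"
  by (simp add: rot_def)

lemma compose_rot_nth [simp]: "(a oo rot \<omega>) $ n = \<omega> ^ n * a $ n"
  by (simp add: rot_def)

lemma X_power_compose_rot: "\<omega> ^ m = 1 \<Longrightarrow> fps_X ^ m oo rot \<omega> = fps_X ^ m"
  by (rule fps_ext) (simp add: fps_X_power_nth)

text \<open>A set rather than a family over the roots of unity: each conjugate counts once, so
  \<open>conj_prod\<close> is the minimal polynomial over series in x = t^m even if \<open>y\<close>
  is a series in a power of t.\<close>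

definition conjugates :: "nat \<Rightarrow> complex fps \<Rightarrow> complex fps set" where
  "conjugates m y = (\<lambda>\<omega>. y oo rot \<omega>) ` {\<omega>. \<omega> ^ m = 1}"

definition conj_prod :: "nat \<Rightarrow> complex fps \<Rightarrow> complex fps fps" where
  "conj_prod m y = (\<Prod>b\<in>conjugates m y. fps_X - fps_const b)"

lemma finite_conjugates: "m \<ge> 1 \<Longrightarrow> finite (conjugates m y)"
  unfolding conjugates_def by (intro finite_imageI finite_roots_unity) simp

lemma self_in_conjugates: "y \<in> conjugates m y"
  unfolding conjugates_def by (rule image_eqI[of _ _ 1]) (auto intro: fps_ext)

lemma conjugates_nth_0: "b \<in> conjugates m y \<Longrightarrow> b $ 0 = y $ 0"
  by (auto simp: conjugates_def)

lemma compose_rot_inj: "\<omega> \<noteq> 0 \<Longrightarrow> inj (\<lambda>b. b oo rot \<omega>)"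
  by (rule injI) (auto simp: fps_eq_iff)

lemma conjugates_rot:
  assumes "m \<ge> 1" "\<omega> ^ m = 1"
  shows "bij_betw (\<lambda>b. b oo rot \<omega>) (conjugates m y) (conjugates m y)"
proof -
  have "\<omega> \<noteq> 0" using assms by (auto simp: power_0_left)
  then have inj: "inj_on (\<lambda>b. b oo rot \<omega>) (conjugates m y)"
    using compose_rot_inj inj_on_subset by blast
  have "(\<lambda>b. b oo rot \<omega>) ` conjugates m y \<subseteq> conjugates m y"
  proof safe
    fix b assume "b \<in> conjugates m y"
    then obtain \<omega>' where \<omega>': "b = y oo rot \<omega>'" "\<omega>' ^ m = 1" by (auto simp: conjugates_def)
    then have "b oo rot \<omega> = y oo rot (\<omega>' * \<omega>)"
      by (intro fps_ext) (simp add: power_mult_distrib)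
    moreover have "(\<omega>' * \<omega>) ^ m = 1" using assms \<omega>' by (simp add: power_mult_distrib)
    ultimately show "b oo rot \<omega> \<in> conjugates m y" by (auto simp: conjugates_def)
  qed
  then show ?thesis using inj finite_conjugates[OF assms(1)]
    by (metis endo_inj_surj bij_betw_def)
qed

lemma conj_prod_rot:
  assumes "m \<ge> 1" "\<omega> ^ m = 1"
  shows "sx (rot \<omega>) (conj_prod m y) = conj_prod m y"
proof -
  have "sx (rot \<omega>) (conj_prod m y) = (\<Prod>b\<in>conjugates m y. fps_X - fps_const (b oo rot \<omega>))"
    by (simp add: conj_prod_def sx_prod)
  also have "\<dots> = conj_prod m y"
    unfolding conj_prod_def by (rule prod.reindex_bij_betw[OF conjugates_rot[OF assms]])
  finally show ?thesis .
qed

section \<open>Descent from the ramified variable to x\<close>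

lemma exists_primitive_root_of_unity:
  assumes "m \<ge> 1"
  obtains \<omega> :: complex where "\<And>j. \<omega> ^ j = 1 \<longleftrightarrow> m dvd j"
proof -
  define \<omega> where "\<omega> = exp (2 * of_real pi * \<i> / of_nat m)"
  have "\<omega> ^ j = exp (2 * of_real pi * \<i> * of_nat j / of_nat m)" for j
  proof -
    have "of_nat j * (2 * of_real pi * \<i> / of_nat m) = 2 * of_real pi * \<i> * of_nat j / (of_nat m :: complex)"
      by simp
    then show ?thesis unfolding \<omega>_def by (simp only: exp_of_nat_mult[symmetric])
  qed
  then have "\<omega> ^ j = 1 \<longleftrightarrow> m dvd j" for j
    using complex_root_unity_eq_1[of m j] assms by simp
  then show ?thesis using that by blast
qed

text \<open>A primitive m-th root of unity multiplies the coefficient of t^i by \<omega>^i, so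
  invariance kills every exponent not divisible by m.\<close>

lemma invariant_descends:
  assumes m: "m \<ge> 1" and inv: "\<And>\<omega>. \<omega> ^ m = 1 \<Longrightarrow> sx (rot \<omega>) F = F"
  obtains F' where "F = sx (fps_X ^ m) F'" "\<And>i j. F' $ j $ i = F $ j $ (m * i)"
proof -
  obtain \<omega> :: complex where \<omega>: "\<And>j. \<omega> ^ j = 1 \<longleftrightarrow> m dvd j"
    using exists_primitive_root_of_unity[OF m] by blast
  define F' where "F' = Abs_fps (\<lambda>j. Abs_fps (\<lambda>i. F $ j $ (m * i)))"
  have "F $ j $ i = (sx (fps_X ^ m) F') $ j $ i" for i j
  proof (cases "m dvd i")
    case True
    then show ?thesis using m by (simp add: fps_nth_compose_X_power F'_def)
  next
    case False
    have "\<omega> ^ m = 1" using \<omega>[of m] by simp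
    then have "(sx (rot \<omega>) F) $ j $ i = F $ j $ i" by (simp only: inv)
    then have "\<omega> ^ i * F $ j $ i = F $ j $ i" by simp
    then have "F $ j $ i = 0" using \<omega>[of i] False by auto
    then show ?thesis using m False by (simp add: fps_nth_compose_X_power)
  qed
  then have "F = sx (fps_X ^ m) F'" by (intro fps_ext)
  moreover have "F' $ j $ i = F $ j $ (m * i)" for i j by (simp add: F'_def)
  ultimately show ?thesis by (rule that)
qed

lemma sx_X_power_inj:
  assumes "m \<ge> 1" "sx (fps_X ^ m) F = sx (fps_X ^ m) G"
  shows "F = G"
proof (intro fps_ext)
  fix i j
  have "(sx (fps_X ^ m) F) $ j $ (m * i) = (sx (fps_X ^ m) G) $ j $ (m * i)" using assms by simp
  then show "F $ j $ i = G $ j $ i" using assms(1) by (simp add: fps_nth_compose_X_power)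
qed

lemma conj_prod_dvd:
  assumes "m \<ge> 1" "y $ 0 = 0" "psubst G (fps_X ^ m) y = 0"
  shows "conj_prod m y dvd sx (fps_X ^ m) G"
  unfolding conj_prod_def
proof (rule linear_factors[OF finite_conjugates[OF assms(1)]])
  fix b assume b: "b \<in> conjugates m y"
  then obtain \<omega> where \<omega>: "b = y oo rot \<omega>" "\<omega> ^ m = 1" by (auto simp: conjugates_def)
  have "psubst G (fps_X ^ m) y oo rot \<omega> = psubst G (fps_X ^ m oo rot \<omega>) (y oo rot \<omega>)"
    using assms by (intro compose_psubst) auto
  then have "psubst G (fps_X ^ m) b = 0" using \<omega> assms(3) by (simp add: X_power_compose_rot)
  then show "b $ 0 = 0 \<and> ev (sx (fps_X ^ m) G) b = 0"
    using b conjugates_nth_0 assms(2) by (simp add: psubst_def)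
qed

lemma conj_prod_descends:
  assumes "m \<ge> 1"
  obtains P where "sx (fps_X ^ m) P = conj_prod m y" "\<And>i j. P $ j $ i = conj_prod m y $ j $ (m * i)"
proof -
  obtain P where "conj_prod m y = sx (fps_X ^ m) P" "\<And>i j. P $ j $ i = conj_prod m y $ j $ (m * i)"
    using invariant_descends[OF assms conj_prod_rot[OF assms]] by blast
  then show ?thesis using that by metis
qed

lemma conj_prod_nonzero: "conj_prod m y \<noteq> 0"
proof -
  have "fps_X - fps_const b \<noteq> 0" for b :: "complex fps"
  proof
    assume "fps_X - fps_const b = 0"
    then have "(fps_X - fps_const b) $ 1 = 0" by simp
    then show False by simp
  qed
  then show ?thesis unfolding conj_prod_def
    by (cases "finite (conjugates m y)") (auto simp: prod_zero_iff simp del: right_minus_eq)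
qed

lemma sx_rot_sx_X_power:
  assumes "m \<ge> 1" "\<omega> ^ m = 1"
  shows "sx (rot \<omega>) (sx (fps_X ^ m) G) = sx (fps_X ^ m) G"
proof (rule fps_ext)
  fix j
  have "(G $ j oo fps_X ^ m) oo rot \<omega> = G $ j oo (fps_X ^ m oo rot \<omega>)"
    by (rule fps_compose_assoc[symmetric]) (use assms in auto)
  then show "(sx (rot \<omega>) (sx (fps_X ^ m) G)) $ j = (sx (fps_X ^ m) G) $ j"
    by (simp add: X_power_compose_rot assms)
qed

text \<open>All conjugates are roots of \<open>G\<close>, so \<open>conj_prod\<close> divides it
  over series in t. Both are invariant under t -> \<omega> t, hence so is the cofactor, and the
  divisibility descends to series in x.\<close>

lemma minimal_polynomial_dvd:
  assumes m: "m \<ge> 1" and y: "y $ 0 = 0" and P: "sx (fps_X ^ m) P = conj_prod m y"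
    and G: "psubst G (fps_X ^ m) y = 0"
  shows "P dvd G"
proof -
  obtain U where U: "sx (fps_X ^ m) G = conj_prod m y * U"
    using conj_prod_dvd[OF m y G] by (rule dvdE)
  have "sx (rot \<omega>) U = U" if \<omega>: "\<omega> ^ m = 1" for \<omega>
  proof -
    have "sx (rot \<omega>) (sx (fps_X ^ m) G) = sx (fps_X ^ m) G" by (rule sx_rot_sx_X_power[OF m \<omega>])
    then have "conj_prod m y * sx (rot \<omega>) U = conj_prod m y * U"
      unfolding U by (simp add: conj_prod_rot[OF m \<omega>])
    then show ?thesis using conj_prod_nonzero by simp
  qed
  then obtain U' where "U = sx (fps_X ^ m) U'" using invariant_descends[OF m, of U] by metis
  then have "sx (fps_X ^ m) G = sx (fps_X ^ m) (P * U')" using m by (simp add: U P)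
  then show ?thesis using sx_X_power_inj[OF m] by (metis dvd_triv_left)
qed

lemma conj_prod_at_0:
  assumes "m \<ge> 1" "y $ 0 = 0"
  shows "conj_prod m y $ j $ 0 = (if j = card (conjugates m y) then 1 else 0)"
proof -
  \<comment> \<open>Every conjugate vanishes at t = 0, so each factor y - b restricts to y.\<close>
  have "sx 0 (conj_prod m y) = (\<Prod>b\<in>conjugates m y. fps_X)"
    unfolding conj_prod_def by (subst sx_prod) (use assms in \<open>auto simp: conjugates_nth_0 intro!: prod.cong\<close>)
  then have *: "sx 0 (conj_prod m y) = fps_X ^ card (conjugates m y)" by simp
  have "(sx 0 (conj_prod m y)) $ j $ 0 = conj_prod m y $ j $ 0" by simp
  moreover have "(fps_X ^ n :: complex fps fps) $ j $ 0 = (if j = n then 1 else 0)" for n by simp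
  ultimately show ?thesis by (simp only: *)
qed

lemma card_conjugates: "m \<ge> 1 \<Longrightarrow> card (conjugates m y) \<ge> 1"
  using finite_conjugates self_in_conjugates by (metis One_nat_def Suc_leI card_gt_0_iff empty_iff)

text \<open>The descended product divides \<open>G\<close> and is not a unit, so the cofactor is
  one. In this form irreducibility says that the Puiseux roots of \<open>G\<close> are simple and
  all conjugate.\<close>

lemma irreducible_factorization:
  fixes G :: "complex fps fps"
  assumes G: "irreducible G" and m: "m \<ge> 1" and y: "y $ 0 = 0" and root: "psubst G (fps_X ^ m) y = 0"
  obtains U where "sx (fps_X ^ m) G = conj_prod m y * U" "U $ 0 $ 0 \<noteq> 0"
proof -
  obtain P where P: "sx (fps_X ^ m) P = conj_prod m y" "\<And>i j. P $ j $ i = conj_prod m y $ j $ (m * i)"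
    using conj_prod_descends[OF m] by blast
  obtain U where U: "G = P * U" using minimal_polynomial_dvd[OF m y P(1) root] by (rule dvdE)
  have "P $ 0 $ 0 = 0" using conj_prod_at_0[OF m y, of 0] card_conjugates[OF m, of y] by (simp add: P)
  then have "\<not> P dvd 1" by (simp add: fps2_unit_iff)
  then have "U dvd 1" using G U irreducibleD by blast
  then have "U $ 0 $ 0 \<noteq> 0" by (simp add: fps2_unit_iff)
  then have "sx (fps_X ^ m) U $ 0 $ 0 \<noteq> 0" by simp
  moreover have "sx (fps_X ^ m) G = conj_prod m y * sx (fps_X ^ m) U" using m by (simp add: U P)
  ultimately show ?thesis using that by blast
qed

lemma convergent2_conj_prod:
  assumes m: "m \<ge> 1" and y: "convergent1 y"
  shows "convergent2 (conj_prod m y)"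
  unfolding conj_prod_def
proof (intro convergent2_prod convergent2_diff convergent2_X)
  fix b assume "b \<in> conjugates m y"
  then obtain \<omega> where \<omega>: "b = y oo rot \<omega>" "\<omega> ^ m = 1" by (auto simp: conjugates_def)
  have "norm \<omega> ^ m = 1 ^ m" using \<omega>(2) by (metis norm_one norm_power power_one)
  then have "norm \<omega> = 1" by (rule power_eq_imp_eq_base) (use m in auto)
  then have "norm (b $ i) = norm (y $ i)" for i by (simp add: \<omega>(1) norm_mult norm_power)
  then have "convergent1 b" using y by (simp add: convergent1_iff_bound)
  then show "convergent2 (fps_const b)" by (simp add: convergent1_def)
qed

lemma minimal_polynomial:
  assumes m: "m \<ge> 1" and y: "y $ 0 = 0" "convergent1 y"
  obtains P where "sx (fps_X ^ m) P = conj_prod m y" "convergent2 P" "regular (card (conjugates m y)) P"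
    "P $ 0 $ 0 = 0"
proof -
  obtain P where P: "sx (fps_X ^ m) P = conj_prod m y" "\<And>i j. P $ j $ i = conj_prod m y $ j $ (m * i)"
    using conj_prod_descends[OF m] by blast
  obtain C R where CR: "C > 0" "R \<ge> 1" "\<And>i j. norm (conj_prod m y $ j $ i) \<le> C * R ^ (i + j)"
    using convergent2_conj_prod[OF m y(2)] by (rule convergent2E) blast
  have "convergent2 P"
  proof (rule convergent2I[of C "R ^ m"])
    fix i j
    have "m * i + j \<le> m * (i + j)" using m by (simp add: distrib_left)
    then have "C * R ^ (m * i + j) \<le> C * R ^ (m * (i + j))"
      using CR by (intro mult_left_mono power_increasing) auto
    then show "norm (P $ j $ i) \<le> C * (R ^ m) ^ (i + j)"
      using CR(3)[of j "m * i"] by (simp add: P(2) power_mult)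
  qed (use CR in auto)
  moreover have "regular (card (conjugates m y)) P" "P $ 0 $ 0 = 0"
    using conj_prod_at_0[OF m y(1)] card_conjugates[OF m, of y] by (auto simp: regular_def P(2))
  ultimately show ?thesis using that P(1) by blast
qed

section \<open>Convergent and formal irreducibility\<close>

lemma fps2_X_factor:
  fixes F :: "'a::idom fps fps"
  assumes "\<And>j. F $ j $ 0 = 0"
  shows "F = fps_const fps_X * Abs_fps (\<lambda>j. fps_shift 1 (F $ j))"
proof (rule fps_ext)
  fix j
  have "fps_X * fps_shift 1 (F $ j) = F $ j"
    by (rule fps_ext) (use assms in \<open>auto simp: gr0_conv_Suc\<close>)
  then show "F $ j = (fps_const fps_X * Abs_fps (\<lambda>j. fps_shift 1 (F $ j))) $ j"
    by simp
qed

text \<open>Setting x = 0 lands in an integral domain, so one of two factors of x vanishes there and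
  is divisible by x; the other one is then a unit.\<close>

lemma irreducible_fps2_X: "irreducible (fps_const fps_X :: 'a::field fps fps)"
proof (rule irreducibleI)
  show "fps_const fps_X \<noteq> (0 :: 'a fps fps)" by simp
  show "\<not> fps_const fps_X dvd (1 :: 'a fps fps)" by (simp add: fps2_unit_iff)
  fix a b :: "'a fps fps"
  assume ab: "fps_const fps_X = a * b"
  have X0: "sx 0 a * sx 0 b = 0"
    using arg_cong[OF ab, of "sx 0"] by simp
  have key: "d dvd 1" if "fps_const fps_X = c * d" "sx 0 c = 0" for c d :: "'a fps fps"
  proof -
    have "c $ j $ 0 = 0" for j
    proof -
      have "(sx 0 c) $ j $ 0 = 0" by (simp only: that(2) fps_zero_nth)
      then show ?thesis by simp
    qed
    from fps2_X_factor[OF this] obtain c' where c: "c = fps_const fps_X * c'" by blast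
    have "fps_const fps_X * 1 = c * d" using that(1) by (simp only: mult_1_right)
    also have "\<dots> = fps_const fps_X * (c' * d)" unfolding c by (rule mult.assoc)
    finally have "fps_const fps_X * 1 = fps_const fps_X * (c' * d)" .
    then have "c' * d = 1" by (metis mult_cancel_left \<open>fps_const fps_X \<noteq> (0 :: 'a fps fps)\<close>)
    then show ?thesis by (metis dvd_triv_right)
  qed
  have ba: "fps_const fps_X = b * a" using ab by (metis mult.commute)
  from X0 have "sx 0 a = 0 \<or> sx 0 b = 0" by (rule mult_eq_0_iff[THEN iffD1])
  then show "a dvd 1 \<or> b dvd 1"
    using key[OF ab] key[OF ba] by blast
qed

lemma irreducible_times_unit:
  fixes a b :: "'a::idom"
  assumes a: "irreducible a" and b: "b dvd 1"
  shows "irreducible (a * b)"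
proof (rule irreducibleI)
  obtain b' where b': "1 = b * b'" using b by (rule dvdE)
  then have ab: "a * b * b' = a" by (metis mult.assoc mult.right_neutral)
  show "a * b \<noteq> 0" using a b' by (metis ab irreducible_def mult_zero_left)
  show "\<not> a * b dvd 1" using a by (metis dvd_mult_left irreducible_def)
  fix c d assume "a * b = c * d"
  then have "a = c * (d * b')" using ab by (metis mult.assoc)
  then have "c dvd 1 \<or> d * b' dvd 1" using a irreducibleD by blast
  then show "c dvd 1 \<or> d dvd 1" by (metis dvd_mult_left)
qed

lemma Rep_cps2_dvd_1: "h dvd 1 \<Longrightarrow> Rep_cps2 h $ 0 $ 0 \<noteq> 0"
proof -
  assume "h dvd 1"
  then obtain k where "1 = h * k" by (rule dvdE)
  then have "Rep_cps2 h dvd 1" by (metis dvd_triv_left one_cps2.rep_eq times_cps2.rep_eq)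
  then show ?thesis by (simp add: fps2_unit_iff)
qed

text \<open>For order n = 0 the Weierstrass division of 1 has no remainder, and the quotient bound
  makes the inverse converge.\<close>

lemma cps2_dvd_1I:
  assumes "Rep_cps2 h $ 0 $ 0 \<noteq> 0"
  shows "h dvd 1"
proof -
  have reg: "regular 0 (Rep_cps2 h)" using assms by (simp add: regular_def)
  obtain Q where Q: "\<And>j. j \<ge> 0 \<Longrightarrow> (1 - Q * Rep_cps2 h) $ j = 0"
    using weierstrass_division[OF reg] by metis
  have "convergent2 Q"
    by (rule convergent2_quotient[OF reg _ _ Q]) (use Rep_cps2[of h] in auto)
  then have R: "Rep_cps2 (Abs_cps2 Q) = Q" by (simp add: Abs_cps2_inverse)
  have "1 - Q * Rep_cps2 h = 0" using Q by (intro fps_ext) simp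
  then have "Abs_cps2 Q * h = 1"
    by (simp add: Rep_cps2_inject[symmetric] times_cps2.rep_eq one_cps2.rep_eq R)
  then show ?thesis by (metis dvd_triv_right)
qed

lemma dvd_1_iff_cps2: "h dvd 1 \<longleftrightarrow> Rep_cps2 h $ 0 $ 0 \<noteq> 0"
  using cps2_dvd_1I Rep_cps2_dvd_1 by blast

lemma cps2_dvdI:
  assumes "Rep_cps2 g = Rep_cps2 h * U" "regular n (Rep_cps2 h)"
  obtains u where "g = h * u" "Rep_cps2 u = U"
proof -
  have "convergent2 U"
    by (rule convergent2_quotient[OF assms(2), of "Rep_cps2 g"])
      (use Rep_cps2[of g] Rep_cps2[of h] in \<open>auto simp: assms(1) mult.commute\<close>)
  then have "Rep_cps2 (Abs_cps2 U) = U" by (simp add: Abs_cps2_inverse)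
  moreover from this have "g = h * Abs_cps2 U"
    by (simp add: Rep_cps2_inject[symmetric] times_cps2.rep_eq assms(1))
  ultimately show ?thesis using that by blast
qed

text \<open>The minimal polynomial of a convergent root is convergent and divides every formal factor that
  vanishes on this root.\<close>

theorem irreducible_Rep_cps2:
  assumes h: "irreducible h"
  shows "irreducible (Rep_cps2 h)"
    and "\<exists>a b. a $ 0 = 0 \<and> b $ 0 = 0 \<and> (a \<noteq> 0 \<or> b \<noteq> 0) \<and> psubst (Rep_cps2 h) a b = 0"
proof -
  define H where "H = Rep_cps2 h"
  have H0: "H \<noteq> 0" using h by (metis H_def Rep_cps2_inject irreducible_def zero_cps2.rep_eq)
  have H00: "H $ 0 $ 0 = 0" using h by (auto simp: H_def irreducible_def dvd_1_iff_cps2)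
  have cH: "convergent2 H" using Rep_cps2[of h] by (simp add: H_def)
  have "irreducible H \<and> (\<exists>a b. a $ 0 = 0 \<and> b $ 0 = 0 \<and> (a \<noteq> 0 \<or> b \<noteq> 0) \<and> psubst H a b = 0)"
  proof (cases "\<forall>j. H $ j $ 0 = 0")
    case True
    \<comment> \<open>Here h(0, y) = 0, so \<open>H\<close> is regular in y of no order and
      Newton-Puiseux does not apply; but then x divides \<open>h\<close>, and irreducibility makes
      \<open>h\<close> a unit multiple of x.\<close>
    define K where "K = Abs_fps (\<lambda>j. fps_shift 1 (H $ j))"
    have HK: "H = fps_const fps_X * K" unfolding K_def using True by (intro fps2_X_factor) auto
    obtain C R where CR: "C > 0" "R \<ge> 1" "\<And>i j. norm (H $ j $ i) \<le> C * R ^ (i + j)"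
      using cH by (rule convergent2E) blast
    have "convergent2 K"
    proof (rule convergent2I[of "C * R" R])
      show "norm (K $ j $ i) \<le> C * R * R ^ (i + j)" for i j
        using CR(3)[of j "Suc i"] by (simp add: K_def mult.assoc)
    qed (use CR in auto)
    then have K: "Rep_cps2 (Abs_cps2 K) = K" by (simp add: Abs_cps2_inverse)
    then have "h = X2 * Abs_cps2 K"
      by (simp add: Rep_cps2_inject[symmetric] times_cps2.rep_eq X2.rep_eq HK[unfolded H_def])
    moreover have "\<not> X2 dvd 1" by (simp add: dvd_1_iff_cps2 X2.rep_eq)
    ultimately have "Abs_cps2 K dvd 1" using h irreducibleD by blast
    then have "K dvd 1" using K by (simp add: dvd_1_iff_cps2 fps2_unit_iff)
    then have "irreducible H"
      unfolding HK using irreducible_fps2_X irreducible_times_unit by blast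
    moreover have "psubst H 0 fps_X = 0" unfolding HK by simp
    ultimately show ?thesis by (intro conjI exI[of _ 0] exI[of _ fps_X]) auto
  next
    case False
    define n where "n = (LEAST j. H $ j $ 0 \<noteq> 0)"
    have reg: "regular n H" unfolding regular_def n_def
      using False by (metis (mono_tags, lifting) LeastI_ex not_less_Least)
    then have "n \<ge> 1" using H00 by (cases n) (auto simp: regular_def)
    then obtain m y where my: "m \<ge> 1" "y $ 0 = 0" "convergent1 y" "psubst H (fps_X ^ m) y = 0"
      using newton_puiseux[OF cH reg] by blast
    obtain P where P: "sx (fps_X ^ m) P = conj_prod m y" "convergent2 P"
        "regular (card (conjugates m y)) P" "P $ 0 $ 0 = 0"
      using minimal_polynomial[OF my(1-3)] by blast
    have RP: "Rep_cps2 (Abs_cps2 P) = P" using P(2) by (simp add: Abs_cps2_inverse)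
    obtain U where U: "H = P * U" using minimal_polynomial_dvd[OF my(1,2) P(1) my(4)] by (rule dvdE)
    obtain u where u: "h = Abs_cps2 P * u" "Rep_cps2 u = U"
      by (rule cps2_dvdI[of h "Abs_cps2 P" U]) (use U P(3) in \<open>auto simp: RP H_def\<close>)
    have "\<not> Abs_cps2 P dvd 1" using P(4) by (simp add: dvd_1_iff_cps2 RP)
    then have "u dvd 1" using h u(1) irreducibleD by blast
    then have Uu: "U dvd 1" using u(2) by (simp add: dvd_1_iff_cps2 fps2_unit_iff)
    \<comment> \<open>A formal factor vanishing at the convergent root absorbs all of
      \<open>P\<close>, so the other factor divides the unit \<open>U\<close>.\<close>
    have key: "G2 dvd 1" if GG: "H = G1 * G2" and G1: "psubst G1 (fps_X ^ m) y = 0" for G1 G2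
    proof -
      obtain V where V: "G1 = P * V" using minimal_polynomial_dvd[OF my(1,2) P(1) G1] by (rule dvdE)
      have "P * U = P * (V * G2)" using GG U V by (simp add: mult.assoc)
      moreover have "P \<noteq> 0" using H0 U by auto
      ultimately have "U = V * G2" by simp
      then show ?thesis using Uu by (metis dvd_triv_right dvd_trans)
    qed
    have "irreducible H"
    proof (rule irreducibleI)
      fix G1 G2 assume G: "H = G1 * G2"
      have G': "H = G2 * G1" using G by (metis mult.commute)
      have "psubst G1 (fps_X ^ m) y * psubst G2 (fps_X ^ m) y = psubst H (fps_X ^ m) y"
        unfolding G using my(1,2) by simp
      then have "psubst G1 (fps_X ^ m) y = 0 \<or> psubst G2 (fps_X ^ m) y = 0"
        by (simp only: my(4) mult_eq_0_iff)
      then show "G1 dvd 1 \<or> G2 dvd 1" using key[OF G] key[OF G'] by blast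
    qed (use H0 H00 in \<open>auto simp: fps2_unit_iff\<close>)
    moreover have "(fps_X ^ m :: complex fps) \<noteq> 0" by simp
    ultimately show ?thesis using my by (intro conjI exI[of _ "fps_X ^ m"] exI[of _ y]) auto
  qed
  then show "irreducible (Rep_cps2 h)"
    "\<exists>a b. a $ 0 = 0 \<and> b $ 0 = 0 \<and> (a \<noteq> 0 \<or> b \<noteq> 0) \<and> psubst (Rep_cps2 h) a b = 0"
    by (auto simp: H_def)
qed

section \<open>Straightening a smooth curve\<close>

text \<open>Cutting both sums at n makes the formula symmetric in the two variables, which is what
  their exchange requires.\<close>

lemma psubst_nth:
  assumes a: "a $ 0 = 0" and b: "b $ 0 = 0"
  shows "psubst F a b $ n = (\<Sum>j\<le>n. \<Sum>i\<le>n. F $ j $ i * (a ^ i * b ^ j) $ n)"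
proof -
  have "((F $ j oo a) * b ^ j) $ n = (\<Sum>i\<le>n. F $ j $ i * (a ^ i * b ^ j) $ n)" for j
  proof -
    have "(F $ j oo a) $ k = (\<Sum>i\<le>n. F $ j $ i * (a ^ i) $ k)" if "k \<le> n" for k
      unfolding fps_compose_nth
      by (rule sum.mono_neutral_left) (use that startsby_zero_power_prefix[OF a] in auto)
    then have "((F $ j oo a) * b ^ j) $ n = (\<Sum>k=0..n. (\<Sum>i\<le>n. F $ j $ i * (a ^ i) $ k) * (b ^ j) $ (n - k))"
      unfolding fps_mult_nth by (intro sum.cong) auto
    also have "\<dots> = (\<Sum>k=0..n. \<Sum>i\<le>n. F $ j $ i * ((a ^ i) $ k * (b ^ j) $ (n - k)))"
      by (simp add: sum_distrib_right mult.assoc)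
    also have "\<dots> = (\<Sum>i\<le>n. \<Sum>k=0..n. F $ j $ i * ((a ^ i) $ k * (b ^ j) $ (n - k)))"
      by (rule sum.swap)
    finally show ?thesis by (simp add: fps_mult_nth sum_distrib_left)
  qed
  then show ?thesis unfolding psubst_def ev_def by simp
qed

lemma psubst_left_0:
  assumes "b $ 0 = 0"
  shows "psubst F 0 b = Abs_fps (\<lambda>j. F $ j $ 0) oo b"
proof (rule fps_ext)
  fix n
  have "(\<Sum>i\<le>n. F $ j $ i * (0 ^ i * b ^ j) $ n) = F $ j $ 0 * (b ^ j) $ n" for j
  proof -
    have "(\<Sum>i\<le>n. F $ j $ i * (0 ^ i * b ^ j) $ n) = (\<Sum>i\<in>{0}. F $ j $ i * (0 ^ i * b ^ j) $ n)"
      by (rule sum.mono_neutral_right) (auto simp: power_0_left)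
    then show ?thesis by simp
  qed
  then show "psubst F 0 b $ n = (Abs_fps (\<lambda>j. F $ j $ 0) oo b) $ n"
    using assms by (simp add: psubst_nth fps_compose_nth atMost_atLeast0)
qed

section \<open>Exchange of the variables and partial derivatives\<close>

definition swap :: "'a fps fps \<Rightarrow> 'a fps fps" where
  "swap F = Abs_fps (\<lambda>j. Abs_fps (\<lambda>i. F $ i $ j))"

lemma swap_nth [simp]: "swap F $ j $ i = F $ i $ j"
  by (simp add: swap_def)

lemma swap_swap [simp]: "swap (swap F) = F"
  by (intro fps_ext) simp

lemma swap_mult: "swap (F * G) = swap F * swap G" for F G :: "'a::comm_ring_1 fps fps"
proof (intro fps_ext)
  fix j i
  have "(\<Sum>(a, b)\<in>{..j} \<times> {..i}. F $ b $ a * G $ (i - b) $ (j - a))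
      = (\<Sum>(b, a)\<in>{..i} \<times> {..j}. F $ b $ a * G $ (i - b) $ (j - a))"
    by (simp only: sum.cartesian_product[symmetric]) (rule sum.swap)
  then show "swap (F * G) $ j $ i = (swap F * swap G) $ j $ i"
    by (simp add: fps2_mult_nth)
qed

lemma swap_uminus: "swap (- F) = - swap F" and swap_diff: "swap (F - G) = swap F - swap G"
  for F G :: "'a::comm_ring_1 fps fps"
  by (auto intro!: fps_ext)

lemma swap_1: "swap 1 = (1 :: 'a::comm_ring_1 fps fps)"
proof (intro fps_ext)
  fix j i show "swap (1 :: 'a fps fps) $ j $ i = 1 $ j $ i"
    by (cases "i = 0"; cases "j = 0") auto
qed

lemma psubst_swap: "a $ 0 = 0 \<Longrightarrow> b $ 0 = 0 \<Longrightarrow> psubst (swap F) a b = psubst F b a"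
proof (rule fps_ext)
  fix n assume "a $ 0 = 0" "b $ 0 = 0"
  then show "psubst (swap F) a b $ n = psubst F b a $ n"
    by (simp add: psubst_nth mult.commute[of "a ^ _"]) (rule sum.swap)
qed

lemma swap_dvd: "swap F dvd swap G \<longleftrightarrow> F dvd G" for F G :: "'a::comm_ring_1 fps fps"
  by (metis dvdE dvd_triv_left swap_mult swap_swap)

lemma irreducible_swap:
  fixes F :: "'a::idom fps fps"
  assumes "irreducible F"
  shows "irreducible (swap F)"
proof (rule irreducibleI)
  have u: "swap G dvd 1 \<longleftrightarrow> G dvd 1" for G :: "'a fps fps"
    using swap_dvd[of G 1] by (simp add: swap_1)
  show "swap F \<noteq> 0"
  proof
    assume "swap F = 0"
    then have "F $ j $ i = 0" for i j by (metis swap_nth fps_zero_nth)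
    then have "F = 0" by (intro fps_ext) simp
    then show False using assms by simp
  qed
  show "\<not> swap F dvd 1" using assms u by (simp add: irreducible_def)
  fix a b assume "swap F = a * b"
  then have "F = swap a * swap b" by (metis swap_mult swap_swap)
  then have "swap a dvd 1 \<or> swap b dvd 1" using assms irreducibleD by blast
  then show "a dvd 1 \<or> b dvd 1" by (simp add: u)
qed

definition deriv_inner :: "'a::comm_ring_1 fps fps \<Rightarrow> 'a fps fps" where
  "deriv_inner F = Abs_fps (\<lambda>j. fps_deriv (F $ j))"

lemma deriv_inner_nth [simp]: "deriv_inner F $ j = fps_deriv (F $ j)"
  by (simp add: deriv_inner_def)

lemma deriv_inner_add: "deriv_inner (F + G) = deriv_inner F + deriv_inner G"
  by (rule fps_ext) simp

lemma deriv_inner_const: "deriv_inner (fps_const c) = fps_const (fps_deriv c)"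
  by (rule fps_ext) simp

lemma deriv_inner_mult: "deriv_inner (F * G) = F * deriv_inner G + deriv_inner F * G"
proof (rule fps_ext)
  fix j
  have "fps_deriv (sum f A) = (\<Sum>x\<in>A. fps_deriv (f x))" for f :: "nat \<Rightarrow> 'a fps" and A
    by (induction A rule: infinite_finite_induct) auto
  then show "deriv_inner (F * G) $ j = (F * deriv_inner G + deriv_inner F * G) $ j"
    by (simp add: fps_mult_nth sum.distrib)
qed

lemma fps_deriv_fps_nth: "fps_deriv F $ j $ i = of_nat (j + 1) * F $ (j + 1) $ i"
  for F :: "'a::comm_ring_1 fps fps"
proof -
  have "(of_nat m :: 'a fps) * a = fps_const (of_nat m) * a" for m and a :: "'a fps"
    by (simp add: fps_of_nat)
  then show ?thesis by (simp only: fps_deriv_nth fps_mult_left_const_nth)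
qed

lemma fps_deriv_swap: "fps_deriv (swap F) = swap (deriv_inner F)"
  by (intro fps_ext) (simp add: fps_deriv_fps_nth del: of_nat_Suc of_nat_add)

lemma deriv_inner_swap: "deriv_inner (swap F) = swap (fps_deriv F)"
  by (metis fps_deriv_swap swap_swap)

section \<open>Weighted substitution with polynomial coefficients\<close>

definition lift1 :: "'a::comm_ring_1 fps \<Rightarrow> 'a poly fps" where
  "lift1 a = Abs_fps (\<lambda>n. [:a $ n:])"

definition lift2 :: "'a::comm_ring_1 fps fps \<Rightarrow> 'a poly fps fps" where
  "lift2 F = Abs_fps (\<lambda>j. lift1 (F $ j))"

lemma lift1_nth [simp]: "lift1 a $ n = [:a $ n:]" by (simp add: lift1_def)
lemma lift2_nth [simp]: "lift2 F $ n = lift1 (F $ n)" by (simp add: lift2_def)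

lemma lift1_add: "lift1 (a + b) = lift1 a + lift1 b" by (rule fps_ext) simp
lemma lift1_0 [simp]: "lift1 0 = 0" by (rule fps_ext) simp
lemma lift1_mult: "lift1 (a * b) = lift1 a * lift1 b"
  by (rule fps_ext) (simp add: fps_mult_nth sum_to_poly[symmetric] mult.commute)
lemma lift1_sum: "lift1 (\<Sum>i\<in>A. a i) = (\<Sum>i\<in>A. lift1 (a i))"
  by (induction A rule: infinite_finite_induct) (auto simp: lift1_add)
lemma lift2_add: "lift2 (F + G) = lift2 F + lift2 G" by (rule fps_ext) (simp add: lift1_add)
lemma lift2_mult: "lift2 (F * G) = lift2 F * lift2 G"
  by (rule fps_ext) (simp add: fps_mult_nth lift1_sum lift1_mult)
lemma lift2_const: "lift2 (fps_const c) = fps_const (lift1 c)" by (rule fps_ext) simp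

text \<open>\<open>weighted p q F\<close> is the series \<open>F(s^p, z s^q)\<close> in \<open>s\<close>, with coefficients that are polynomials
  in \<open>z\<close>.\<close>

definition weighted :: "nat \<Rightarrow> nat \<Rightarrow> 'a::idom fps fps \<Rightarrow> 'a poly fps" where
  "weighted p q F = psubst (lift2 F) (fps_X ^ p) (fps_const [:0, 1:] * fps_X ^ q)"

lemma weighted_mult:
  "p \<ge> 1 \<Longrightarrow> q \<ge> 1 \<Longrightarrow> weighted p q (F * G) = weighted p q F * weighted p q G"
  by (simp add: weighted_def lift2_mult)

text \<open>The monomial x^i y^j turns into z^j s^(p i + q j), and n together with j recovers i. The
  division is exact whenever such an i exists.\<close>

lemma coeff_weighted:
  assumes "p \<ge> 1" "q \<ge> 1"
  shows "coeff (weighted p q F $ n) j = (if \<exists>i. p * i + q * j = n then F $ j $ ((n - q * j) div p) else 0)"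
proof -
  have t: "[:F $ j' $ i:] * ((fps_X ^ p) ^ i * (fps_const [:0, 1:] * fps_X ^ q) ^ j') $ n
      = (if p * i + q * j' = n then monom (F $ j' $ i) j' else 0)" for i j'
  proof -
    have *: "(fps_X ^ p) ^ i * (fps_const [:0, 1:] * fps_X ^ q) ^ j' = fps_const ([:0, 1:] ^ j') * fps_X ^ (p * i + q * j')"
      by (simp add: power_mult_distrib power_add fps_const_power mult_ac flip: power_mult)
    show ?thesis unfolding * by (simp add: fps_X_power_nth monom_altdef)
  qed
  have "weighted p q F $ n = (\<Sum>j'\<le>n. \<Sum>i\<le>n. if p * i + q * j' = n then monom (F $ j' $ i) j' else 0)"
    unfolding weighted_def using assms by (subst psubst_nth) (auto simp: t simp del: mult_pCons_left intro!: sum.cong)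
  then have "coeff (weighted p q F $ n) j = (\<Sum>j'\<le>n. \<Sum>i\<le>n. if p * i + q * j' = n \<and> j' = j then F $ j' $ i else 0)"
    by (simp add: coeff_sum if_distrib[of "\<lambda>x. coeff x _"] cong: if_cong) (intro sum.cong refl, auto)
  also have "\<dots> = (if \<exists>i. p * i + q * j = n then F $ j $ ((n - q * j) div p) else 0)"
  proof (cases "\<exists>i. p * i + q * j = n")
    case True
    then obtain i where i: "p * i + q * j = n" by blast
    have "i \<le> p * i" "j \<le> q * j" using assms by auto
    then have le: "i \<le> n" "j \<le> n" using i by linarith+
    have iff: "(p * i' + q * j' = n \<and> j' = j) \<longleftrightarrow> (i' = i \<and> j' = j)" for i' j'
      using i assms by auto
    have "(\<Sum>j'\<le>n. \<Sum>i'\<le>n. if p * i' + q * j' = n \<and> j' = j then F $ j' $ i' else 0)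
        = (\<Sum>j'\<le>n. if j' = j then F $ j $ i else 0)"
      unfolding iff using le by (intro sum.cong refl) (auto cong: if_cong)
    also have "\<dots> = F $ j $ i" using le by simp
    also have "i = (n - q * j) div p" using i assms by auto
    finally show ?thesis using True by simp
  next
    case False
    then show ?thesis by (auto intro!: sum.neutral)
  qed
  finally show ?thesis .
qed

lemma weighted_1_1_inj:
  assumes "weighted 1 1 F = weighted 1 1 G"
  shows "F = G"
proof (intro fps_ext)
  fix j i
  have "coeff (weighted 1 1 F $ (i + j)) j = coeff (weighted 1 1 G $ (i + j)) j" using assms by simp
  then show "F $ j $ i = G $ j $ i" by (simp add: coeff_weighted)
qed

text \<open>For j \<le> n the monomial z^j s^n is s^(n - j) (z s)^j, so the degree bound
  characterizes the series in s and z s. It lets factors found over polynomial coefficients be read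
  back as series in two variables.\<close>

lemma weighted_1_1_surj:
  fixes P :: "'a::idom poly fps"
  assumes "\<And>n. degree (P $ n) \<le> n"
  obtains F where "P = weighted 1 1 F" "F $ 0 $ 0 = coeff (P $ 0) 0"
proof
  define F where "F = Abs_fps (\<lambda>j. Abs_fps (\<lambda>i. coeff (P $ (i + j)) j))"
  show "P = weighted 1 1 F"
  proof (intro fps_ext poly_eqI)
    fix n j
    show "coeff (P $ n) j = coeff (weighted 1 1 F $ n) j"
    proof (cases "j \<le> n")
      case True
      then have "\<exists>i. 1 * i + 1 * j = n" by (intro exI[of _ "n - j"]) simp
      then show ?thesis using True by (simp add: coeff_weighted F_def)
    next
      case False
      then show ?thesis using assms[of n] by (auto simp: coeff_weighted coeff_eq_0)
    qed
  qed
  show "F $ 0 $ 0 = coeff (P $ 0) 0" by (simp add: F_def)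
qed

lemma degree_nth_mult_le:
  fixes P Q :: "'a::idom poly fps"
  assumes "\<And>n. degree (P $ n) \<le> n" "\<And>n. degree (Q $ n) \<le> n"
  shows "degree ((P * Q) $ n) \<le> n"
  unfolding fps_mult_nth
proof (rule degree_sum_le)
  fix i assume "i \<in> {0..n}"
  have "degree (P $ i * Q $ (n - i)) \<le> degree (P $ i) + degree (Q $ (n - i))" by (rule degree_mult_le)
  also have "\<dots> \<le> i + (n - i)" by (intro add_mono assms)
  finally show "degree (P $ i * Q $ (n - i)) \<le> n" using \<open>i \<in> {0..n}\<close> by simp
qed simp

lemma degree_nth_power_le:
  fixes P :: "'a::idom poly fps"
  assumes "\<And>n. degree (P $ n) \<le> n"
  shows "degree ((P ^ k) $ n) \<le> n"
  by (induction k arbitrary: n) (auto intro: degree_nth_mult_le assms)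

lemma degree_nth_weighted_1_1: "degree (weighted 1 1 F $ n) \<le> n"
  by (rule degree_le) (auto simp: coeff_weighted)

text \<open>If \<open>f\<close> is repeatedly divided by \<open>l\<close>, the remainders \<open>c k\<close> are the coefficients of \<open>f\<close> in the
  coordinates \<open>(x, l)\<close>.\<close>

lemma coordinate_change:
  fixes f l :: "'a::field fps fps"
  assumes l0: "l $ 0 $ 0 = 0" and l1: "l $ 1 $ 0 \<noteq> 0" and f: "irreducible f" and lf: "\<not> l dvd f"
  obtains g where "irreducible g" "g $ 0 \<noteq> 0"
    "\<And>a b. a $ 0 = 0 \<Longrightarrow> b $ 0 = 0 \<Longrightarrow> psubst g a (psubst l a b) = psubst f a b"
    "\<And>a b. a $ 0 = 0 \<Longrightarrow> b $ 0 = 0 \<Longrightarrow>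
      psubst (deriv_inner l * fps_deriv f - fps_deriv l * deriv_inner f) a b =
      - psubst (fps_deriv l) a b * psubst (deriv_inner g) a (psubst l a b)"
proof -
  have reg: "regular 1 l" using l0 l1 by (simp add: regular_def)
  have "\<exists>Q. \<forall>j\<ge>1. (F - Q * l) $ j = 0" for F
    using weierstrass_division[OF reg, of F] by metis
  then obtain step where step: "\<And>F j. j \<ge> 1 \<Longrightarrow> (F - step F * l) $ j = 0" by metis
  define A where "A k = (step ^^ k) f" for k
  define c where "c k = (A k - A (Suc k) * l) $ 0" for k
  have A: "A k = fps_const (c k) + l * A (Suc k)" for k
  proof -
    have "A k - A (Suc k) * l = fps_const (c k)"
    proof (rule fps_ext)
      fix j show "(A k - A (Suc k) * l) $ j = fps_const (c k) $ j"
        using step[of j "A k"] by (cases "j = 0") (simp_all add: c_def A_def)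
    qed
    then show ?thesis by (simp add: algebra_simps)
  qed
  have A0: "A 0 = f" by (simp add: A_def)
  define g where "g = Abs_fps c"
  have val: "psubst g a (psubst l a b) = psubst f a b" if "a $ 0 = 0" "b $ 0 = 0" for a b
  proof -
    have "psubst (A 0) a b = ev (Abs_fps (\<lambda>k. c k oo a)) (psubst l a b)"
    proof (rule ev_recursion)
      fix k show "psubst (A k) a b = (c k oo a) + psubst l a b * psubst (A (Suc k)) a b"
        by (subst A) (simp add: that)
    qed (use l0 in simp)
    moreover have "sx a g = Abs_fps (\<lambda>k. c k oo a)" by (rule fps_ext) (simp add: g_def)
    ultimately show ?thesis by (simp add: A0 psubst_def[of g])
  qed
  \<comment> \<open>The Jacobian with l is a derivation that annihilates l, so it obeys the same
    kind of recursion along the repeated divisions.\<close>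
  define D where "D F = deriv_inner l * fps_deriv F - fps_deriv l * deriv_inner F" for F
  have DA: "D (A k) = - fps_deriv l * fps_const (fps_deriv (c k)) + l * D (A (Suc k))" for k
    unfolding D_def
    by (subst (1 2) A) (simp add: deriv_inner_add deriv_inner_const deriv_inner_mult algebra_simps)
  have deriv: "psubst (D f) a b = - psubst (fps_deriv l) a b * psubst (deriv_inner g) a (psubst l a b)"
    if "a $ 0 = 0" "b $ 0 = 0" for a b
  proof -
    define \<mu> where "\<mu> = psubst (fps_deriv l) a b"
    have "psubst (D (A 0)) a b = ev (Abs_fps (\<lambda>k. - \<mu> * (fps_deriv (c k) oo a))) (psubst l a b)"
    proof (rule ev_recursion)
      fix k show "psubst (D (A k)) a b = - \<mu> * (fps_deriv (c k) oo a) + psubst l a b * psubst (D (A (Suc k))) a b"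
        by (subst DA) (simp add: that \<mu>_def)
    qed (use l0 in simp)
    also have "Abs_fps (\<lambda>k. - \<mu> * (fps_deriv (c k) oo a)) = fps_const (- \<mu>) * sx a (deriv_inner g)"
      by (rule fps_ext) (simp add: g_def)
    also have "ev \<dots> (psubst l a b) = - \<mu> * psubst (deriv_inner g) a (psubst l a b)"
      using that l0 by (subst ev_mult) (auto simp: psubst_def[of "deriv_inner g"])
    finally show ?thesis by (simp add: A0 \<mu>_def)
  qed
  \<comment> \<open>\<open>E G\<close> is G(s, l(s, z s)). It turns a factorization of
    \<open>g\<close> into one of f(s, z s) whose factors obey the degree bound and hence come from
    factors of f. This transports irreducibility without inverting the coordinate change.\<close>
  define E where "E G = psubst (lift2 G) fps_X (weighted 1 1 l)" for G :: "'a fps fps"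
  have wl0: "weighted 1 1 l $ 0 = 0" using l0 by (simp add: weighted_def)
  have E_mult: "E (G * H) = E G * E H" for G H
    using wl0 by (simp add: E_def lift2_mult)
  have Eg: "E g = weighted 1 1 f"
  proof -
    have "weighted 1 1 (A 0) = ev (Abs_fps (\<lambda>k. lift1 (c k))) (weighted 1 1 l)"
    proof (rule ev_recursion[OF _ wl0])
      fix k show "weighted 1 1 (A k) = lift1 (c k) + weighted 1 1 l * weighted 1 1 (A (Suc k))"
        by (subst A) (simp add: weighted_def lift2_add lift2_mult lift2_const)
    qed
    moreover have "sx fps_X (lift2 g) = Abs_fps (\<lambda>k. lift1 (c k))"
      by (rule fps_ext) (simp add: g_def)
    ultimately show ?thesis by (simp add: A0 E_def psubst_def)
  qed
  have E0: "E G $ 0 = [:G $ 0 $ 0:]" for G by (simp add: E_def)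
  have Edeg: "degree (E G $ n) \<le> n" for G n
    unfolding E_def psubst_def ev_def fps_nth_Abs_fps
    by (rule degree_sum_le) (auto intro!: degree_nth_mult_le degree_nth_power_le degree_nth_weighted_1_1[unfolded One_nat_def])
  have "irreducible g"
  proof (rule irreducibleI)
    have "weighted 1 1 f \<noteq> weighted 1 1 0" using weighted_1_1_inj[of f 0] f by auto
    then show "g \<noteq> 0" using Eg by (auto simp: E_def weighted_def lift2_const[of 0, simplified])
    have "[:g $ 0 $ 0:] = [:f $ 0 $ 0:]" using E0[of g] by (simp add: Eg weighted_def)
    then show "\<not> g dvd 1" using f by (simp add: fps2_unit_iff irreducible_def)
    fix G H assume gGH: "g = G * H"
    obtain G1 where G1: "E G = weighted 1 1 G1" "G1 $ 0 $ 0 = coeff (E G $ 0) 0"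
      using weighted_1_1_surj[OF Edeg] by blast
    obtain H1 where H1: "E H = weighted 1 1 H1" "H1 $ 0 $ 0 = coeff (E H $ 0) 0"
      using weighted_1_1_surj[OF Edeg] by blast
    have "weighted 1 1 f = weighted 1 1 (G1 * H1)"
      using Eg E_mult[of G H] by (simp add: gGH G1 H1 weighted_mult)
    then have "f = G1 * H1" by (rule weighted_1_1_inj)
    then have "G1 dvd 1 \<or> H1 dvd 1" using f irreducibleD by blast
    then show "G dvd 1 \<or> H dvd 1" using G1(2) H1(2) by (simp add: fps2_unit_iff E0)
  qed
  \<comment> \<open>\<open>g $ 0\<close> is the remainder of f on division by l.\<close>
  moreover have "g $ 0 \<noteq> 0"
  proof
    assume "g $ 0 = 0"
    then have "f = l * A 1" using A[of 0] by (simp add: g_def A0)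
    then show False using lf by simp
  qed
  ultimately show ?thesis using that[of g] val deriv unfolding D_def by blast
qed

text \<open>In the coordinates (l, x), or (l, y) if the y-derivative of l vanishes at the origin,
  the Jacobian is up to a unit the derivative in the second variable. Everything is stated along
  parametrized arcs, the only form in which it is used. The condition on \<open>g $ j $ 0\<close>
  says that the first coordinate does not divide \<open>g\<close>.\<close>

lemma straighten:
  fixes f l :: "'a::field fps fps"
  assumes l0: "l $ 0 $ 0 = 0" and l1: "l $ 1 $ 0 \<noteq> 0 \<or> l $ 0 $ 1 \<noteq> 0"
    and f: "irreducible f" and lf: "\<not> l dvd f"
  obtains g where "irreducible g" "\<exists>j. g $ j $ 0 \<noteq> 0"
    "\<And>a b. a $ 0 = 0 \<Longrightarrow> b $ 0 = 0 \<Longrightarrow> a \<noteq> 0 \<or> b \<noteq> 0 \<Longrightarrow>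
      \<exists>c. c $ 0 = 0 \<and> psubst g (psubst l a b) c = psubst f a b \<and> (psubst l a b \<noteq> 0 \<or> c \<noteq> 0) \<and>
        (psubst (deriv_inner l * fps_deriv f - fps_deriv l * deriv_inner f) a b = 0 \<longrightarrow>
         psubst (fps_deriv g) (psubst l a b) c = 0)"
proof -
  have main: "\<exists>g. irreducible g \<and> (\<exists>j. g $ j $ 0 \<noteq> 0) \<and> (\<forall>a b. a $ 0 = 0 \<longrightarrow> b $ 0 = 0 \<longrightarrow> a \<noteq> 0 \<or> b \<noteq> 0 \<longrightarrow>
      (psubst g (psubst l a b) a = psubst f a b \<and> (psubst l a b \<noteq> 0 \<or> a \<noteq> 0) \<and>
        (psubst (deriv_inner l * fps_deriv f - fps_deriv l * deriv_inner f) a b = 0 \<longrightarrow>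
         psubst (fps_deriv g) (psubst l a b) a = 0)))"
    if l0: "l $ 0 $ 0 = 0" and l1: "l $ 1 $ 0 \<noteq> 0" and f: "irreducible f" and lf: "\<not> l dvd f"
    for l f :: "'a fps fps"
  proof -
    obtain g where g: "irreducible g" "g $ 0 \<noteq> 0"
    "\<And>a b. a $ 0 = 0 \<Longrightarrow> b $ 0 = 0 \<Longrightarrow> psubst g a (psubst l a b) = psubst f a b"
    "\<And>a b. a $ 0 = 0 \<Longrightarrow> b $ 0 = 0 \<Longrightarrow>
      psubst (deriv_inner l * fps_deriv f - fps_deriv l * deriv_inner f) a b =
      - psubst (fps_deriv l) a b * psubst (deriv_inner g) a (psubst l a b)"
      using coordinate_change[OF l0 l1 f lf] by blast
    obtain j where j: "g $ 0 $ j \<noteq> 0" using g(2) by (metis fps_ext fps_zero_nth)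
    have "psubst (swap g) (psubst l a b) a = psubst f a b \<and> (psubst l a b \<noteq> 0 \<or> a \<noteq> 0) \<and>
        (psubst (deriv_inner l * fps_deriv f - fps_deriv l * deriv_inner f) a b = 0 \<longrightarrow>
         psubst (fps_deriv (swap g)) (psubst l a b) a = 0)"
      if ab: "a $ 0 = 0" "b $ 0 = 0" "a \<noteq> 0 \<or> b \<noteq> 0" for a b
    proof (intro conjI impI)
      have L0: "psubst l a b $ 0 = 0" using l0 by simp
      show "psubst (swap g) (psubst l a b) a = psubst f a b"
        using g(3)[OF ab(1,2)] psubst_swap[OF L0 ab(1)] by simp
      \<comment> \<open>An arc on x = 0 and l = 0 is constant, because l restricted to x = 0 is a
        nonzero series in y.\<close>
      show "psubst l a b \<noteq> 0 \<or> a \<noteq> 0"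
      proof (rule ccontr)
        assume "\<not> (psubst l a b \<noteq> 0 \<or> a \<noteq> 0)"
        then have a: "a = 0" and "psubst l 0 b = 0" by auto
        then have "Abs_fps (\<lambda>j. l $ j $ 0) oo b = 0" using psubst_left_0[OF ab(2)] by metis
        moreover have "Abs_fps (\<lambda>j. l $ j $ 0) \<noteq> 0" using l1 by (metis fps_nth_Abs_fps fps_zero_nth)
        ultimately have "b = 0" using fps_compose_eq_0_iff[OF ab(2)] by blast
        then show False using ab(3) a by simp
      qed
      assume "psubst (deriv_inner l * fps_deriv f - fps_deriv l * deriv_inner f) a b = 0"
      then have "psubst (fps_deriv l) a b * psubst (deriv_inner g) a (psubst l a b) = 0"
        using g(4)[OF ab(1,2)] by simp
      moreover have "psubst (fps_deriv l) a b \<noteq> 0"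
      proof -
        have "psubst (fps_deriv l) a b $ 0 \<noteq> 0" using l1 by (simp add: fps_deriv_fps_nth)
        then show ?thesis by (metis fps_zero_nth)
      qed
      ultimately show "psubst (fps_deriv (swap g)) (psubst l a b) a = 0"
        by (simp add: fps_deriv_swap psubst_swap[OF L0 ab(1)])
    qed
    then show ?thesis using g(1) j irreducible_swap by (intro exI[of _ "swap g"]) auto
  qed
  show ?thesis
  proof (cases "l $ 1 $ 0 \<noteq> 0")
    case True
    then show ?thesis using main[OF l0 True f lf] that by metis
  next
    case False
    then have l1': "swap l $ 1 $ 0 \<noteq> 0" using l1 by simp
    have l0': "swap l $ 0 $ 0 = 0" using l0 by simp
    have lf': "\<not> swap l dvd swap f" using lf by (simp add: swap_dvd)
    obtain g where g: "irreducible g" "\<exists>j. g $ j $ 0 \<noteq> 0" "\<And>a b. a $ 0 = 0 \<Longrightarrow> b $ 0 = 0 \<Longrightarrow> a \<noteq> 0 \<or> b \<noteq> 0 \<Longrightarrow>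
      (psubst g (psubst (swap l) a b) a = psubst (swap f) a b \<and> (psubst (swap l) a b \<noteq> 0 \<or> a \<noteq> 0) \<and>
        (psubst (deriv_inner (swap l) * fps_deriv (swap f) - fps_deriv (swap l) * deriv_inner (swap f)) a b = 0 \<longrightarrow>
         psubst (fps_deriv g) (psubst (swap l) a b) a = 0))"
      using main[OF l0' l1' irreducible_swap[OF f] lf'] by metis
    \<comment> \<open>Exchanging the variables reverses the sign of the Jacobian, which does not
      affect its zeros.\<close>
    have J: "deriv_inner (swap l) * fps_deriv (swap f) - fps_deriv (swap l) * deriv_inner (swap f)
        = swap (- (deriv_inner l * fps_deriv f - fps_deriv l * deriv_inner f))"
      by (simp add: fps_deriv_swap deriv_inner_swap swap_mult swap_uminus swap_diff)
    show ?thesis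
    proof (rule that[OF g(1,2)])
      fix a b :: "'a fps" assume ab: "a $ 0 = 0" "b $ 0 = 0" "a \<noteq> 0 \<or> b \<noteq> 0"
      have sw: "psubst (swap F) b a = psubst F a b" for F using ab by (simp add: psubst_swap)
      show "\<exists>c. c $ 0 = 0 \<and> psubst g (psubst l a b) c = psubst f a b \<and> (psubst l a b \<noteq> 0 \<or> c \<noteq> 0) \<and>
        (psubst (deriv_inner l * fps_deriv f - fps_deriv l * deriv_inner f) a b = 0 \<longrightarrow>
         psubst (fps_deriv g) (psubst l a b) c = 0)"
        using g(3)[of b a] ab unfolding J sw psubst_uminus neg_equal_0_iff_equal by blast
    qed
  qed
qed

section \<open>Leading coefficients along polar branches\<close>

lemma fps_prod_nth_subdegree:
  fixes f :: "'b \<Rightarrow> 'a::idom fps"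
  assumes "\<And>x. x \<in> A \<Longrightarrow> f x \<noteq> 0"
  shows "(\<Prod>x\<in>A. f x) $ (\<Sum>x\<in>A. subdegree (f x)) = (\<Prod>x\<in>A. f x $ subdegree (f x))"
  using assms
proof (induction A rule: infinite_finite_induct)
  case (insert x A)
  have "subdegree (\<Prod>x\<in>A. f x) = (\<Sum>x\<in>A. subdegree (f x))" using insert.prems by (intro subdegree_prod) auto
  then show ?case using insert nth_subdegree_mult[of "f x" "\<Prod>x\<in>A. f x"] by simp
qed auto

lemma fps_mult_nth_lowest:
  fixes f g :: "'a::comm_ring_1 fps"
  assumes "\<And>i. i < k \<Longrightarrow> f $ i = 0"
  shows "(f * g) $ k = f $ k * g $ 0"
proof -
  have "(f * g) $ k = (\<Sum>i\<in>{k}. f $ i * g $ (k - i))"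
    unfolding fps_mult_nth by (rule sum.mono_neutral_right) (use assms in auto)
  then show ?thesis by simp
qed

lemma fps_deriv_linear_prod:
  fixes B :: "'a::comm_ring_1 fps set"
  assumes "finite B"
  shows "fps_deriv (\<Prod>b\<in>B. fps_X - fps_const b) = (\<Sum>b\<in>B. \<Prod>c\<in>B - {b}. fps_X - fps_const c)"
  using assms
proof (induction B rule: finite_induct)
  case (insert b B)
  have "(\<Prod>c\<in>insert b B - {d}. fps_X - fps_const c) = (fps_X - fps_const b) * (\<Prod>c\<in>B - {d}. fps_X - fps_const c)"
    if "d \<in> B" for d
  proof -
    have "insert b B - {d} = insert b (B - {d})" using insert.hyps that by auto
    then show ?thesis using insert.hyps by simp
  qed
  moreover have "insert b B - {b} = B" using insert.hyps by auto
  ultimately show ?case using insert by (simp add: sum_distrib_left)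
qed simp

text \<open>The coefficients at \<open>x^K\<close> of the conjugates in contact \<open>K\<close> are stable under a group of roots of
  unity, hence their power sums of positive order below the exponent of this group vanish.\<close>

lemma contact_coefficient_eq_0:
  fixes \<alpha> :: "complex fps" and c :: complex and N K :: nat
  defines "B \<equiv> {b \<in> conjugates N \<alpha>. \<forall>i<K. b $ i = \<alpha> $ i}"
  assumes N: "N \<ge> 1" and ne: "\<And>b. b \<in> B \<Longrightarrow> c \<noteq> b $ K"
    and sum: "(\<Sum>b\<in>B. 1 / (c - b $ K)) = 0"
  shows "c = 0"
proof -
  \<comment> \<open>The \<omega> that fix \<alpha> below index K. They permute \<open>B\<close> and
    multiply the coefficients at K by \<omega>^K; \<open>e\<close> will be the exponent of the group
    of these factors.\<close>
  define H where "H = {\<omega>::complex. \<omega> ^ N = 1 \<and> (\<forall>i<K. \<omega> ^ i * \<alpha> $ i = \<alpha> $ i)}"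
  define P where "P e \<longleftrightarrow> e > 0 \<and> (\<forall>\<omega>\<in>H. (\<omega> ^ K) ^ e = 1)" for e
  have "(\<omega> ^ K) ^ N = 1" if "\<omega> \<in> H" for \<omega>
  proof -
    have "(\<omega> ^ K) ^ N = (\<omega> ^ N) ^ K" by (simp only: power_mult[symmetric] mult.commute)
    then show ?thesis using that by (simp add: H_def)
  qed
  then have "P N" using N by (simp add: P_def)
  define e where "e = (LEAST e. P e)"
  have e: "P e" unfolding e_def by (rule LeastI) (rule \<open>P N\<close>)
  have fin: "finite (B)" using finite_conjugates[OF N] by (simp add: B_def)
  have bO: "(b $ K) ^ e = (\<alpha> $ K) ^ e" if b: "b \<in> B" for b
  proof -
    obtain \<omega> where \<omega>: "b = \<alpha> oo rot \<omega>" "\<omega> ^ N = 1" using b by (auto simp: B_def conjugates_def)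
    then have "\<omega> \<in> H" using b by (auto simp: B_def H_def)
    then have "(\<omega> ^ K) ^ e = 1" using e by (simp add: P_def)
    then show ?thesis by (simp add: \<omega>(1) power_mult_distrib)
  qed
  have stable: "bij_betw (\<lambda>b. b oo rot \<omega>) (B) (B)" if \<omega>: "\<omega> \<in> H" for \<omega>
  proof -
    have \<omega>N: "\<omega> ^ N = 1" using \<omega> by (simp add: H_def)
    then have "\<omega> \<noteq> 0" using N by (auto simp: power_0_left)
    then have inj: "inj_on (\<lambda>b. b oo rot \<omega>) (B)" using compose_rot_inj inj_on_subset by blast
    have "(\<lambda>b. b oo rot \<omega>) ` B \<subseteq> B"
    proof safe
      fix b assume b: "b \<in> B"
      then have "b oo rot \<omega> \<in> conjugates N \<alpha>"
        using conjugates_rot[OF N \<omega>N, of \<alpha>] by (auto simp: B_def bij_betw_def)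
      then show "b oo rot \<omega> \<in> B" using b \<omega> by (auto simp: B_def H_def)
    qed
    then show ?thesis using inj fin by (metis endo_inj_surj bij_betw_def)
  qed
  \<comment> \<open>Since k < e, some \<omega>^K has a k-th power other than 1; composing with this
    rotation permutes \<open>B\<close> but rescales the sum.\<close>
  have power_sum: "(\<Sum>b\<in>B. (b $ K) ^ k) = 0" if k: "0 < k" "k < e" for k
  proof -
    have "\<not> P k" using k not_less_Least unfolding e_def by blast
    then obtain \<omega> where \<omega>: "\<omega> \<in> H" "(\<omega> ^ K) ^ k \<noteq> 1" using k by (auto simp: P_def)
    have "(\<Sum>b\<in>B. (b $ K) ^ k) = (\<Sum>b\<in>B. ((b oo rot \<omega>) $ K) ^ k)"
      by (rule sum.reindex_bij_betw[OF stable[OF \<omega>(1)], symmetric])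
    also have "\<dots> = (\<omega> ^ K) ^ k * (\<Sum>b\<in>B. (b $ K) ^ k)"
      by (simp add: power_mult_distrib sum_distrib_left)
    finally show ?thesis using \<omega>(2) by auto
  qed
  \<comment> \<open>All members of \<open>B\<close> share the e-th power of their coefficient at K,
    so c^e minus this common value, divided by c - b_K, is a geometric sum. Summed over
    \<open>B\<close>, the power sums leave only card B times c^(e - 1).\<close>
  have "(\<Sum>i<e. (b $ K) ^ (e - Suc i) * c ^ i) = (c ^ e - (\<alpha> $ K) ^ e) * (1 / (c - b $ K))" if b: "b \<in> B" for b
  proof -
    have "c ^ e - (b $ K) ^ e = (c - b $ K) * (\<Sum>i<e. (b $ K) ^ (e - Suc i) * c ^ i)"
      by (rule power_diff_sumr2)
    then show ?thesis using ne[OF b] bO[OF b] by (simp add: field_simps)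
  qed
  then have "(\<Sum>b\<in>B. \<Sum>i<e. (b $ K) ^ (e - Suc i) * c ^ i) = (c ^ e - (\<alpha> $ K) ^ e) * (\<Sum>b\<in>B. 1 / (c - b $ K))"
    by (simp add: sum_distrib_left)
  then have "0 = (\<Sum>i<e. \<Sum>b\<in>B. (b $ K) ^ (e - Suc i) * c ^ i)"
    by (subst sum.swap) (simp add: sum)
  also have "\<dots> = (\<Sum>i<e. c ^ i * (\<Sum>b\<in>B. (b $ K) ^ (e - Suc i)))"
    by (simp add: sum_distrib_left mult.commute)
  also have "\<dots> = (\<Sum>i\<in>{e - 1}. c ^ i * (\<Sum>b\<in>B. (b $ K) ^ (e - Suc i)))"
    by (rule sum.mono_neutral_right) (use e power_sum in \<open>auto simp: P_def\<close>)
  also have "\<dots> = c ^ (e - 1) * of_nat (card (B))"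
    using e by (simp add: P_def)
  finally have "c ^ (e - 1) = 0 \<or> card (B) = 0" by simp
  moreover have "card (B) \<noteq> 0"
    using fin self_in_conjugates[of \<alpha> N] by (auto simp: B_def)
  ultimately show "c = 0" by simp
qed

text \<open>Order of the product of all \<gamma> - b when the largest contact of \<gamma> is k and
  \<alpha> attains it: a conjugate agreeing with \<alpha> below k has contact exactly k with
  \<gamma>, and any other separates from \<gamma> where it separates from \<alpha>.\<close>

definition contact_order :: "nat \<Rightarrow> complex fps \<Rightarrow> nat \<Rightarrow> nat" where
  "contact_order N \<alpha> k = (\<Sum>b\<in>conjugates N \<alpha>. if \<forall>i<k. b $ i = \<alpha> $ i then k else subdegree (\<alpha> - b))"

text \<open>The leading coefficient of the same product once \<gamma> is known to have coefficient 0
  at index k.\<close>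

definition contact_coeff :: "nat \<Rightarrow> complex fps \<Rightarrow> nat \<Rightarrow> complex" where
  "contact_coeff N \<alpha> k = (\<Prod>b\<in>conjugates N \<alpha>. if \<forall>i<k. b $ i = \<alpha> $ i then - (b $ k) else (\<alpha> - b) $ subdegree (\<alpha> - b))"

text \<open>The summand of \<alpha> itself is k and the others never decrease. Hence the order of f
  along a polar root determines its contact.\<close>

lemma contact_order_strict_mono:
  assumes N: "N \<ge> 1" and "k < k'"
  shows "contact_order N \<alpha> k < contact_order N \<alpha> k'"
  unfolding contact_order_def
proof (rule sum_strict_mono_ex1[OF finite_conjugates[OF N]])
  show "\<forall>b\<in>conjugates N \<alpha>. (if \<forall>i<k. b $ i = \<alpha> $ i then k else subdegree (\<alpha> - b))
      \<le> (if \<forall>i<k'. b $ i = \<alpha> $ i then k' else subdegree (\<alpha> - b))"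
  proof
    fix b
    have "k \<le> subdegree (\<alpha> - b)" if "\<forall>i<k. b $ i = \<alpha> $ i" "\<not> (\<forall>i<k'. b $ i = \<alpha> $ i)"
      using that by (intro subdegree_geI) auto
    then show "(if \<forall>i<k. b $ i = \<alpha> $ i then k else subdegree (\<alpha> - b))
      \<le> (if \<forall>i<k'. b $ i = \<alpha> $ i then k' else subdegree (\<alpha> - b))"
      using assms(2) by auto
  qed
  show "\<exists>b\<in>conjugates N \<alpha>. (if \<forall>i<k. b $ i = \<alpha> $ i then k else subdegree (\<alpha> - b))
      < (if \<forall>i<k'. b $ i = \<alpha> $ i then k' else subdegree (\<alpha> - b))"
    using self_in_conjugates assms(2) by (intro bexI[of _ \<alpha>]) auto
qed

text \<open>Let E be the order of the product of the \<gamma> - b. In the product rule at \<gamma>,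
  omitting one factor leaves an order of at least E - k, attained when the omitted factor has order
  k; the term with the derivative of \<open>U\<close> has order at least E. The coefficient at E - k
  therefore yields the logarithmic derivative condition on the differences \<gamma> $ k - b $
  k.\<close>

lemma polar_leading_coeff:
  fixes \<alpha> \<gamma> :: "complex fps" and U :: "complex fps fps" and N :: nat
  defines "G \<equiv> conj_prod N \<alpha> * U"
  assumes N: "N \<ge> 1" and U: "U $ 0 $ 0 \<noteq> 0" and z: "\<alpha> $ 0 = 0" "\<gamma> $ 0 = 0"
    and polar: "ev (fps_deriv G) \<gamma> = 0" and nz: "ev G \<gamma> \<noteq> 0"
    and max: "\<And>b. b \<in> conjugates N \<alpha> \<Longrightarrow> subdegree (\<gamma> - b) \<le> subdegree (\<gamma> - \<alpha>)"
  shows "subdegree (ev G \<gamma>) = contact_order N \<alpha> (subdegree (\<gamma> - \<alpha>))"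
    and "ev G \<gamma> $ subdegree (ev G \<gamma>) = contact_coeff N \<alpha> (subdegree (\<gamma> - \<alpha>)) * U $ 0 $ 0"
proof -
  define B where "B = conjugates N \<alpha>"
  define k where "k = subdegree (\<gamma> - \<alpha>)"
  define d where "d b = \<gamma> - b" for b
  define V where "V = ev U \<gamma>"
  have fin: "finite B" using finite_conjugates[OF N] by (simp add: B_def)
  have \<alpha>B: "\<alpha> \<in> B" by (simp add: B_def self_in_conjugates)
  have V0: "V $ 0 \<noteq> 0" using U by (simp add: V_def)
  have evP: "ev (conj_prod N \<alpha>) \<gamma> = (\<Prod>b\<in>B. d b)"
    using z by (simp add: conj_prod_def B_def d_def ev_prod)
  have evG: "ev G \<gamma> = (\<Prod>b\<in>B. d b) * V"
    using z by (simp add: G_def evP V_def)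
  have dnz: "d b \<noteq> 0" if "b \<in> B" for b using nz that fin by (auto simp: evG)
  have dk: "subdegree (d b) \<le> k" if "b \<in> B" for b using max[of b] that unfolding d_def B_def k_def by blast
  have \<gamma>\<alpha>: "\<gamma> $ i = \<alpha> $ i" if "i < k" for i
    using nth_less_subdegree_zero[of i "\<gamma> - \<alpha>"] that by (simp add: k_def)
  have k1: "k \<ge> 1" using dnz[OF \<alpha>B] z subdegree_eq_0_iff[of "\<gamma> - \<alpha>"] by (simp add: k_def d_def Suc_le_eq)
  have agree: "subdegree (d b) = k" if "b \<in> B" "\<forall>i<k. b $ i = \<alpha> $ i" for b
  proof -
    have "k \<le> subdegree (d b)" using dnz[OF that(1)] \<gamma>\<alpha> that(2) by (intro subdegree_geI) (auto simp: d_def)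
    then show ?thesis using dk[OF that(1)] by simp
  qed
  have agree': "\<forall>i<k. b $ i = \<alpha> $ i" if "b \<in> B" "subdegree (d b) = k" for b
  proof (intro allI impI)
    fix i assume "i < k"
    then have "\<gamma> $ i = b $ i" using nth_less_subdegree_zero[of i "d b"] that by (simp add: d_def)
    then show "b $ i = \<alpha> $ i" using \<gamma>\<alpha>[OF \<open>i < k\<close>] by simp
  qed
  have disagree: "subdegree (\<alpha> - b) = subdegree (d b)" "(\<alpha> - b) $ subdegree (\<alpha> - b) = d b $ subdegree (d b)"
    if b: "b \<in> B" "\<not> (\<forall>i<k. b $ i = \<alpha> $ i)" for b
  proof -
    have lt: "subdegree (d b) < k" using agree'[OF b(1)] b(2) dk[OF b(1)] le_neq_implies_less by blast
    have eq: "\<alpha> - b = d b - (\<gamma> - \<alpha>)" by (simp add: d_def)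
    show s: "subdegree (\<alpha> - b) = subdegree (d b)"
      unfolding eq using lt dnz[OF b(1)] by (intro subdegree_diff_eq1) (auto simp: k_def)
    show "(\<alpha> - b) $ subdegree (\<alpha> - b) = d b $ subdegree (d b)"
      using \<gamma>\<alpha>[OF lt] unfolding s by (simp add: d_def)
  qed
  have sd: "(\<Sum>b\<in>B. subdegree (d b)) = contact_order N \<alpha> k"
    unfolding contact_order_def B_def[symmetric]
  proof (rule sum.cong[OF refl])
    fix b assume b: "b \<in> B"
    show "subdegree (d b) = (if \<forall>i<k. b $ i = \<alpha> $ i then k else subdegree (\<alpha> - b))"
    proof (cases "\<forall>i<k. b $ i = \<alpha> $ i")
      case True
      then show ?thesis by (simp only: agree[OF b True] if_P[OF True] if_True)
    next
      case False
      then show ?thesis by (simp only: disagree[OF b False] if_not_P[OF False] if_False)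
    qed
  qed
  have sdprod: "subdegree (\<Prod>b\<in>A. d b) = (\<Sum>b\<in>A. subdegree (d b))" if "A \<subseteq> B" for A
    using dnz that by (intro subdegree_prod) auto
  define E where "E = (\<Sum>b\<in>B. subdegree (d b))"
  have Ek: "k \<le> E" unfolding E_def using member_le_sum[OF \<alpha>B, of "\<lambda>b. subdegree (d b)"] fin by (simp add: k_def d_def)
  define S where "S = (\<Sum>b\<in>B. \<Prod>c\<in>B - {b}. d c)"
  have "ev (fps_deriv (conj_prod N \<alpha>)) \<gamma> = S"
    unfolding conj_prod_def B_def[symmetric] fps_deriv_linear_prod[OF fin] S_def d_def
    using z by (simp add: ev_sum ev_prod)
  then have eq: "S * V = - ((\<Prod>b\<in>B. d b) * ev (fps_deriv U) \<gamma>)"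
    using polar z by (simp add: G_def evP V_def add_eq_0_iff add.commute)
  have El: "E - subdegree (d b) = (\<Sum>c\<in>B - {b}. subdegree (d c))" if "b \<in> B" for b
    using that fin by (simp add: E_def sum_diff1_nat)
  have low: "(\<Prod>c\<in>B - {b}. d c) $ i = 0" if "b \<in> B" "i < E - k" for b i
  proof (rule nth_less_subdegree_zero)
    show "i < subdegree (\<Prod>c\<in>B - {b}. d c)"
      using that dk[OF that(1)] El[OF that(1)] by (subst sdprod) auto
  qed
  have "(S * V) $ (E - k) = S $ (E - k) * V $ 0"
    by (rule fps_mult_nth_lowest) (simp add: S_def fps_sum_nth low)
  moreover have "((\<Prod>b\<in>B. d b) * ev (fps_deriv U) \<gamma>) $ (E - k) = 0"
  proof -
    have "(\<Prod>b\<in>B. d b) $ i = 0" if "i \<le> E - k" for i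
    proof (rule nth_less_subdegree_zero)
      show "i < subdegree (\<Prod>b\<in>B. d b)"
        using that k1 Ek by (subst sdprod) (auto simp: E_def[symmetric])
    qed
    then show ?thesis unfolding fps_mult_nth by (intro sum.neutral) auto
  qed
  ultimately have S0: "S $ (E - k) = 0" using eq V0 by simp
  define L where "L = (\<Prod>b\<in>B. d b $ subdegree (d b))"
  have L0: "L \<noteq> 0" unfolding L_def using fin dnz by simp
  define B' where "B' = {b \<in> B. \<forall>i<k. b $ i = \<alpha> $ i}"
  \<comment> \<open>Omitting a factor of order k divides the full leading coefficient
    \<open>L\<close> by that of the factor; omitting one of smaller order leaves an order above E -
    k.\<close>
  have trm: "(\<Prod>c\<in>B - {b}. d c) $ (E - k) = (if b \<in> B' then L / (\<gamma> $ k - b $ k) else 0)" if b: "b \<in> B" for b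
  proof (cases "b \<in> B'")
    case True
    then have sb: "subdegree (d b) = k" using agree by (auto simp: B'_def)
    have "(\<Prod>c\<in>B - {b}. d c) $ (E - k) = (\<Prod>c\<in>B - {b}. d c $ subdegree (d c))"
      using El[OF b] sb fps_prod_nth_subdegree[of "B - {b}" d] dnz by auto
    moreover have "L = d b $ k * (\<Prod>c\<in>B - {b}. d c $ subdegree (d c))"
      unfolding L_def using prod.remove[OF fin b, of "\<lambda>b. d b $ subdegree (d b)"] sb by simp
    moreover have "d b $ k \<noteq> 0" using dnz[OF b] sb by (metis nth_subdegree_nonzero)
    ultimately show ?thesis using True by (simp add: d_def field_simps)
  next
    case False
    then have "subdegree (d b) < k" using b agree' dk[OF b] by (fastforce simp: B'_def)
    moreover have "subdegree (d b) \<le> E" unfolding E_def using member_le_sum[OF b, of "\<lambda>b. subdegree (d b)"] fin by simp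
    ultimately have "E - k < subdegree (\<Prod>c\<in>B - {b}. d c)"
      using El[OF b] Ek by (subst sdprod) auto
    then have "(\<Prod>c\<in>B - {b}. d c) $ (E - k) = 0" by (rule nth_less_subdegree_zero)
    then show ?thesis using False by simp
  qed
  have nek: "\<gamma> $ k \<noteq> b $ k" if "b \<in> B'" for b
  proof -
    have "b \<in> B" "subdegree (d b) = k" using that agree by (auto simp: B'_def)
    then show ?thesis using nth_subdegree_nonzero[OF dnz[of b]] by (simp add: d_def)
  qed
  have "L * (\<Sum>b\<in>B'. 1 / (\<gamma> $ k - b $ k)) = (\<Sum>b\<in>B. if b \<in> B' then L / (\<gamma> $ k - b $ k) else 0)"
    unfolding B'_def using fin
    by (simp add: sum_distrib_left sum.inter_filter if_distrib[of "(*) L"] cong: if_cong)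
  also have "\<dots> = S $ (E - k)" unfolding S_def fps_sum_nth using trm by (intro sum.cong) auto
  finally have "(\<Sum>b\<in>B'. 1 / (\<gamma> $ k - b $ k)) = 0" using S0 L0 by simp
  then have \<gamma>k: "\<gamma> $ k = 0"
    using contact_coefficient_eq_0[OF N, where K = k and \<alpha> = \<alpha> and c = "\<gamma> $ k"] nek by (simp add: B'_def B_def)
  have Lc: "L = contact_coeff N \<alpha> k"
    unfolding L_def contact_coeff_def B_def[symmetric]
  proof (rule prod.cong[OF refl])
    fix b assume b: "b \<in> B"
    show "d b $ subdegree (d b) = (if \<forall>i<k. b $ i = \<alpha> $ i then - (b $ k) else (\<alpha> - b) $ subdegree (\<alpha> - b))"
    proof (cases "\<forall>i<k. b $ i = \<alpha> $ i")
      case True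
      then show ?thesis by (simp only: agree[OF b True] if_P[OF True] if_True) (simp add: d_def \<gamma>k)
    next
      case False
      then show ?thesis by (simp only: disagree(2)[OF b False] if_not_P[OF False] if_False)
    qed
  qed
  have "subdegree V = 0" using V0 by (simp add: subdegree_eq_0_iff)
  moreover have "V \<noteq> 0" using V0 by auto
  moreover have "(\<Prod>b\<in>B. d b) \<noteq> 0" using fin dnz by simp
  ultimately have sG: "subdegree (ev G \<gamma>) = E" unfolding evG by (simp add: sdprod E_def)
  then show "subdegree (ev G \<gamma>) = contact_order N \<alpha> (subdegree (\<gamma> - \<alpha>))"
    using sd by (simp add: E_def k_def)
  have "((\<Prod>b\<in>B. d b) * V) $ E = (\<Prod>b\<in>B. d b) $ E * V $ 0"
    by (rule fps_mult_nth_lowest, rule nth_less_subdegree_zero) (use sdprod[of B] in \<open>auto simp: E_def\<close>)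
  also have "(\<Prod>b\<in>B. d b) $ E = L" unfolding E_def L_def by (rule fps_prod_nth_subdegree) (rule dnz)
  finally show "ev G \<gamma> $ subdegree (ev G \<gamma>) = contact_coeff N \<alpha> (subdegree (\<gamma> - \<alpha>)) * U $ 0 $ 0"
    unfolding sG evG[symmetric] by (simp add: Lc V_def k_def)
qed

section \<open>Comparison of two polar roots up to conjugation\<close>

lemma subdegree_compose_rot: "\<omega> \<noteq> 0 \<Longrightarrow> subdegree (a oo rot \<omega>) = subdegree a"
proof -
  assume "\<omega> \<noteq> 0"
  then have "subdegree (rot \<omega>) = 1" by (simp add: rot_def)
  then show ?thesis by simp
qed

text \<open>A rotation of t moves the conjugate nearest to \<gamma> to \<alpha> and leaves
  \<open>G\<close> unchanged; the leading coefficient of \<open>G\<close> along \<gamma> only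
  changes by a power of the rotation factor.\<close>

lemma polar_normalized:
  fixes \<alpha> \<gamma> :: "complex fps" and U G :: "complex fps fps"
  assumes G: "G = conj_prod N \<alpha> * U" and inv: "\<And>\<omega>. \<omega> ^ N = 1 \<Longrightarrow> sx (rot \<omega>) G = G"
    and N: "N \<ge> 1" and U: "U $ 0 $ 0 \<noteq> 0" and z: "\<alpha> $ 0 = 0" "\<gamma> $ 0 = 0"
    and polar: "ev (fps_deriv G) \<gamma> = 0" and nz: "ev G \<gamma> \<noteq> 0"
  obtains \<omega> k where "\<omega> ^ N = 1" "subdegree (ev G \<gamma>) = contact_order N \<alpha> k"
    "ev G \<gamma> $ subdegree (ev G \<gamma>) = \<omega> ^ subdegree (ev G \<gamma>) * (contact_coeff N \<alpha> k * U $ 0 $ 0)"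
proof -
  define B where "B = conjugates N \<alpha>"
  have fin: "finite B" "B \<noteq> {}" using finite_conjugates[OF N] self_in_conjugates[of \<alpha> N] by (auto simp: B_def)
  obtain b0 where b0: "b0 \<in> B" "\<And>b. b \<in> B \<Longrightarrow> subdegree (\<gamma> - b) \<le> subdegree (\<gamma> - b0)"
    using arg_min_if_finite[OF fin, of "\<lambda>b. - int (subdegree (\<gamma> - b))"]
    by (metis neg_le_iff_le not_le_imp_less of_nat_le_iff)
  obtain \<omega> where \<omega>: "b0 = \<alpha> oo rot \<omega>" "\<omega> ^ N = 1" using b0(1) by (auto simp: B_def conjugates_def)
  then have \<omega>0: "\<omega> \<noteq> 0" using N by (auto simp: power_0_left)
  define \<omega>' where "\<omega>' = inverse \<omega>"
  have \<omega>': "\<omega>' ^ N = 1" "\<omega>' \<noteq> 0" using \<omega>(2) \<omega>0 by (auto simp: \<omega>'_def power_inverse)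
  have inverse: "(a oo rot \<omega>') oo rot \<omega> = a" "(a oo rot \<omega>) oo rot \<omega>' = a" for a :: "complex fps"
    using \<omega>0 by (auto intro!: fps_ext simp: \<omega>'_def mult.assoc[symmetric] simp flip: power_mult_distrib)
  define \<gamma>' where "\<gamma>' = \<gamma> oo rot \<omega>'"
  have z': "\<gamma>' $ 0 = 0" using z by (simp add: \<gamma>'_def)
  have evr: "ev F \<gamma> oo rot \<omega>' = ev F \<gamma>'" if "sx (rot \<omega>') F = F" for F
    using compose_ev[OF z(2), of "rot \<omega>'" F] that by (simp add: \<gamma>'_def)
  have inv': "sx (rot \<omega>') G = G" using inv \<omega>'(1) by blast
  then have evG: "ev G \<gamma>' = ev G \<gamma> oo rot \<omega>'" using evr by simp
  have "sx (rot \<omega>') (fps_deriv G) = fps_deriv G" by (simp add: sx_deriv inv')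
  then have polar': "ev (fps_deriv G) \<gamma>' = 0" using evr[of "fps_deriv G"] polar by simp
  have sdG: "subdegree (ev G \<gamma>') = subdegree (ev G \<gamma>)" unfolding evG by (rule subdegree_compose_rot[OF \<omega>'(2)])
  have nz': "ev G \<gamma>' \<noteq> 0" using nz inverse(1) evG by (metis fps_compose_0)
  have max': "subdegree (\<gamma>' - b) \<le> subdegree (\<gamma>' - \<alpha>)" if "b \<in> conjugates N \<alpha>" for b
  proof -
    have "b oo rot \<omega> \<in> B" using conjugates_rot[OF N \<omega>(2), of \<alpha>] that by (auto simp: B_def bij_betw_def)
    moreover have "\<gamma>' - b = (\<gamma> - (b oo rot \<omega>)) oo rot \<omega>'"
      by (simp add: \<gamma>'_def fps_compose_sub_distrib inverse)
    moreover have "\<gamma>' - \<alpha> = (\<gamma> - b0) oo rot \<omega>'"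
      by (simp add: \<gamma>'_def fps_compose_sub_distrib inverse \<omega>(1))
    ultimately show ?thesis using b0(2) subdegree_compose_rot[OF \<omega>'(2)] by metis
  qed
  have P: "subdegree (ev G \<gamma>') = contact_order N \<alpha> (subdegree (\<gamma>' - \<alpha>))"
    "ev G \<gamma>' $ subdegree (ev G \<gamma>') = contact_coeff N \<alpha> (subdegree (\<gamma>' - \<alpha>)) * U $ 0 $ 0"
    using polar_leading_coeff[OF N U z(1) z', folded G, OF polar' nz' max'] by auto
  have "\<omega> ^ n * (\<omega>' ^ n * x) = x" for n x using \<omega>0 by (simp add: \<omega>'_def mult.assoc[symmetric] flip: power_mult_distrib)
  then have "ev G \<gamma> $ n = \<omega> ^ n * ev G \<gamma>' $ n" for n by (simp add: evG)
  then show ?thesis using that[OF \<omega>(2), of "subdegree (\<gamma>' - \<alpha>)"] P sdG by simp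
qed

text \<open>Equal orders force equal contacts by strict monotonicity, so both leading coefficients
  are one and the same value times powers of N-th roots of unity.\<close>

theorem polar_conjugate_leading:
  fixes \<alpha> \<gamma> \<gamma>' :: "complex fps" and U G :: "complex fps fps"
  assumes G: "G = conj_prod N \<alpha> * U" and inv: "\<And>\<omega>. \<omega> ^ N = 1 \<Longrightarrow> sx (rot \<omega>) G = G"
    and N: "N \<ge> 1" and U: "U $ 0 $ 0 \<noteq> 0" and z: "\<alpha> $ 0 = 0" "\<gamma> $ 0 = 0" "\<gamma>' $ 0 = 0"
    and polar: "ev (fps_deriv G) \<gamma> = 0" "ev (fps_deriv G) \<gamma>' = 0"
    and nz: "ev G \<gamma> \<noteq> 0" "ev G \<gamma>' \<noteq> 0"
    and eq: "subdegree (ev G \<gamma>) = s" "subdegree (ev G \<gamma>') = s"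
  obtains \<omega> where "\<omega> ^ N = 1" "ev G \<gamma>' $ s = \<omega> ^ s * ev G \<gamma> $ s"
proof -
  obtain \<omega> k where 1: "\<omega> ^ N = 1" "s = contact_order N \<alpha> k" "ev G \<gamma> $ s = \<omega> ^ s * (contact_coeff N \<alpha> k * U $ 0 $ 0)"
    using polar_normalized[OF G inv N U z(1,2) polar(1) nz(1)] eq(1) by metis
  obtain \<omega>' k' where 2: "\<omega>' ^ N = 1" "s = contact_order N \<alpha> k'" "ev G \<gamma>' $ s = \<omega>' ^ s * (contact_coeff N \<alpha> k' * U $ 0 $ 0)"
    using polar_normalized[OF G inv N U z(1,3) polar(2) nz(2)] eq(2) by metis
  have "k = k'" using 1(2) 2(2) contact_order_strict_mono[OF N, of _ _ \<alpha>] by (metis nat_neq_iff)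
  have \<omega>0: "\<omega> \<noteq> 0" using 1(1) N by (auto simp: power_0_left)
  have "(\<omega>' / \<omega>) ^ N = 1" using 1(1) 2(1) by (simp add: power_divide)
  moreover have "ev G \<gamma>' $ s = (\<omega>' / \<omega>) ^ s * ev G \<gamma> $ s"
    using 1(3) 2(3) \<omega>0 by (simp add: \<open>k = k'\<close> power_divide)
  ultimately show ?thesis by (rule that)
qed

section \<open>Initial forms\<close>

text \<open>The initial form for the weights p of x and q of y, written with x = 1 and y = z. It is
  multiplicative, being a lowest coefficient over an integral domain.\<close>

definition init_poly :: "nat \<Rightarrow> nat \<Rightarrow> 'a::idom fps fps \<Rightarrow> 'a poly" where
  "init_poly p q F = weighted p q F $ subdegree (weighted p q F)"

lemma init_poly_mult:
  "p \<ge> 1 \<Longrightarrow> q \<ge> 1 \<Longrightarrow> init_poly p q (F * G) = init_poly p q F * init_poly p q G"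
  unfolding init_poly_def
  by (cases "weighted p q F = 0 \<or> weighted p q G = 0") (auto simp: weighted_mult)

lemma lift1_1: "lift1 1 = 1"
proof (rule fps_ext)
  fix n show "lift1 1 $ n = (1 :: 'a poly fps) $ n" by (cases "n = 0") auto
qed

lemma lift1_power: "lift1 (c ^ k) = lift1 c ^ k"
  by (induction k) (simp_all add: lift1_1 lift1_mult)

lemma lift1_X: "lift1 fps_X = fps_X"
proof (rule fps_ext)
  fix n show "lift1 fps_X $ n = (fps_X :: 'a poly fps) $ n" by (cases "n = 1") auto
qed

lemma lift2_X: "lift2 fps_X = fps_X"
proof (rule fps_ext)
  fix n show "lift2 fps_X $ n = (fps_X :: 'a poly fps fps) $ n" by (cases "n = 1") (auto simp: lift1_1)
qed

lemma weighted_1 [simp]: "weighted p q 1 = 1"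
proof -
  have "lift2 (1 :: 'a::idom fps fps) $ n = 1 $ n" for n
    by (cases "n = 0") (simp_all add: lift1_1)
  then have "lift2 (1 :: 'a::idom fps fps) = 1" by (rule fps_ext)
  then show ?thesis by (simp add: weighted_def)
qed

lemma init_poly_1 [simp]: "init_poly p q 1 = 1"
  by (simp add: init_poly_def)

lemma init_poly_prod:
  "p \<ge> 1 \<Longrightarrow> q \<ge> 1 \<Longrightarrow> init_poly p q (\<Prod>x\<in>A. F x) = (\<Prod>x\<in>A. init_poly p q (F x))"
  by (induction A rule: infinite_finite_induct) (auto simp: init_poly_mult)

lemma init_poly_power:
  "p \<ge> 1 \<Longrightarrow> q \<ge> 1 \<Longrightarrow> init_poly p q (F ^ n) = init_poly p q F ^ n"
  by (induction n) (auto simp: init_poly_mult)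

lemma init_poly_unit:
  assumes "p \<ge> 1" "q \<ge> 1" "F $ 0 $ 0 \<noteq> 0"
  shows "init_poly p q F = [:F $ 0 $ 0:]"
proof -
  have "weighted p q F $ 0 = [:F $ 0 $ 0:]" by (simp add: weighted_def)
  moreover from this have "subdegree (weighted p q F) = 0" using assms(3) by (simp add: subdegree_eq_0_iff)
  ultimately show ?thesis by (simp add: init_poly_def)
qed

section \<open>Initial forms under ramification\<close>

lemma lift1_compose: "lift1 (a oo c) = lift1 a oo lift1 c" for a c :: "'a::idom fps"
proof (rule fps_ext)
  fix n
  have pow: "(lift1 c ^ k) $ m = [:(c ^ k) $ m:]" for k m by (simp flip: lift1_power)
  have "lift1 (a oo c) $ n = (\<Sum>i=0..n. [:a $ i * (c ^ i) $ n:])"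
    by (simp only: lift1_nth fps_compose_nth sum_to_poly)
  also have "\<dots> = (\<Sum>i=0..n. lift1 a $ i * (lift1 c ^ i) $ n)"
    by (intro sum.cong refl) (simp add: pow)
  finally show "lift1 (a oo c) $ n = (lift1 a oo lift1 c) $ n" by (simp only: fps_compose_nth)
qed

lemma lift1_X_power: "lift1 (fps_X ^ n) = fps_X ^ n"
  by (simp add: lift1_power lift1_X)

lemma lift2_sx_X_power: "lift2 (sx (fps_X ^ k) F) = sx (fps_X ^ k) (lift2 F)"
  by (rule fps_ext) (simp add: lift1_compose lift1_X_power)

text \<open>Both sides are F(s^(p k), z s^(k q)).\<close>

lemma weighted_sx_X_power:
  assumes "p \<ge> 1" "q \<ge> 1" "k \<ge> 1"
  shows "weighted p (k * q) (sx (fps_X ^ k) F) = weighted p q F oo fps_X ^ k"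
proof -
  have X: "fps_X ^ a oo fps_X ^ b = (fps_X ^ (a * b) :: 'a poly fps)" if "b \<ge> 1" for a b
    using that by (simp add: fps_X_power_compose mult.commute flip: power_mult)
  have "weighted p q F oo fps_X ^ k = psubst (lift2 F) (fps_X ^ p oo fps_X ^ k) (fps_const [:0, 1:] * fps_X ^ q oo fps_X ^ k)"
    unfolding weighted_def using assms by (intro compose_psubst) auto
  also have "fps_const [:0, 1:] * fps_X ^ q oo fps_X ^ k = fps_const [:0, 1:] * (fps_X ^ (k * q) :: 'a poly fps)"
    using assms by (subst fps_compose_mult_distrib) (auto simp: X mult.commute)
  also have "fps_X ^ p oo fps_X ^ k = (fps_X ^ k oo fps_X ^ p :: 'a poly fps)"
    using assms by (simp add: X mult.commute)
  finally show ?thesis unfolding weighted_def lift2_sx_X_power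
    using assms by (subst psubst_sx) auto
qed

lemma nth_compose_X_power_subdegree:
  fixes a :: "'a::idom fps"
  assumes "k \<ge> 1"
  shows "subdegree (a oo fps_X ^ k) = subdegree a * k"
    and "(a oo fps_X ^ k) $ (subdegree a * k) = a $ subdegree a"
proof -
  show "subdegree (a oo fps_X ^ k) = subdegree a * k"
    using assms by (subst subdegree_fps_compose) auto
  show "(a oo fps_X ^ k) $ (subdegree a * k) = a $ subdegree a"
    using assms by (simp add: fps_nth_compose_X_power)
qed

lemma init_poly_sx_X_power:
  assumes "p \<ge> 1" "q \<ge> 1" "k \<ge> 1"
  shows "init_poly p (k * q) (sx (fps_X ^ k) F) = init_poly p q F"
  unfolding init_poly_def weighted_sx_X_power[OF assms]
  by (simp only: nth_compose_X_power_subdegree[OF assms(3)])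

text \<open>The weighted series is z s^q - b(s^p). Its initial form is z, a nonzero constant, or z
  minus the leading coefficient of \<open>b\<close>; only the last case, where the two orders agree,
  has a nonzero root.\<close>

lemma init_poly_linear_root:
  fixes b :: "complex fps"
  assumes pq: "p \<ge> 1" "q \<ge> 1" and b: "b \<noteq> 0" "b $ 0 = 0" and \<zeta>: "\<zeta> \<noteq> 0"
    and root: "poly (init_poly p q (fps_X - fps_const b)) \<zeta> = 0"
  shows "p * subdegree b = q \<and> \<zeta> = b $ subdegree b"
proof -
  define A where "A = (fps_const [:0, 1:] * fps_X ^ q :: complex poly fps)"
  define C where "C = lift1 b oo fps_X ^ p"
  define e where "e = subdegree b"
  have "lift2 (fps_X - fps_const b) = lift2 fps_X - lift2 (fps_const b)"
    by (rule fps_ext) (auto intro!: fps_ext)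
  then have W: "weighted p q (fps_X - fps_const b) = A - C"
    using pq by (simp add: weighted_def lift2_const lift2_X A_def C_def)
  have sl: "subdegree (lift1 b) = e" "lift1 b $ e = [:b $ e:]"
    using b(1) by (auto simp: e_def intro!: subdegreeI)
  have sC: "subdegree C = e * p" "C $ (e * p) = [:b $ e:]"
    using nth_compose_X_power_subdegree[OF pq(1), of "lift1 b"] sl by (auto simp: C_def)
  have sA: "subdegree A = q" "A $ q = [:0, 1:]"
    by (auto simp: A_def intro!: subdegreeI)
  have nz: "A \<noteq> 0" "C \<noteq> 0" "b $ e \<noteq> 0" using sA sC b(1) by (auto simp: e_def)
  consider "q < e * p" | "q > e * p" | "q = e * p" by linarith
  then show ?thesis
  proof cases
    case 1
    have "subdegree (A - C) = q" using subdegree_diff_eq1[of A C] nz sA sC 1 by simp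
    then have "init_poly p q (fps_X - fps_const b) = [:0, 1:]"
      using 1 sA sC nth_less_subdegree_zero[of q C] by (simp add: init_poly_def W)
    then show ?thesis using root \<zeta> by simp
  next
    case 2
    have "subdegree (A - C) = e * p" using subdegree_diff_eq2[of C A] nz sA sC 2 by simp
    then have "init_poly p q (fps_X - fps_const b) = - [:b $ e:]"
      using 2 sA sC nth_less_subdegree_zero[of "e * p" A] by (simp add: init_poly_def W)
    then show ?thesis using root nz by simp
  next
    case 3
    have "(A - C) $ q = [:- (b $ e), 1:]" using sA sC 3 by simp
    moreover from this have "subdegree (A - C) = q"
      using sA sC 3 nth_less_subdegree_zero[of _ A] nth_less_subdegree_zero[of _ C] by (intro subdegreeI) auto
    ultimately have "init_poly p q (fps_X - fps_const b) = [:- (b $ e), 1:]"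
      by (simp add: init_poly_def W)
    then show ?thesis using root 3 by (simp add: e_def mult.commute)
  qed
qed

text \<open>The initial form of \<open>g\<close> is a product over the conjugates of
  \<open>F\<close>, so \<zeta> is the leading coefficient of one of them. Conjugation multiplies
  this coefficient by a power of \<omega> whose p-th power is \<omega>^(k q) = 1.\<close>

lemma branch_init_root:
  fixes g :: "complex fps fps"
  assumes g: "irreducible g" and k: "k \<ge> 1" and F: "F $ 0 = 0" "F \<noteq> 0" and root: "psubst g (fps_X ^ k) F = 0"
    and pq: "p \<ge> 1" "q \<ge> 1" and \<zeta>: "\<zeta> \<noteq> 0" "poly (init_poly p q g) \<zeta> = 0"
  shows "p * subdegree F = q * k \<and> \<zeta> ^ p = (F $ subdegree F) ^ p"
proof -
  obtain U where U: "sx (fps_X ^ k) g = conj_prod k F * U" "U $ 0 $ 0 \<noteq> 0"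
    using irreducible_factorization[OF g k F(1) root] by blast
  have kq: "k * q \<ge> 1" using k pq by simp
  have "init_poly p q g = init_poly p (k * q) (conj_prod k F * U)"
    using init_poly_sx_X_power[OF pq k, of g] U by simp
  also have "\<dots> = (\<Prod>b\<in>conjugates k F. init_poly p (k * q) (fps_X - fps_const b)) * [:U $ 0 $ 0:]"
    using pq kq U(2) by (simp add: init_poly_mult init_poly_unit conj_prod_def init_poly_prod)
  finally have "(\<Prod>b\<in>conjugates k F. poly (init_poly p (k * q) (fps_X - fps_const b)) \<zeta>) = 0"
    using \<zeta>(2) U(2) by (simp add: poly_prod)
  then obtain b where b: "b \<in> conjugates k F" "poly (init_poly p (k * q) (fps_X - fps_const b)) \<zeta> = 0"
    using finite_conjugates[OF k] by auto
  obtain \<omega> where \<omega>: "b = F oo rot \<omega>" "\<omega> ^ k = 1" using b(1) by (auto simp: conjugates_def)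
  have \<omega>0: "\<omega> \<noteq> 0" using \<omega>(2) k by (auto simp: power_0_left)
  have "subdegree (rot \<omega>) = 1" "rot \<omega> \<noteq> 0" using \<omega>0 by (auto simp: rot_def)
  then have sb: "subdegree b = subdegree F" by (simp add: \<omega>(1))
  have bF: "b $ subdegree b = \<omega> ^ subdegree F * F $ subdegree F" unfolding sb by (simp add: \<omega>(1))
  have "b \<noteq> 0" using bF F(2) \<omega>0 by auto
  then have 1: "p * subdegree b = k * q" "\<zeta> = b $ subdegree b"
  proof -
    have "b $ 0 = 0" using conjugates_nth_0[OF b(1)] F(1) by simp
    from init_poly_linear_root[OF pq(1) kq \<open>b \<noteq> 0\<close> this \<zeta>(1) b(2)]
    show "p * subdegree b = k * q" "\<zeta> = b $ subdegree b" by blast+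
  qed
  have "\<zeta> ^ p = \<omega> ^ (p * subdegree F) * (F $ subdegree F) ^ p"
    unfolding 1(2) bF by (simp add: power_mult_distrib mult.commute[of p] power_mult)
  also have "\<omega> ^ (p * subdegree F) = (\<omega> ^ k) ^ q" unfolding sb[symmetric] 1(1) by (rule power_mult)
  finally show ?thesis using 1(1) sb \<omega>(2) by (simp add: mult.commute)
qed

text \<open>The unit part of \<open>L\<close> has a k-th root, so \<open>L\<close> is the k-th power
  of a series of order 1; the compositional inverse of that series is the new parameter.\<close>

lemma reparametrize:
  fixes L :: "complex fps"
  assumes "L $ 0 = 0" "L \<noteq> 0"
  obtains \<psi> k where "k \<ge> 1" "\<psi> $ 0 = 0" "\<psi> \<noteq> 0" "L oo \<psi> = fps_X ^ k"
proof -
  define k where "k = subdegree L"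
  have k1: "k \<ge> 1" using assms subdegree_eq_0_iff[of L] by (simp add: k_def Suc_le_eq)
  then obtain k' where k': "k = Suc k'" by (cases k) auto
  define M where "M = fps_shift k L"
  have M0: "M $ 0 \<noteq> 0" using assms by (simp add: M_def k_def)
  have LM: "L = M * fps_X ^ k" unfolding M_def k_def by (rule subdegree_decompose)
  obtain w where w: "M $ 0 = w ^ k" using exists_complex_root[of k "M $ 0"] k1 by auto
  define R where "R = fps_radical (\<lambda>_ _. w) k M"
  have Rk: "R ^ k = M" using power_radical[OF M0, of "\<lambda>_ _. w" k'] w by (simp add: R_def k')
  have "(R ^ k) $ 0 = (R $ 0) ^ k" by (induction k) auto
  then have R0: "R $ 0 \<noteq> 0" using M0 k1 Rk by (auto simp: power_0_left)
  define \<phi> where "\<phi> = fps_X * R"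
  have \<phi>: "\<phi> $ 0 = 0" "\<phi> $ 1 \<noteq> 0" using R0 by (auto simp: \<phi>_def)
  define \<psi> where "\<psi> = fps_inv \<phi>"
  have \<psi>0: "\<psi> $ 0 = 0" by (simp add: \<psi>_def fps_inv_def)
  have X: "\<phi> oo \<psi> = fps_X" unfolding \<psi>_def by (rule fps_inv_right[OF \<phi>])
  have "\<psi> \<noteq> 0"
  proof
    assume "\<psi> = 0"
    then have "fps_X = (0 :: complex fps)" using X \<phi>(1) by simp
    then show False by simp
  qed
  moreover have "L = \<phi> ^ k" unfolding LM by (simp add: \<phi>_def power_mult_distrib Rk mult.commute)
  then have "L oo \<psi> = fps_X ^ k" using fps_compose_power[OF \<psi>0, of \<phi> k] X by simp
  ultimately show ?thesis using that k1 \<psi>0 by blast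
qed

section \<open>Compact edges of the Newton diagram\<close>

definition diagram_generators :: "cps2 \<Rightarrow> (real \<times> real) set" where
  "diagram_generators g = {(real i + s, real j + t) | i j s t. coeff2 g i j \<noteq> 0 \<and> s \<ge> 0 \<and> t \<ge> 0}"

lemma newton_diagram_eq: "newton_diagram g = convex hull (diagram_generators g)"
  by (simp add: newton_diagram_def diagram_generators_def)

lemma newton_diagram_support: "coeff2 g i j \<noteq> 0 \<Longrightarrow> (real i, real j) \<in> newton_diagram g"
  unfolding newton_diagram_eq
  by (rule subsetD[OF hull_subset]) (force simp: diagram_generators_def)

lemma newton_diagram_upward:
  assumes "z \<in> newton_diagram g" "fst v \<ge> 0" "snd v \<ge> 0"
  shows "z + v \<in> newton_diagram g"
proof -
  have "(+) v ` diagram_generators g \<subseteq> diagram_generators g"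
  proof
    fix x assume "x \<in> (+) v ` diagram_generators g"
    then obtain i j s t where ij: "coeff2 g i j \<noteq> 0" "s \<ge> 0" "t \<ge> 0" "x = v + (real i + s, real j + t)"
      by (auto simp: diagram_generators_def)
    then have "x = (real i + (s + fst v), real j + (t + snd v))" by (cases v) simp
    then show "x \<in> diagram_generators g" using ij assms unfolding diagram_generators_def
      by (intro CollectI exI[of _ i] exI[of _ j] exI[of _ "s + fst v"] exI[of _ "t + snd v"]) auto
  qed
  then have "(+) v ` newton_diagram g \<subseteq> newton_diagram g"
    unfolding newton_diagram_eq using convex_hull_translation[of v] hull_mono by metis
  then show ?thesis using assms(1) by (auto simp: add.commute)
qed

text \<open>Otherwise z + v is the midpoint of z and z + 2 v, both in the diagram.\<close>

lemma newton_diagram_extreme_minimal: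
  assumes x: "(z + v) extreme_point_of newton_diagram g" and z: "z \<in> newton_diagram g"
    and v: "fst v \<ge> 0" "snd v \<ge> 0"
  shows "v = 0"
proof (rule ccontr)
  assume "v \<noteq> 0"
  have "z + 2 *\<^sub>R v \<in> newton_diagram g"
    by (rule newton_diagram_upward[OF z]) (use v in auto)
  moreover have "midpoint z (z + 2 *\<^sub>R v) = z + v"
    by (simp add: midpoint_def scaleR_add_right scaleR_2 flip: scaleR_add_left)
  moreover have "midpoint z (z + 2 *\<^sub>R v) \<in> open_segment z (z + 2 *\<^sub>R v)"
    using \<open>v \<noteq> 0\<close> by simp
  ultimately show False using x z unfolding extreme_point_of_def by metis
qed

lemma newton_diagram_extreme_support:
  assumes "x extreme_point_of newton_diagram g"
  obtains i j where "coeff2 g i j \<noteq> 0" "x = (real i, real j)"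
proof -
  have "x \<in> diagram_generators g"
    using assms unfolding newton_diagram_eq by (rule extreme_point_of_convex_hull)
  then obtain i j s t where *: "coeff2 g i j \<noteq> 0" "s \<ge> 0" "t \<ge> 0" "x = (real i, real j) + (s, t)"
    by (auto simp: diagram_generators_def)
  then have "(s, t) = 0"
    using assms newton_diagram_support[OF *(1)] by (intro newton_diagram_extreme_minimal[of "(real i, real j)" _ g]) auto
  then show ?thesis using that * by (metis add.right_neutral)
qed

section \<open>Endpoints and supporting lines of an edge\<close>

lemma mem_closed_segment_prod:
  fixes x y :: real
  shows "(x, y) \<in> closed_segment (a, b) (c, d) \<longleftrightarrow>
    (\<exists>u. 0 \<le> u \<and> u \<le> 1 \<and> x = a + u * (c - a) \<and> y = b + u * (d - b))"
  by (force simp: closed_segment_def algebra_simps)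

lemma mem_open_segmentI:
  fixes x :: "'a::real_vector"
  assumes "0 < u" "u < 1" "x = a + u *\<^sub>R (b - a)" "a \<noteq> b"
  shows "x \<in> open_segment a b"
  using assms unfolding in_segment by (intro conjI exI[of _ u]) (auto simp: algebra_simps)

text \<open>Endpoints of the edge are extreme points of the diagram, hence support points, and two
  distinct extreme points are never comparable coordinatewise. So the edge has negative
  slope.\<close>

lemma compact_edge_endpoints:
  assumes "S \<in> compact_edges g"
  obtains i1 j1 i2 j2 where "i1 < i2" "j2 < j1" "coeff2 g i1 j1 \<noteq> 0" "coeff2 g i2 j2 \<noteq> 0"
    "S = closed_segment (real i1, real j1) (real i2, real j2)"
    "(real i1, real j1) extreme_point_of newton_diagram g" "(real i2, real j2) extreme_point_of newton_diagram g"
proof -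
  have face: "S face_of newton_diagram g" and dim: "aff_dim S = 1" and comp: "compact S"
    using assms by (auto simp: compact_edges_def edge_of_def)
  have "S \<noteq> {}" using dim by auto
  moreover have "convex S" using face by (rule face_of_imp_convex)
  moreover have "collinear S" using dim by (simp add: collinear_aff_dim)
  ultimately obtain a b where S: "S = closed_segment a b"
    using compact_convex_collinear_segment comp by metis
  have ab: "a \<noteq> b" using dim S by auto
  have ext: "a extreme_point_of newton_diagram g" "b extreme_point_of newton_diagram g"
    using extreme_point_of_face[OF face, of a] extreme_point_of_face[OF face, of b]
    unfolding S by (simp_all add: extreme_point_of_segment)
  obtain i1 j1 where 1: "coeff2 g i1 j1 \<noteq> 0" "a = (real i1, real j1)"
    using newton_diagram_extreme_support[OF ext(1)] by blast
  obtain i2 j2 where 2: "coeff2 g i2 j2 \<noteq> 0" "b = (real i2, real j2)"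
    using newton_diagram_extreme_support[OF ext(2)] by blast
  have le: False if "(real i, real j) extreme_point_of newton_diagram g" "coeff2 g i' j' \<noteq> 0"
    "i' \<le> i" "j' \<le> j" "(i, j) \<noteq> (i', j')" for i j i' j'
  proof -
    have "((real i', real j') + (real i - real i', real j - real j')) extreme_point_of newton_diagram g"
      using that(1) by simp
    from newton_diagram_extreme_minimal[OF this newton_diagram_support[OF that(2)]]
    show False using that(3-5) by (auto simp: zero_prod_def)
  qed
  have ne: "(i1, j1) \<noteq> (i2, j2)" using ab 1 2 by auto
  consider "i1 < i2" "j2 < j1" | "i2 < i1" "j1 < j2"
    using le[of i1 j1 i2 j2] le[of i2 j2 i1 j1] ext 1 2 ne by (metis linorder_not_le nat_le_linear)
  then show ?thesis
  proof cases
    case 1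
    then show ?thesis using that[of i1 i2 j2 j1] \<open>coeff2 g i1 j1 \<noteq> 0\<close> \<open>a = _\<close> 2 S ext by simp
  next
    case 2
    have "S = closed_segment b a" by (simp add: S closed_segment_commute)
    then show ?thesis using that[of i2 i1 j1 j2] 1 2 \<open>coeff2 g i2 j2 \<noteq> 0\<close> \<open>b = _\<close> ext by simp
  qed
qed

text \<open>If z lay strictly below the line, a short step from the midpoint m of the edge away from
  z would stay in the diagram, and the face property would put z on the edge. A point on the line
  beyond an endpoint would keep that endpoint from being extreme.\<close>

lemma compact_edge_supporting_line:
  fixes A B :: real
  assumes S: "S face_of newton_diagram g" "S = closed_segment a b"
    and a: "a extreme_point_of newton_diagram g" and b: "b extreme_point_of newton_diagram g"
    and AB: "A > 0" "B > 0" "b = a + (B, - A)"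
    and z: "z \<in> newton_diagram g"
  shows "A * fst z + B * snd z \<ge> A * fst a + B * snd a"
    and "A * fst z + B * snd z = A * fst a + B * snd a \<Longrightarrow> z \<in> S"
proof -
  define \<phi> where "\<phi> x = A * fst x + B * snd x" for x :: "real \<times> real"
  have SD: "S \<subseteq> newton_diagram g" using S(1) by (rule face_of_imp_subset)
  have onS: "\<phi> x = \<phi> a" if "x \<in> S" for x
  proof -
    have "x \<in> closed_segment a b" using that by (simp only: S(2))
    then obtain u where "x = (1 - u) *\<^sub>R a + u *\<^sub>R b" unfolding in_segment by blast
    then have "x = a + u *\<^sub>R (B, - A)" using AB(3) by (simp add: algebra_simps)
    then show ?thesis by (simp add: \<phi>_def algebra_simps)
  qed
  show "A * fst z + B * snd z \<ge> A * fst a + B * snd a"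
  proof (rule ccontr)
    assume "\<not> A * fst z + B * snd z \<ge> A * fst a + B * snd a"
    then have lt: "\<phi> z < \<phi> a" by (simp add: \<phi>_def)
    define m where "m = a + (1 / 2) *\<^sub>R (B, - A)"
    define r where "r = m - z"
    \<comment> \<open>\<open>\<mu>\<close> and \<open>\<beta>\<close> are the coordinates of m - z
      in the basis (B, -A), (1, 1). The factor \<open>\<epsilon>\<close> keeps the first part within
      half the edge, and the second part points into the diagram because \<beta> > 0.\<close>
    define \<beta> where "\<beta> = \<phi> r / (A + B)"
    define \<mu> where "\<mu> = (fst r - snd r) / (A + B)"
    define \<epsilon> where "\<epsilon> = 1 / (2 * (\<bar>\<mu>\<bar> + 1))"
    have \<epsilon>: "\<epsilon> > 0" "\<bar>\<epsilon> * \<mu>\<bar> \<le> 1 / 2" by (auto simp: \<epsilon>_def abs_mult field_simps)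
    have "\<phi> m = \<phi> a" by (simp add: m_def \<phi>_def algebra_simps)
    then have "\<phi> r > 0" using lt by (simp add: r_def \<phi>_def algebra_simps)
    then have \<beta>: "\<beta> > 0" using AB by (simp add: \<beta>_def)
    have r: "r = \<mu> *\<^sub>R (B, - A) + \<beta> *\<^sub>R (1, 1)"
    proof (rule prod_eqI)
      have "A + B \<noteq> 0" using AB by linarith
      moreover have "fst (\<mu> *\<^sub>R (B, - A) + \<beta> *\<^sub>R (1, 1)) = ((fst r - snd r) * B + \<phi> r) / (A + B)"
        "snd (\<mu> *\<^sub>R (B, - A) + \<beta> *\<^sub>R (1, 1)) = (\<phi> r - (fst r - snd r) * A) / (A + B)"
      proof -
        obtain D where D: "A + B = D" "D \<noteq> 0" using \<open>A + B \<noteq> 0\<close> by blast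
        show "fst (\<mu> *\<^sub>R (B, - A) + \<beta> *\<^sub>R (1, 1)) = ((fst r - snd r) * B + \<phi> r) / (A + B)"
          "snd (\<mu> *\<^sub>R (B, - A) + \<beta> *\<^sub>R (1, 1)) = (\<phi> r - (fst r - snd r) * A) / (A + B)"
          unfolding \<mu>_def \<beta>_def D(1) using D(2) by (simp_all add: field_simps)
      qed
      moreover have "(fst r - snd r) * B + \<phi> r = fst r * (A + B)" "\<phi> r - (fst r - snd r) * A = snd r * (A + B)"
        by (simp_all add: \<phi>_def algebra_simps)
      ultimately show "fst r = fst (\<mu> *\<^sub>R (B, - A) + \<beta> *\<^sub>R (1, 1))" "snd r = snd (\<mu> *\<^sub>R (B, - A) + \<beta> *\<^sub>R (1, 1))"
        by simp_all
    qed
    have seg: "a + t *\<^sub>R (B, - A) \<in> S" if "0 \<le> t" "t \<le> 1" for t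
      using that AB(3) unfolding S(2) closed_segment_def
      by (intro CollectI exI[of _ t]) (auto simp: algebra_simps)
    have "a + (1 / 2 + \<epsilon> * \<mu>) *\<^sub>R (B, - A) \<in> newton_diagram g"
      by (rule subsetD[OF SD seg]) (use \<epsilon> in \<open>auto simp: abs_le_iff\<close>)
    then have "a + (1 / 2 + \<epsilon> * \<mu>) *\<^sub>R (B, - A) + (\<epsilon> * \<beta>) *\<^sub>R (1, 1) \<in> newton_diagram g"
      by (rule newton_diagram_upward) (use \<epsilon> \<beta> in auto)
    moreover have "a + (1 / 2 + \<epsilon> * \<mu>) *\<^sub>R (B, - A) + (\<epsilon> * \<beta>) *\<^sub>R (1, 1) = m + \<epsilon> *\<^sub>R r"
      unfolding r m_def by (simp add: algebra_simps)
    ultimately have z': "m + \<epsilon> *\<^sub>R r \<in> newton_diagram g" by simp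
    have "r \<noteq> 0" using \<open>\<phi> r > 0\<close> by (auto simp: \<phi>_def)
    have "m \<in> open_segment z (m + \<epsilon> *\<^sub>R r)"
    proof (rule mem_open_segmentI)
      show "0 < 1 / (1 + \<epsilon>)" "1 / (1 + \<epsilon>) < 1" using \<epsilon> by auto
      have "m + \<epsilon> *\<^sub>R r - z = (1 + \<epsilon>) *\<^sub>R r" by (simp add: r_def algebra_simps)
      then show "m = z + (1 / (1 + \<epsilon>)) *\<^sub>R (m + \<epsilon> *\<^sub>R r - z)" using \<epsilon> by (simp add: r_def)
      then show "z \<noteq> m + \<epsilon> *\<^sub>R r"
        using \<open>r \<noteq> 0\<close> by (auto simp: r_def)
    qed
    moreover have "m \<in> S" unfolding m_def by (rule seg) auto
    ultimately have "z \<in> S" using face_ofD[OF S(1)] z z' by blast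
    then show False using onS lt by auto
  qed
  assume eq: "A * fst z + B * snd z = A * fst a + B * snd a"
  define t where "t = (fst z - fst a) / B"
  have zt: "z = a + t *\<^sub>R (B, - A)"
  proof (rule prod_eqI)
    show "fst z = fst (a + t *\<^sub>R (B, - A))" using AB by (simp add: t_def)
    show "snd z = snd (a + t *\<^sub>R (B, - A))" using AB eq by (simp add: t_def field_simps)
  qed
  have "t \<le> 1"
  proof (rule ccontr)
    assume t: "\<not> t \<le> 1"
    have "b \<in> open_segment a z"
      by (rule mem_open_segmentI[of "1 / t"]) (use t AB(1,2) in \<open>auto simp: AB(3) zt zero_prod_def\<close>)
    moreover have "a \<in> newton_diagram g" using a by (simp add: extreme_point_of_def)
    ultimately show False using b z by (auto simp: extreme_point_of_def)
  qed
  moreover have "t \<ge> 0"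
  proof (rule ccontr)
    assume t: "\<not> t \<ge> 0"
    have "a \<in> open_segment z b"
    proof (rule mem_open_segmentI[of "- t / (1 - t)"])
      have "b - z = (1 - t) *\<^sub>R (B, - A)" by (simp add: AB(3) zt algebra_simps)
      then show "a = z + (- t / (1 - t)) *\<^sub>R (b - z)" using t by (simp add: zt zero_prod_def)
      show "z \<noteq> b"
      proof
        assume "z = b"
        then have "fst z = fst b" by simp
        then show False using t AB by (simp add: zt)
      qed
    qed (use t in \<open>auto simp: field_simps\<close>)
    moreover have "b \<in> newton_diagram g" using b by (simp add: extreme_point_of_def)
    ultimately show False using a z by (auto simp: extreme_point_of_def)
  qed
  ultimately show "z \<in> S"
    unfolding S(2) closed_segment_def
    by (intro CollectI exI[of _ t]) (auto simp: zt AB(3) algebra_simps)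
qed

text \<open>Here \<open>p / q\<close> is the inclination of the edge in lowest terms.\<close>

lemma compact_edge_shape:
  assumes "S \<in> compact_edges g"
  obtains k l p q s where "p \<ge> 1" "q \<ge> 1" "s \<ge> 1" "coprime p q"
    "coeff2 g k (l + q * s) \<noteq> 0" "coeff2 g (k + p * s) l \<noteq> 0"
    "S = closed_segment (real k, real (l + q * s)) (real (k + p * s), real l)"
    "\<And>i j. coeff2 g i j \<noteq> 0 \<Longrightarrow> q * k + p * (l + q * s) \<le> q * i + p * j"
    "\<And>i j. coeff2 g i j \<noteq> 0 \<Longrightarrow> q * i + p * j = q * k + p * (l + q * s) \<Longrightarrow> (real i, real j) \<in> S"
proof -
  obtain i1 j1 i2 j2 where E: "i1 < i2" "j2 < j1" "coeff2 g i1 j1 \<noteq> 0" "coeff2 g i2 j2 \<noteq> 0"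
    "S = closed_segment (real i1, real j1) (real i2, real j2)"
    "(real i1, real j1) extreme_point_of newton_diagram g" "(real i2, real j2) extreme_point_of newton_diagram g"
    by (rule compact_edge_endpoints[OF assms])
  \<comment> \<open>The lattice length of the edge; dividing by it gives the primitive step (p,
    -q).\<close>
  define s where "s = gcd (i2 - i1) (j1 - j2)"
  define p where "p = (i2 - i1) div s"
  define q where "q = (j1 - j2) div s"
  have s: "s \<ge> 1" using E(1) by (simp add: s_def Suc_le_eq)
  have "p * s = i2 - i1" "q * s = j1 - j2"
    unfolding p_def q_def by (rule dvd_div_mult_self, simp add: s_def)+
  then have ps: "i2 = i1 + p * s" and qs: "j1 = j2 + q * s"
    using E(1,2) by linarith+
  have "p \<noteq> 0" using ps E(1) by (metis add_0_right mult_0 less_irrefl)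
  then have p: "p \<ge> 1" by simp
  have "q \<noteq> 0" using qs E(2) by (metis add_0_right mult_0 less_irrefl)
  then have q: "q \<ge> 1" by simp
  have cop: "coprime p q" unfolding p_def q_def s_def using E(1) by (intro div_gcd_coprime) auto
  have face: "S face_of newton_diagram g" using assms by (auto simp: compact_edges_def edge_of_def)
  have b: "(real i2, real j2) = (real i1, real j1) + (real (p * s), - real (q * s))"
    unfolding ps qs by simp
  have pos: "real (q * s) > 0" "real (p * s) > 0" using p q s by auto
  have line1: "real (q * s) * real i1 + real (p * s) * real j1 \<le> real (q * s) * real i + real (p * s) * real j"
    if "coeff2 g i j \<noteq> 0" for i j
    using compact_edge_supporting_line(1)[OF face E(5-7) pos b newton_diagram_support[OF that]]
    by (simp only: fst_conv snd_conv)
  have line2: "(real i, real j) \<in> S" if "coeff2 g i j \<noteq> 0"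
    "real (q * s) * real i + real (p * s) * real j = real (q * s) * real i1 + real (p * s) * real j1" for i j
    by (rule compact_edge_supporting_line(2)[OF face E(5-7) pos b newton_diagram_support[OF that(1)]])
      (use that(2) in \<open>simp only: fst_conv snd_conv\<close>)
  have mult: "real (q * s) * real i + real (p * s) * real j = real (s * (q * i + p * j))" for i j
    by (simp add: algebra_simps)
  have le: "q * i1 + p * j1 \<le> q * i + p * j" if "coeff2 g i j \<noteq> 0" for i j
    using line1[OF that] s unfolding mult of_nat_le_iff by simp
  have eq: "(real i, real j) \<in> S" if "coeff2 g i j \<noteq> 0" "q * i + p * j = q * i1 + p * j1" for i j
    by (rule line2[OF that(1)]) (simp only: mult that(2))
  show ?thesis
  proof (rule that[OF p q s cop, of i1 j2])
    show "coeff2 g i1 (j2 + q * s) \<noteq> 0" "coeff2 g (i1 + p * s) j2 \<noteq> 0"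
      using E(3,4) unfolding ps qs by simp_all
    show "S = closed_segment (real i1, real (j2 + q * s)) (real (i1 + p * s), real j2)"
      using E(5) by (simp only: ps qs)
    show "q * i1 + p * (j2 + q * s) \<le> q * i + p * j" if "coeff2 g i j \<noteq> 0" for i j
      using le[OF that] by (simp only: qs)
    show "(real i, real j) \<in> S" if "coeff2 g i j \<noteq> 0" "q * i + p * j = q * i1 + p * (j2 + q * s)" for i j
      using eq[OF that(1)] that(2) by (simp only: qs)
  qed
qed

text \<open>The edge consists of s primitive steps (p, -q). For s = 1 an interior lattice point
  would give an integer strictly between 0 and p that is divisible by p, by coprimality.\<close>

lemma edge_lattice_points:
  assumes p: "p \<ge> 1" "q \<ge> 1" "s \<ge> 1" "coprime p q"
  shows "rel_interior (closed_segment (real k, real (l + q * s)) (real (k + p * s), real l)) \<inter> (\<int> \<times> \<int>) = {}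
    \<longleftrightarrow> s = 1" (is "rel_interior (closed_segment ?a ?b) \<inter> _ = {} \<longleftrightarrow> _")
proof -
  have ab: "?a \<noteq> ?b" using p by auto
  then have ri: "rel_interior (closed_segment ?a ?b) = open_segment ?a ?b"
    using rel_interior_closed_segment[of ?a ?b] by (simp only: if_False)
  have d: "?b - ?a = (real (p * s), - real (q * s))" by simp
  show ?thesis
  proof
    assume empty: "rel_interior (closed_segment ?a ?b) \<inter> (\<int> \<times> \<int>) = {}"
    show "s = 1"
    proof (rule ccontr)
      assume "s \<noteq> 1"
      then have s2: "s \<ge> 2" using p by simp
      have "(real (k + p), real (l + q * (s - 1))) \<in> open_segment ?a ?b"
      proof (rule mem_open_segmentI[of "1 / real s"])
        show "(real (k + p), real (l + q * (s - 1))) = ?a + (1 / real s) *\<^sub>R (?b - ?a)"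
          unfolding d using s2 by (cases s) (auto simp: field_simps)
      qed (use s2 ab in auto)
      moreover have "(real (k + p), real (l + q * (s - 1))) \<in> \<int> \<times> \<int>"
        using Ints_of_nat by blast
      ultimately show False using empty ri by blast
    qed
  next
    assume s1: "s = 1"
    show "rel_interior (closed_segment ?a ?b) \<inter> (\<int> \<times> \<int>) = {}"
    proof (rule ccontr)
      assume "rel_interior (closed_segment ?a ?b) \<inter> (\<int> \<times> \<int>) \<noteq> {}"
      then obtain x y where xy: "(x, y) \<in> open_segment ?a ?b" "x \<in> \<int>" "y \<in> \<int>" using ri by auto
      obtain u where u: "0 < u" "u < 1" "(x, y) = (1 - u) *\<^sub>R ?a + u *\<^sub>R ?b"
        using xy(1) by (auto simp: in_segment)
      have x: "u * real p = x - real k" and y: "u * real q = real (l + q) - y"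
        using u(3) s1 by (auto simp: algebra_simps)
      have "u * real p \<in> \<int>" "u * real q \<in> \<int>" unfolding x y using xy by (auto intro!: Ints_diff)
      then obtain m n :: int where mn: "u * real p = of_int m" "u * real q = of_int n"
        by (metis Ints_cases)
      have "of_int m * real q = of_int n * real p" using mn by (simp add: mult_ac flip: mn)
      then have "m * int q = n * int p" by (metis of_int_eq_iff of_int_mult of_int_of_nat_eq)
      then have "int p dvd m * int q" by simp
      then have dvd: "int p dvd m" using p(4) by (simp add: coprime_dvd_mult_left_iff)
      have "0 < u * real p" "u * real p < real p" using u p by auto
      then have "0 < m" "m < int p" unfolding mn by linarith+
      then show False using dvd zdvd_not_zless by blast
    qed
  qed
qed

section \<open>Roots of the initial forms of the discriminant\<close>

text \<open>The series f(0, y) is nonzero without constant term, so its derivative is nonzero too,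
  and an arc on x = 0 annihilating either of them is constant. This permits the parameter x = t^k on
  arcs of f and of its polar curve.\<close>

lemma polar_abscissa_nonzero:
  fixes f :: "complex fps fps"
  assumes f: "irreducible f" "\<exists>j. f $ j $ 0 \<noteq> 0" and c: "c $ 0 = 0" "L \<noteq> 0 \<or> c \<noteq> 0"
    and zero: "psubst f L c = 0 \<or> psubst (fps_deriv f) L c = 0"
  shows "L \<noteq> 0"
proof
  assume L: "L = 0"
  define u where "u = Abs_fps (\<lambda>j. f $ j $ 0)"
  have "f $ 0 $ 0 = 0" using f(1) by (auto simp: irreducible_def fps2_unit_iff)
  then have u0: "u $ 0 = 0" by (simp add: u_def)
  obtain j where "f $ j $ 0 \<noteq> 0" using f(2) by blast
  then have "u $ j \<noteq> 0" by (simp add: u_def)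
  then have u: "u \<noteq> 0" by auto
  have "fps_deriv u \<noteq> 0"
  proof
    assume "fps_deriv u = 0"
    then have "u = fps_const (u $ 0)" using fps_deriv_eq_0_iff by blast
    then show False using u u0 by simp
  qed
  moreover have "Abs_fps (\<lambda>j. fps_deriv f $ j $ 0) = fps_deriv u"
    by (rule fps_ext) (simp add: fps_deriv_fps_nth u_def del: of_nat_Suc of_nat_add)
  ultimately have "u oo c = 0 \<or> fps_deriv u oo c = 0"
    using zero psubst_left_0[OF c(1)] unfolding L by (metis u_def)
  then have "c = 0" using fps_compose_eq_0_iff[OF c(1)] u \<open>fps_deriv u \<noteq> 0\<close> by blast
  then show False using c(2) L by simp
qed

text \<open>A common zero with the derivative would be a multiple root, but f is a unit times a
  product over distinct conjugates.\<close>

lemma polar_value_nonzero: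
  fixes f :: "complex fps fps"
  assumes f: "irreducible f" and k: "k \<ge> 1" and \<gamma>: "\<gamma> $ 0 = 0" "psubst (fps_deriv f) (fps_X ^ k) \<gamma> = 0"
  shows "psubst f (fps_X ^ k) \<gamma> \<noteq> 0"
proof
  assume "psubst f (fps_X ^ k) \<gamma> = 0"
  from irreducible_factorization[OF f k \<gamma>(1) this] obtain U where
    U: "sx (fps_X ^ k) f = conj_prod k \<gamma> * U" "U $ 0 $ 0 \<noteq> 0" by blast
  define B where "B = conjugates k \<gamma>"
  have fin: "finite B" and \<gamma>B: "\<gamma> \<in> B" using finite_conjugates[OF k] self_in_conjugates by (auto simp: B_def)
  have "ev (conj_prod k \<gamma>) \<gamma> = 0"
    using fin \<gamma>B \<gamma>(1) by (auto simp: conj_prod_def ev_prod B_def[symmetric])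
  then have "psubst (fps_deriv f) (fps_X ^ k) \<gamma> = ev (fps_deriv (conj_prod k \<gamma>)) \<gamma> * ev U \<gamma>"
    using \<gamma>(1) by (simp add: psubst_def sx_deriv U)
  moreover have "ev (fps_deriv (conj_prod k \<gamma>)) \<gamma> = (\<Sum>b\<in>B. \<Prod>c\<in>B - {b}. \<gamma> - c)"
    unfolding conj_prod_def B_def[symmetric] fps_deriv_linear_prod[OF fin]
    using \<gamma>(1) by (simp add: ev_sum ev_prod)
  \<comment> \<open>A product that omits a root other than \<gamma> still contains the factor
    \<gamma> - \<gamma>.\<close>
  moreover have "\<dots> = (\<Sum>b\<in>{\<gamma>}. \<Prod>c\<in>B - {b}. \<gamma> - c)"
    by (rule sum.mono_neutral_right[OF fin]) (use fin \<gamma>B in \<open>auto intro!: prod_zero\<close>)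
  moreover have "(\<Prod>c\<in>B - {\<gamma>}. \<gamma> - c) \<noteq> 0" using fin by auto
  moreover have "ev U \<gamma> \<noteq> 0" using U(2) ev_nth_0[of U \<gamma>] by (metis fps_zero_nth)
  ultimately show False using \<gamma>(2) by simp
qed

text \<open>Over the common ramification N = n k1 k2 the slope conditions give both values the same
  order s, with q s = N p. The leading coefficients differ by \<omega>^s, whose q-th power is
  \<omega>^(N p) = 1.\<close>

lemma polar_value_leading_coeff:
  fixes f :: "complex fps fps"
  assumes f: "irreducible f" and \<alpha>: "n \<ge> 1" "\<alpha> $ 0 = 0" "psubst f (fps_X ^ n) \<alpha> = 0"
    and 1: "k1 \<ge> 1" "\<gamma>1 $ 0 = 0" "psubst (fps_deriv f) (fps_X ^ k1) \<gamma>1 = 0" "F1 = psubst f (fps_X ^ k1) \<gamma>1"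
    and 2: "k2 \<ge> 1" "\<gamma>2 $ 0 = 0" "psubst (fps_deriv f) (fps_X ^ k2) \<gamma>2 = 0" "F2 = psubst f (fps_X ^ k2) \<gamma>2"
    and q: "q \<ge> 1" and slope: "q * subdegree F1 = p * k1" "q * subdegree F2 = p * k2"
  shows "(F1 $ subdegree F1) ^ q = (F2 $ subdegree F2) ^ q"
proof -
  define N where "N = n * k1 * k2"
  define G where "G = sx (fps_X ^ N) f"
  have N: "N \<ge> 1" using \<alpha>(1) 1(1) 2(1) by (simp add: N_def)
  have comp: "psubst H (fps_X ^ N) (a oo fps_X ^ m) = psubst H (fps_X ^ r) a oo fps_X ^ m"
    if "r * m = N" "r \<ge> 1" "m \<ge> 1" "a $ 0 = 0" for H :: "complex fps fps" and a r m
  proof -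
    have "fps_X ^ r oo fps_X ^ m = (fps_X ^ (r * m) :: complex fps)"
      using that(3) by (simp add: fps_X_power_compose mult.commute flip: power_mult)
    then show ?thesis using that by (simp add: compose_psubst)
  qed
  define \<alpha>' where "\<alpha>' = \<alpha> oo fps_X ^ (k1 * k2)"
  have \<alpha>': "\<alpha>' $ 0 = 0" "psubst f (fps_X ^ N) \<alpha>' = 0"
    using comp[of n "k1 * k2" \<alpha> f] \<alpha> 1(1) 2(1) by (auto simp: \<alpha>'_def N_def)
  obtain U where U: "G = conj_prod N \<alpha>' * U" "U $ 0 $ 0 \<noteq> 0"
    using irreducible_factorization[OF f N \<alpha>'] unfolding G_def by blast
  have polar: "ev (fps_deriv G) (\<gamma> oo fps_X ^ m) = 0 \<and> ev G (\<gamma> oo fps_X ^ m) \<noteq> 0 \<and> (\<gamma> oo fps_X ^ m) $ 0 = 0 \<and>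
      subdegree (ev G (\<gamma> oo fps_X ^ m)) = subdegree F * m \<and> ev G (\<gamma> oo fps_X ^ m) $ (subdegree F * m) = F $ subdegree F"
    if \<gamma>: "r * m = N" "r \<ge> 1" "m \<ge> 1" "\<gamma> $ 0 = 0" "psubst (fps_deriv f) (fps_X ^ r) \<gamma> = 0"
      "F = psubst f (fps_X ^ r) \<gamma>" for r m \<gamma> F
  proof -
    have F0: "F \<noteq> 0" using polar_value_nonzero[OF f \<gamma>(2,4,5)] \<gamma>(6) by simp
    have ev: "ev G (\<gamma> oo fps_X ^ m) = F oo fps_X ^ m"
      using comp[OF \<gamma>(1-4), of f] by (simp add: G_def psubst_def \<gamma>(6))
    have "ev (fps_deriv G) (\<gamma> oo fps_X ^ m) = 0"
      using comp[OF \<gamma>(1-4), of "fps_deriv f"] \<gamma>(5) by (simp add: G_def psubst_def sx_deriv)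
    moreover have "F oo fps_X ^ m \<noteq> 0"
      using nth_compose_X_power_subdegree(2)[OF \<gamma>(3), of F] F0 by (metis fps_zero_nth nth_subdegree_nonzero)
    ultimately show ?thesis using \<gamma>(4) unfolding ev
      by (simp add: nth_compose_X_power_subdegree[OF \<gamma>(3)])
  qed
  have m1: "k1 * (n * k2) = N" "n * k2 \<ge> 1" and m2: "k2 * (n * k1) = N" "n * k1 \<ge> 1"
    using \<alpha>(1) 1(1) 2(1) by (auto simp: N_def)
  note P1 = polar[OF m1(1) 1(1) m1(2) 1(2-4)]
  note P2 = polar[OF m2(1) 2(1) m2(2) 2(2-4)]
  define s where "s = subdegree F1 * (n * k2)"
  have "q * s = p * k1 * (n * k2)" using slope(1) by (simp add: s_def mult.assoc[symmetric])
  then have qs: "q * s = N * p" by (simp add: N_def mult_ac)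
  have "q * (subdegree F2 * (n * k1)) = p * k2 * (n * k1)" using slope(2) by (simp add: mult.assoc[symmetric])
  then have "q * (subdegree F2 * (n * k1)) = q * s" using qs by (simp add: N_def mult_ac)
  then have s2: "subdegree F2 * (n * k1) = s" using q by simp
  define \<delta>1 where "\<delta>1 = \<gamma>1 oo fps_X ^ (n * k2)"
  define \<delta>2 where "\<delta>2 = \<gamma>2 oo fps_X ^ (n * k1)"
  have \<delta>1: "ev (fps_deriv G) \<delta>1 = 0" "ev G \<delta>1 \<noteq> 0" "\<delta>1 $ 0 = 0" "subdegree (ev G \<delta>1) = s"
    "ev G \<delta>1 $ s = F1 $ subdegree F1" unfolding \<delta>1_def s_def using P1 by blast+
  have \<delta>2: "ev (fps_deriv G) \<delta>2 = 0" "ev G \<delta>2 \<noteq> 0" "\<delta>2 $ 0 = 0" "subdegree (ev G \<delta>2) = s"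
    "ev G \<delta>2 $ s = F2 $ subdegree F2" unfolding \<delta>2_def s2[symmetric] using P2 by blast+
  have inv: "sx (rot \<omega>) G = G" if "\<omega> ^ N = 1" for \<omega>
    unfolding G_def by (rule sx_rot_sx_X_power[OF N that])
  obtain \<omega> where \<omega>: "\<omega> ^ N = 1" "ev G \<delta>2 $ s = \<omega> ^ s * ev G \<delta>1 $ s"
    by (rule polar_conjugate_leading[OF U(1) inv N U(2) \<alpha>'(1) \<delta>1(3) \<delta>2(3) \<delta>1(1) \<delta>2(1) \<delta>1(2) \<delta>2(2) \<delta>1(4) \<delta>2(4)])
  then have "F2 $ subdegree F2 = \<omega> ^ s * F1 $ subdegree F1" by (simp only: \<delta>1(5) \<delta>2(5))
  then have "(F2 $ subdegree F2) ^ q = \<omega> ^ (q * s) * (F1 $ subdegree F1) ^ q"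
    by (simp add: power_mult_distrib mult.commute[of q] power_mult)
  also have "\<omega> ^ (q * s) = 1" unfolding qs power_mult \<omega>(1) by simp
  finally show ?thesis by simp
qed

lemma polar_branch_normal_form:
  fixes f g :: "complex fps fps"
  assumes f: "irreducible f" "\<exists>j. f $ j $ 0 \<noteq> 0" and L: "L $ 0 = 0" "c $ 0 = 0" "L \<noteq> 0 \<or> c \<noteq> 0"
    and polar: "psubst (fps_deriv f) L c = 0" and g: "psubst g L (psubst f L c) = 0"
  obtains k \<gamma> where "k \<ge> 1" "\<gamma> $ 0 = 0" "psubst (fps_deriv f) (fps_X ^ k) \<gamma> = 0"
    "psubst g (fps_X ^ k) (psubst f (fps_X ^ k) \<gamma>) = 0"
proof -
  have "L \<noteq> 0" using polar_abscissa_nonzero[OF f L(2,3)] polar by blast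
  then obtain \<psi> k where \<psi>: "k \<ge> 1" "\<psi> $ 0 = 0" "\<psi> \<noteq> 0" "L oo \<psi> = fps_X ^ k"
    using reparametrize[OF L(1)] by metis
  have f00: "f $ 0 $ 0 = 0" using f(1) by (auto simp: irreducible_def fps2_unit_iff)
  have c: "psubst H L c oo \<psi> = psubst H (fps_X ^ k) (c oo \<psi>)" for H
    using compose_psubst[OF L(1,2) \<psi>(2)] \<psi>(4) by simp
  have "psubst g L (psubst f L c) oo \<psi> = psubst g (fps_X ^ k) (psubst f (fps_X ^ k) (c oo \<psi>))"
    using compose_psubst[OF L(1) _ \<psi>(2), of "psubst f L c" g] f00 \<psi>(4) c[of f] by simp
  then show ?thesis using that[OF \<psi>(1), of "c oo \<psi>"] L(2) c[of "fps_deriv f"] polar g by simp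
qed

text \<open>What is retained of a branch \<open>g\<close> of the discriminant: it contains the image
  of some nonconstant arc of the polar curve. The degree of the map between branches does not affect
  the roots of initial forms.\<close>

definition polar_image :: "complex fps fps \<Rightarrow> complex fps fps \<Rightarrow> complex fps fps \<Rightarrow> bool" where
  "polar_image l f g \<longleftrightarrow> (\<exists>a b. a $ 0 = 0 \<and> b $ 0 = 0 \<and> (a \<noteq> 0 \<or> b \<noteq> 0) \<and>
     psubst (deriv_inner l * fps_deriv f - fps_deriv l * deriv_inner f) a b = 0 \<and>
     psubst g (psubst l a b) (psubst f a b) = 0)"

text \<open>After straightening, each branch contains an arc u = t^k, v = h(t^k, \<gamma>) with
  \<gamma> a root of the derivative of h. The q-th power of a nonzero initial root is that of the
  leading coefficient of v, and this power is common to all polar roots of the given slope. The arc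
  on f supplies the root \<alpha> against which contacts are measured.\<close>

theorem polar_image_init_roots:
  fixes l f g g' :: "complex fps fps"
  assumes l: "l $ 0 $ 0 = 0" "l $ 1 $ 0 \<noteq> 0 \<or> l $ 0 $ 1 \<noteq> 0" and f: "irreducible f" "\<not> l dvd f"
    and root: "a0 $ 0 = 0" "b0 $ 0 = 0" "a0 \<noteq> 0 \<or> b0 \<noteq> 0" "psubst f a0 b0 = 0"
    and g: "irreducible g" "polar_image l f g" and g': "irreducible g'" "polar_image l f g'"
    and qp: "q \<ge> 1" "p \<ge> 1"
    and \<zeta>: "\<zeta> \<noteq> 0" "poly (init_poly q p g) \<zeta> = 0" and \<zeta>': "\<zeta>' \<noteq> 0" "poly (init_poly q p g') \<zeta>' = 0"
  shows "\<zeta> ^ q = \<zeta>' ^ q"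
proof (rule straighten[OF l f])
  fix h :: "complex fps fps"
  assume h: "irreducible h" "\<exists>j. h $ j $ 0 \<noteq> 0"
    and st': "\<And>a b. a $ 0 = 0 \<Longrightarrow> b $ 0 = 0 \<Longrightarrow> a \<noteq> 0 \<or> b \<noteq> 0 \<Longrightarrow>
      \<exists>c. c $ 0 = 0 \<and> psubst h (psubst l a b) c = psubst f a b \<and> (psubst l a b \<noteq> 0 \<or> c \<noteq> 0) \<and>
        (psubst (deriv_inner l * fps_deriv f - fps_deriv l * deriv_inner f) a b = 0 \<longrightarrow>
         psubst (fps_deriv h) (psubst l a b) c = 0)"
  define J where "J = deriv_inner l * fps_deriv f - fps_deriv l * deriv_inner f"
  note st = st'[folded J_def]
  obtain c0 where c0: "c0 $ 0 = 0" "psubst h (psubst l a0 b0) c0 = 0" "psubst l a0 b0 \<noteq> 0 \<or> c0 \<noteq> 0"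
    using st[OF root(1-3)] root(4) by metis
  have "psubst l a0 b0 $ 0 = 0" using l(1) by simp
  moreover have "psubst l a0 b0 \<noteq> 0" using polar_abscissa_nonzero[OF h c0(1,3)] c0(2) by blast
  ultimately obtain \<psi> n where \<psi>: "n \<ge> 1" "\<psi> $ 0 = 0" "\<psi> \<noteq> 0" "psubst l a0 b0 oo \<psi> = fps_X ^ n"
    using reparametrize by metis
  define \<alpha> where "\<alpha> = c0 oo \<psi>"
  have \<alpha>: "\<alpha> $ 0 = 0" "psubst h (fps_X ^ n) \<alpha> = 0"
    using compose_psubst[OF _ c0(1) \<psi>(2), of "psubst l a0 b0" h] l(1) c0 \<psi>(4) by (auto simp: \<alpha>_def)
  have normal: "\<exists>k \<gamma>. k \<ge> 1 \<and> \<gamma> $ 0 = 0 \<and> psubst (fps_deriv h) (fps_X ^ k) \<gamma> = 0 \<and>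
    psubst g (fps_X ^ k) (psubst h (fps_X ^ k) \<gamma>) = 0" if g: "polar_image l f g" for g
  proof -
    obtain a b where ab: "a $ 0 = 0" "b $ 0 = 0" "a \<noteq> 0 \<or> b \<noteq> 0" "psubst J a b = 0"
      "psubst g (psubst l a b) (psubst f a b) = 0"
      using g unfolding polar_image_def J_def by metis
    obtain c where c: "c $ 0 = 0" "psubst h (psubst l a b) c = psubst f a b" "psubst l a b \<noteq> 0 \<or> c \<noteq> 0"
      "psubst (fps_deriv h) (psubst l a b) c = 0"
      using st[OF ab(1-3)] ab(4) by metis
    have "psubst l a b $ 0 = 0" using l(1) by simp
    moreover have "psubst g (psubst l a b) (psubst h (psubst l a b) c) = 0" using c(2) ab(5) by simp
    ultimately show ?thesis using polar_branch_normal_form[OF h _ c(1,3,4)] by metis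
  qed
  have h00: "h $ 0 $ 0 = 0" using h(1) by (auto simp: irreducible_def fps2_unit_iff)
  obtain k1 \<gamma>1 where 1: "k1 \<ge> 1" "\<gamma>1 $ 0 = 0" "psubst (fps_deriv h) (fps_X ^ k1) \<gamma>1 = 0"
    "psubst g (fps_X ^ k1) (psubst h (fps_X ^ k1) \<gamma>1) = 0" using normal[OF g(2)] by metis
  obtain k2 \<gamma>2 where 2: "k2 \<ge> 1" "\<gamma>2 $ 0 = 0" "psubst (fps_deriv h) (fps_X ^ k2) \<gamma>2 = 0"
    "psubst g' (fps_X ^ k2) (psubst h (fps_X ^ k2) \<gamma>2) = 0" using normal[OF g'(2)] by metis
  have b1: "q * subdegree (psubst h (fps_X ^ k1) \<gamma>1) = p * k1 \<and>
      \<zeta> ^ q = (psubst h (fps_X ^ k1) \<gamma>1 $ subdegree (psubst h (fps_X ^ k1) \<gamma>1)) ^ q"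
    by (rule branch_init_root[OF g(1) 1(1) _ _ 1(4) qp \<zeta>])
      (use h00 polar_value_nonzero[OF h(1) 1(1-3)] in auto)
  have b2: "q * subdegree (psubst h (fps_X ^ k2) \<gamma>2) = p * k2 \<and>
      \<zeta>' ^ q = (psubst h (fps_X ^ k2) \<gamma>2 $ subdegree (psubst h (fps_X ^ k2) \<gamma>2)) ^ q"
    by (rule branch_init_root[OF g'(1) 2(1) _ _ 2(4) qp \<zeta>'])
      (use h00 polar_value_nonzero[OF h(1) 2(1-3)] in auto)
  show ?thesis
    using polar_value_leading_coeff[OF h(1) \<psi>(1) \<alpha> 1(1-3) refl 2(1-3) refl qp(1), of p] b1 b2 by simp
qed

section \<open>Non-degeneracy on an edge\<close>

lemma weighted_inj:
  assumes "p \<ge> 1" "q \<ge> 1" "weighted p q F = weighted p q G"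
  shows "F = G"
proof (intro fps_ext)
  fix j i
  have "coeff (weighted p q H $ (p * i + q * j)) j = H $ j $ i" for H :: "'a fps fps"
    using assms(1,2) by (auto simp: coeff_weighted)
  then show "F $ j $ i = G $ j $ i" using assms(3) by metis
qed

lemma weighted_diff: "weighted p q (F - G) = weighted p q F - weighted p q G"
proof -
  have "lift2 (F - G) = lift2 F - lift2 G" by (intro fps_ext) simp
  then show ?thesis by (simp add: weighted_def)
qed

lemma weighted_const: "weighted p q (fps_const (fps_const c)) = fps_const [:c:]"
proof -
  have "lift1 (fps_const c) = fps_const [:c:]" by (rule fps_ext) auto
  then show ?thesis by (simp add: weighted_def lift2_const)
qed

lemma weighted_inner_X: "p \<ge> 1 \<Longrightarrow> weighted p q (fps_const fps_X) = fps_X ^ p"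
  by (simp add: weighted_def lift2_const lift1_X)

lemma weighted_X: "q \<ge> 1 \<Longrightarrow> weighted p q fps_X = fps_const [:0, 1:] * fps_X ^ q"
  by (simp add: weighted_def lift2_X)

lemma weighted_power: "p \<ge> 1 \<Longrightarrow> q \<ge> 1 \<Longrightarrow> weighted p q (F ^ n) = weighted p q F ^ n"
  by (induction n) (simp_all add: weighted_mult)

lemma Rep_cps2_power: "Rep_cps2 (F ^ n) = Rep_cps2 F ^ n"
  by (induction n) (simp_all add: one_cps2.rep_eq times_cps2.rep_eq)

lemma Rep_cps2_prod: "Rep_cps2 (\<Prod>x\<in>A. F x) = (\<Prod>x\<in>A. Rep_cps2 (F x))"
  by (induction A rule: infinite_finite_induct) (simp_all add: one_cps2.rep_eq times_cps2.rep_eq)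

lemma init_poly_const_mult_X_power:
  assumes "weighted p q F = fps_const \<phi> * fps_X ^ n"
  shows "init_poly p q F = \<phi>"
proof (cases "\<phi> = 0")
  case False
  then have "subdegree (fps_const \<phi> * fps_X ^ n) = n" by (intro subdegreeI) auto
  then show ?thesis by (simp add: init_poly_def assms)
qed (simp add: init_poly_def assms)

lemma weighted_binomial:
  assumes "p \<ge> 1" "q \<ge> 1"
  shows "weighted q p (Rep_cps2 (Y2 ^ q' - const2 a * X2 ^ p')) =
    fps_const ([:0, 1:] ^ q') * fps_X ^ (p * q') - fps_const [:a:] * fps_X ^ (q * p')"
  unfolding minus_cps2.rep_eq times_cps2.rep_eq Rep_cps2_power Y2.rep_eq X2.rep_eq const2.rep_eq weighted_diff
    weighted_mult[OF assms(2,1)] weighted_power[OF assms(2,1)] weighted_X[OF assms(1)]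
    weighted_inner_X[OF assms(2)] weighted_const
  by (simp add: power_mult_distrib fps_const_power flip: power_mult)

text \<open>If p q' and q p' differ, the initial form is a power of z or a constant, without nonzero
  root; if they agree, coprimality identifies the exponent pairs. This pins down the exponents in an
  arbitrary edge factorization.\<close>

lemma init_poly_binomial_root:
  assumes pq: "p \<ge> 1" "q \<ge> 1" "coprime p q" and pq': "p' > 0" "q' > 0" "coprime p' q'" and a: "a \<noteq> 0"
    and \<zeta>: "\<zeta> \<noteq> 0" "poly (init_poly q p (Rep_cps2 (Y2 ^ q' - const2 a * X2 ^ p'))) \<zeta> = 0"
  shows "p' = p \<and> q' = q \<and> \<zeta> ^ q = a"
proof -
  define A where "A = (fps_const ([:0, 1:] ^ q') * fps_X ^ (p * q') :: complex poly fps)"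
  define C where "C = (fps_const [:a:] * fps_X ^ (q * p') :: complex poly fps)"
  have W: "weighted q p (Rep_cps2 (Y2 ^ q' - const2 a * X2 ^ p')) = A - C"
    unfolding A_def C_def by (rule weighted_binomial[OF pq(1,2)])
  have sA: "subdegree A = p * q'" "A $ (p * q') = [:0, 1:] ^ q'"
    by (auto simp: A_def intro!: subdegreeI)
  have sC: "subdegree C = q * p'" "C $ (q * p') = [:a:]"
    using a by (auto simp: C_def intro!: subdegreeI)
  have nz: "A \<noteq> 0" "C \<noteq> 0" using sA sC a by auto
  consider "p * q' < q * p'" | "p * q' > q * p'" | "p * q' = q * p'" by linarith
  then show ?thesis
  proof cases
    case 1
    have "subdegree (A - C) = p * q'" using subdegree_diff_eq1[of A C] nz sA sC 1 by simp
    then have "init_poly q p (Rep_cps2 (Y2 ^ q' - const2 a * X2 ^ p')) = [:0, 1:] ^ q'"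
      using 1 sA sC nth_less_subdegree_zero[of "p * q'" C] by (simp add: init_poly_def W)
    then show ?thesis using \<zeta> by simp
  next
    case 2
    have "subdegree (A - C) = q * p'" using subdegree_diff_eq2[of C A] nz sA sC 2 by simp
    then have "init_poly q p (Rep_cps2 (Y2 ^ q' - const2 a * X2 ^ p')) = - [:a:]"
      using 2 sA sC nth_less_subdegree_zero[of "q * p'" A] by (simp add: init_poly_def W)
    then show ?thesis using \<zeta> a by simp
  next
    case 3
    have "p dvd q * p'" using 3 by (metis dvd_triv_left)
    then have "p dvd p'" using pq(3) by (simp add: coprime_dvd_mult_right_iff)
    moreover have "p' dvd p * q'" using 3 by (metis dvd_triv_right)
    then have "p' dvd p" using pq'(3) by (simp add: coprime_dvd_mult_left_iff)
    ultimately have p: "p' = p" by (metis dvd_antisym)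
    then have q: "q' = q" using 3 pq(1) by simp
    have "(A - C) $ (p * q) = [:0, 1:] ^ q - [:a:]" using sA sC 3 by (simp add: p q mult.commute)
    moreover have "A - C = fps_const ([:0, 1:] ^ q - [:a:]) * fps_X ^ (p * q)"
      unfolding A_def C_def p q by (simp add: mult.commute[of q] left_diff_distrib flip: fps_const_sub)
    ultimately have "init_poly q p (Rep_cps2 (Y2 ^ q' - const2 a * X2 ^ p')) = [:0, 1:] ^ q - [:a:]"
      using init_poly_const_mult_X_power W by metis
    then show ?thesis using \<zeta> by (simp add: p q)
  qed
qed

section \<open>The polynomial of an edge\<close>

lemma poly_single_root:
  fixes P :: "complex poly"
  assumes "degree P = n" "n \<ge> 1" "\<And>z z'. poly P z = 0 \<Longrightarrow> poly P z' = 0 \<Longrightarrow> z = z'"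
  obtains a where "P = smult (lead_coeff P) ([:- a, 1:] ^ n)" "poly P a = 0"
proof -
  have "\<not> constant (poly P)" using assms by (simp add: constant_degree)
  then obtain a where a: "poly P a = 0" using fundamental_theorem_of_algebra by blast
  have "P \<noteq> 0" using assms by auto
  then obtain R where R: "P = [:- a, 1:] ^ order a P * R" "\<not> [:- a, 1:] dvd R"
    using order_decomp by blast
  have "degree R = 0"
  proof (rule ccontr)
    assume "degree R \<noteq> 0"
    then have "\<not> constant (poly R)" by (simp add: constant_degree)
    then obtain b where b: "poly R b = 0" using fundamental_theorem_of_algebra by blast
    then have "poly P b = 0" by (subst R(1)) simp
    then have "b = a" using assms(3) a by blast
    then show False using b R(2) by (simp add: poly_eq_0_iff_dvd)
  qed
  then obtain r where r: "R = [:r:]" by (metis degree_eq_zeroE)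
  have r0: "r \<noteq> 0" using R(2) r by auto
  have P: "P = smult r ([:- a, 1:] ^ order a P)" using R(1) r by simp
  then have "degree P = order a P" using r0 by (metis degree_linear_power degree_smult_eq)
  then have "order a P = n" using assms(1) by simp
  then have P': "P = smult r ([:- a, 1:] ^ n)" using P by simp
  have "lead_coeff ([:- a, 1:] ^ n) = 1" by (simp add: lead_coeff_power)
  moreover have "lead_coeff P = lead_coeff (smult r ([:- a, 1:] ^ n))" using P' by (rule arg_cong)
  then have "lead_coeff P = r * lead_coeff ([:- a, 1:] ^ n)" by (simp only: lead_coeff_smult)
  ultimately have "lead_coeff P = r" by (simp only: mult_1_right)
  then have "P = smult (lead_coeff P) ([:- a, 1:] ^ n)" using P' by (simp only:)
  then show ?thesis using a by (rule that)
qed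

lemma pcompose_power_left: "pcompose (P ^ n) Q = pcompose P Q ^ n" for P Q :: "'a::comm_semiring_1 poly"
  by (induction n) (simp_all add: pcompose_mult pcompose_1)

text \<open>Lattice points on the edge differ by multiples of (p, -q), so the initial form is z^l
  \<psi>(z^q) with \<psi>(0) nonzero. Every root of \<psi> is \<zeta>^q for a nonzero root \<zeta>
  of the initial form, so \<open>roots\<close> leaves \<psi> a single root a, of multiplicity
  s.\<close>

lemma edge_restriction:
  assumes S: "S \<in> compact_edges g"
    and roots: "\<And>p q \<zeta> \<zeta>'. p \<ge> 1 \<Longrightarrow> q \<ge> 1 \<Longrightarrow> \<zeta> \<noteq> 0 \<Longrightarrow> \<zeta>' \<noteq> 0 \<Longrightarrow>
      poly (init_poly q p (Rep_cps2 g)) \<zeta> = 0 \<Longrightarrow> poly (init_poly q p (Rep_cps2 g)) \<zeta>' = 0 \<Longrightarrow> \<zeta> ^ q = \<zeta>' ^ q"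
  obtains a c k l p q s where "p \<ge> 1" "q \<ge> 1" "s \<ge> 1" "coprime p q" "a \<noteq> 0" "c \<noteq> 0"
    "S = closed_segment (real k, real (l + q * s)) (real (k + p * s), real l)"
    "restrict_to g S = const2 c * X2 ^ k * Y2 ^ l * (Y2 ^ q - const2 a * X2 ^ p) ^ s"
    "init_poly q p (Rep_cps2 (restrict_to g S)) = smult c ([:0, 1:] ^ l * ([:0, 1:] ^ q - [:a:]) ^ s)"
proof (rule compact_edge_shape[OF S])
  fix k l p q s :: nat
  assume pq: "p \<ge> 1" "q \<ge> 1" and s: "s \<ge> 1" and cop: "coprime p q"
    and ends: "coeff2 g k (l + q * s) \<noteq> 0" "coeff2 g (k + p * s) l \<noteq> 0"
    and seg: "S = closed_segment (real k, real (l + q * s)) (real (k + p * s), real l)"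
    and ge: "\<And>i j. coeff2 g i j \<noteq> 0 \<Longrightarrow> q * k + p * (l + q * s) \<le> q * i + p * j"
    and on: "\<And>i j. coeff2 g i j \<noteq> 0 \<Longrightarrow> q * i + p * j = q * k + p * (l + q * s) \<Longrightarrow> (real i, real j) \<in> S"
  define G where "G = Rep_cps2 g"
  define d where "d = q * k + p * (l + q * s)"
  define \<phi> where "\<phi> = weighted q p G $ d"
  \<comment> \<open>Coefficients at the lattice points of the edge, counted from the lower right
    endpoint.\<close>
  define cf where "cf r = coeff2 g (k + p * (s - r)) (l + q * r)" for r
  have cG: "coeff2 g i j = G $ j $ i" for i j by (simp add: coeff2.rep_eq G_def)
  have w: "coeff (weighted q p F $ n) j = (if \<exists>i. q * i + p * j = n then F $ j $ ((n - p * j) div q) else 0)"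
    for F :: "complex fps fps" and n j by (rule coeff_weighted[OF pq(2,1)])
  have w': "coeff (weighted q p F $ (q * i + p * j)) j = F $ j $ i" for F :: "complex fps fps" and i j
    using pq by (auto simp: w)
  have inS: "q * i + p * j = d \<and> l \<le> j \<and> j \<le> l + q * s" if ij: "(real i, real j) \<in> S" for i j
  proof -
    obtain u where u: "0 \<le> u" "u \<le> 1" "real i = real k + u * (real (k + p * s) - real k)"
      "real j = real (l + q * s) + u * (real l - real (l + q * s))"
      using ij unfolding seg mem_closed_segment_prod by blast
    have i: "real i = real k + u * (real p * real s)" and j: "real j = real l + (1 - u) * (real q * real s)"
      using u(3,4) by (auto simp: algebra_simps)
    have "real (q * i + p * j) = real d"
      by (simp add: i j d_def algebra_simps)
    then have "q * i + p * j = d" by (simp only: of_nat_eq_iff)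
    moreover have "real l \<le> real j" unfolding j using u by simp
    moreover have "(1 - u) * (real q * real s) \<le> 1 * (real q * real s)" using u by (intro mult_right_mono) auto
    then have "real j \<le> real (l + q * s)" unfolding j by simp
    ultimately show ?thesis by linarith
  qed
  have below: "weighted q p G $ n = 0" if "n < d" for n
  proof (rule poly_eqI)
    fix j
    show "coeff (weighted q p G $ n) j = coeff 0 j"
    proof (cases "\<exists>i. q * i + p * j = n")
      case True
      then obtain i where i: "q * i + p * j = n" by blast
      then have "coeff2 g i j = 0" using ge[of i j] that by (metis d_def not_le)
      then show ?thesis using w'[of G i j] i cG by simp
    qed (simp add: w)
  qed
  have d1: "d = q * (k + p * s) + p * l" by (simp add: d_def algebra_simps)
  have \<phi>0: "\<phi> \<noteq> 0"
  proof
    assume "\<phi> = 0"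
    then have "coeff (weighted q p G $ (q * (k + p * s) + p * l)) l = 0" by (simp add: \<phi>_def d1)
    then show False using ends(2) cG by (simp only: w')
  qed
  have "subdegree (weighted q p G) = d" using \<phi>0 below by (intro subdegreeI) (auto simp: \<phi>_def)
  then have init: "init_poly q p G = \<phi>" by (simp add: init_poly_def \<phi>_def)
  have \<phi>sum: "\<phi> = (\<Sum>r\<le>s. monom (cf r) (l + q * r))"
  proof (rule poly_eqI)
    fix j
    have rhs: "coeff (\<Sum>r\<le>s. monom (cf r) (l + q * r)) j = (\<Sum>r\<le>s. if l + q * r = j then cf r else 0)"
      by (simp add: coeff_sum)
    show "coeff \<phi> j = coeff (\<Sum>r\<le>s. monom (cf r) (l + q * r)) j"
    proof (cases "\<exists>r\<le>s. l + q * r = j")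
      case True
      then obtain r where r: "r \<le> s" "l + q * r = j" by blast
      obtain m where m: "s = r + m" using r(1) le_Suc_ex by blast
      have "q * (k + p * (s - r)) + p * j = d"
        unfolding r(2)[symmetric] d_def m by (simp add: algebra_simps)
      then have "coeff \<phi> j = G $ j $ (k + p * (s - r))" unfolding \<phi>_def using w' by metis
      also have "\<dots> = cf r" by (simp add: cf_def cG r(2))
      also have "\<dots> = (\<Sum>r'\<in>{r}. if l + q * r' = j then cf r' else 0)" using r by simp
      also have "\<dots> = (\<Sum>r\<le>s. if l + q * r = j then cf r else 0)"
        by (rule sum.mono_neutral_left) (use r pq in auto)
      finally show ?thesis unfolding rhs .
    next
      case False
      have "coeff \<phi> j = 0"
      proof (cases "\<exists>i. q * i + p * j = d")
        case True
        then obtain i where i: "q * i + p * j = d" by blast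
        show ?thesis
        proof (rule ccontr)
          assume "coeff \<phi> j \<noteq> 0"
          then have "coeff2 g i j \<noteq> 0" using w'[of G i j] i cG by (simp add: \<phi>_def)
          then have "(real i, real j) \<in> S" using on i by (simp add: d_def)
          then have j: "l \<le> j" "j \<le> l + q * s" using inS by auto
          then obtain t where t: "j = l + t" using le_Suc_ex by blast
          \<comment> \<open>On the line of the edge, j - l is a multiple of q by coprimality, so
            only the points counted by \<open>cf\<close> occur.\<close>
          have "q * i + p * t = q * (k + p * s)" using i by (simp add: t d1 algebra_simps)
          then have "q dvd p * t" by (metis dvd_add_right_iff dvd_triv_left)
          then have "q dvd t" using cop by (simp add: coprime_commute coprime_dvd_mult_right_iff)
          then obtain r where r: "t = q * r" by (rule dvdE)
          then have "r \<le> s" using j pq by (simp add: t)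
          then show False using False t r by blast
        qed
      qed (simp add: \<phi>_def w)
      moreover have "(\<Sum>r\<le>s. if l + q * r = j then cf r else 0) = 0"
        using False by (intro sum.neutral) auto
      ultimately show ?thesis unfolding rhs by simp
    qed
  qed
  define \<psi> where "\<psi> = (\<Sum>r\<le>s. monom (cf r) r)"
  have c\<psi>: "coeff \<psi> r = (if r \<le> s then cf r else 0)" for r
    by (simp add: \<psi>_def coeff_sum if_distrib cong: if_cong)
  have cfs: "cf s \<noteq> 0" "cf 0 \<noteq> 0" using ends by (auto simp: cf_def)
  have deg: "degree \<psi> = s" using cfs(1) by (intro antisym degree_le le_degree) (auto simp: c\<psi>)
  have \<phi>\<psi>: "\<phi> = [:0, 1:] ^ l * pcompose \<psi> ([:0, 1:] ^ q)"
  proof -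
    have "pcompose (monom c r) x = smult c (x ^ r)" for c r and x :: "complex poly"
      by (simp add: monom_altdef pcompose_smult pcompose_power_left pcompose_pCons)
    then have "[:0, 1:] ^ l * pcompose \<psi> ([:0, 1:] ^ q) = (\<Sum>r\<le>s. monom (cf r) (l + q * r))"
      unfolding \<psi>_def pcompose_sum by (simp add: sum_distrib_left monom_altdef power_add power_mult)
    then show ?thesis by (simp add: \<phi>sum)
  qed
  have nz: "z \<noteq> 0" if "poly \<psi> z = 0" for z
    using that cfs(2) c\<psi>[of 0] by (auto simp: poly_0_coeff_0)
  have lift: "\<exists>\<zeta>. \<zeta> \<noteq> 0 \<and> \<zeta> ^ q = z \<and> poly \<phi> \<zeta> = 0" if z: "poly \<psi> z = 0" for z
  proof -
    obtain \<zeta> where "\<zeta> \<noteq> 0" "z = \<zeta> ^ q" using exists_complex_root_nonzero[OF nz[OF z], of q] pq by auto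
    then show ?thesis using z by (intro exI[of _ \<zeta>]) (simp add: \<phi>\<psi> poly_pcompose)
  qed
  have single: "z = z'" if z: "poly \<psi> z = 0" "poly \<psi> z' = 0" for z z'
  proof -
    obtain \<zeta> where 1: "\<zeta> \<noteq> 0" "\<zeta> ^ q = z" "poly \<phi> \<zeta> = 0" using lift[OF z(1)] by blast
    obtain \<zeta>' where 2: "\<zeta>' \<noteq> 0" "\<zeta>' ^ q = z'" "poly \<phi> \<zeta>' = 0" using lift[OF z(2)] by blast
    show ?thesis using roots[OF pq 1(1) 2(1)] 1 2 init by (simp add: G_def)
  qed
  obtain a where a: "\<psi> = smult (lead_coeff \<psi>) ([:- a, 1:] ^ s)" "poly \<psi> a = 0"
    using poly_single_root[OF deg s single] by blast
  define c where "c = lead_coeff \<psi>"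
  have c: "c \<noteq> 0" using cfs(1) by (simp add: c_def deg c\<psi>)
  have \<phi>: "\<phi> = smult c ([:0, 1:] ^ l * ([:0, 1:] ^ q - [:a:]) ^ s)"
  proof -
    have "pcompose [:- a, 1:] ([:0, 1:] ^ q) = [:0, 1:] ^ q - [:a:]" by (simp add: pcompose_pCons)
    then have "pcompose \<psi> ([:0, 1:] ^ q) = smult c (([:0, 1:] ^ q - [:a:]) ^ s)"
      by (subst a(1)) (simp add: pcompose_smult pcompose_power_left c_def)
    then show ?thesis by (simp add: \<phi>\<psi>)
  qed
  \<comment> \<open>The restriction is homogeneous for the two weights and so amounts to \<phi> and
    d; injectivity of \<open>weighted\<close> then identifies it with the claimed product.\<close>
  have restr: "weighted q p (Rep_cps2 (restrict_to g S)) = fps_const \<phi> * fps_X ^ d"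
  proof (intro fps_ext poly_eqI)
    fix n j
    have R: "Rep_cps2 (restrict_to g S) $ j $ i = (if (real i, real j) \<in> S then G $ j $ i else 0)" for i j
      by (simp add: restrict_to.rep_eq G_def)
    have rhs: "coeff ((fps_const \<phi> * fps_X ^ d) $ n) j = (if n = d then coeff \<phi> j else 0)"
      by (simp add: fps_X_power_nth)
    show "coeff (weighted q p (Rep_cps2 (restrict_to g S)) $ n) j = coeff ((fps_const \<phi> * fps_X ^ d) $ n) j"
    proof (cases "\<exists>i. q * i + p * j = n")
      case True
      then obtain i where i: "q * i + p * j = n" by blast
      have "coeff (weighted q p (Rep_cps2 (restrict_to g S)) $ n) j = (if (real i, real j) \<in> S then G $ j $ i else 0)"
        using w'[of "Rep_cps2 (restrict_to g S)" i j] i R by simp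
      also have "\<dots> = (if n = d then G $ j $ i else 0)"
        using inS[of i j] on[of i j] i cG by (auto simp: d_def)
      also have "\<dots> = (if n = d then coeff \<phi> j else 0)"
        using w'[of G i j] i by (auto simp: \<phi>_def)
      finally show ?thesis unfolding rhs .
    next
      case False
      then show ?thesis unfolding rhs by (auto simp: w \<phi>_def)
    qed
  qed
  have "restrict_to g S = const2 c * X2 ^ k * Y2 ^ l * (Y2 ^ q - const2 a * X2 ^ p) ^ s"
  proof -
    have "fps_const ([:0, 1:] ^ q) * fps_X ^ (p * q) - fps_const [:a:] * fps_X ^ (q * p)
        = fps_const ([:0, 1:] ^ q - [:a:]) * (fps_X ^ (p * q) :: complex poly fps)"
      by (simp add: mult.commute[of q] left_diff_distrib flip: fps_const_sub)
    then have B: "weighted q p (Rep_cps2 (Y2 ^ q - const2 a * X2 ^ p)) = fps_const ([:0, 1:] ^ q - [:a:]) * fps_X ^ (p * q)"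
      using weighted_binomial[OF pq] by simp
    have "weighted q p (Rep_cps2 (const2 c * X2 ^ k * Y2 ^ l * (Y2 ^ q - const2 a * X2 ^ p) ^ s))
        = fps_const [:c:] * (fps_X ^ q) ^ k * (fps_const [:0, 1:] * fps_X ^ p) ^ l
          * (fps_const ([:0, 1:] ^ q - [:a:]) * fps_X ^ (p * q)) ^ s"
      using pq by (simp only: times_cps2.rep_eq Rep_cps2_power weighted_mult weighted_power B
        const2.rep_eq X2.rep_eq Y2.rep_eq weighted_const weighted_X weighted_inner_X)
    also have "\<dots> = fps_const ([:c:] * [:0, 1:] ^ l * ([:0, 1:] ^ q - [:a:]) ^ s) * fps_X ^ (q * k + p * l + p * q * s)"
      by (simp only: power_mult_distrib fps_const_power fps_const_mult[symmetric] power_mult[symmetric] power_add mult_ac)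
    also have "q * k + p * l + p * q * s = d" by (simp add: d_def algebra_simps)
    also have "[:c:] * [:0, 1:] ^ l * ([:0, 1:] ^ q - [:a:]) ^ s = \<phi>" by (simp add: \<phi>)
    finally have "weighted q p (Rep_cps2 (restrict_to g S)) =
        weighted q p (Rep_cps2 (const2 c * X2 ^ k * Y2 ^ l * (Y2 ^ q - const2 a * X2 ^ p) ^ s))"
      using restr by simp
    then have "Rep_cps2 (restrict_to g S) = Rep_cps2 (const2 c * X2 ^ k * Y2 ^ l * (Y2 ^ q - const2 a * X2 ^ p) ^ s)"
      by (rule weighted_inj[OF pq(2,1)])
    then show ?thesis by (simp only: Rep_cps2_inject)
  qed
  moreover have "init_poly q p (Rep_cps2 (restrict_to g S)) = smult c ([:0, 1:] ^ l * ([:0, 1:] ^ q - [:a:]) ^ s)"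
    using init_poly_const_mult_X_power[OF restr] \<phi> by simp
  ultimately show ?thesis using that[OF pq s cop nz[OF a(2)] c seg] by blast
qed

text \<open>The factorization in \<open>non_degenerate_on\<close> is arbitrary and is therefore
  compared through initial forms. A \<zeta> with \<zeta>^q = a is a root of exactly one of its
  factors, the one for a. Cancelling this factor once leaves a product that is nonzero at \<zeta>,
  which forbids a second such factor in the given power s.\<close>

lemma non_degenerate_on_iff:
  assumes pq: "p \<ge> 1" "q \<ge> 1" "s \<ge> 1" "coprime p q" and ac: "a \<noteq> 0" "c \<noteq> 0"
    and g: "restrict_to g S = const2 c * X2 ^ k * Y2 ^ l * (Y2 ^ q - const2 a * X2 ^ p) ^ s"
    and init: "init_poly q p (Rep_cps2 (restrict_to g S)) = smult c ([:0, 1:] ^ l * ([:0, 1:] ^ q - [:a:]) ^ s)"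
  shows "non_degenerate_on g S \<longleftrightarrow> s = 1"
proof
  assume "s = 1"
  then have "edge_factorization g S c k l p q {a} (\<lambda>_. 1)"
    using pq ac g by (simp add: edge_factorization_def)
  then show "non_degenerate_on g S" unfolding non_degenerate_on_def by blast
next
  assume "non_degenerate_on g S"
  then obtain c' k' l' p' q' A t where fac: "edge_factorization g S c' k' l' p' q' A t" and t: "\<forall>a\<in>A. t a = 1"
    unfolding non_degenerate_on_def by blast
  then have A: "finite A" "0 \<notin> A" and pq': "p' > 0" "q' > 0" "coprime p' q'" and c': "c' \<noteq> 0"
    and r: "restrict_to g S = const2 c' * X2 ^ k' * Y2 ^ l' * (\<Prod>a\<in>A. (Y2 ^ q' - const2 a * X2 ^ p') ^ t a)"
    by (auto simp: edge_factorization_def)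
  define I where "I b = init_poly q p (Rep_cps2 (Y2 ^ q' - const2 b * X2 ^ p'))" for b
  have "(\<Prod>a\<in>A. (Y2 ^ q' - const2 a * X2 ^ p') ^ t a) = (\<Prod>a\<in>A. Y2 ^ q' - const2 a * X2 ^ p')"
    using t by (intro prod.cong) auto
  then have r': "Rep_cps2 (restrict_to g S) = fps_const (fps_const c') * fps_const fps_X ^ k' * fps_X ^ l' *
      (\<Prod>a\<in>A. Rep_cps2 (Y2 ^ q' - const2 a * X2 ^ p'))"
    unfolding r by (simp only: times_cps2.rep_eq Rep_cps2_power Rep_cps2_prod const2.rep_eq X2.rep_eq Y2.rep_eq)
  have iX: "init_poly q p (fps_const fps_X) = 1" "init_poly q p fps_X = [:0, 1:]"
    "init_poly q p (fps_const (fps_const c')) = [:c':]"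
    using pq init_poly_const_mult_X_power[of q p "fps_const fps_X" 1 q]
      init_poly_const_mult_X_power[of q p fps_X "[:0, 1:]" p]
      init_poly_const_mult_X_power[of q p "fps_const (fps_const c')" "[:c':]" 0]
    by (simp_all add: weighted_inner_X weighted_X weighted_const)
  have init': "smult c ([:0, 1:] ^ l * ([:0, 1:] ^ q - [:a:]) ^ s) = [:c':] * [:0, 1:] ^ l' * (\<Prod>b\<in>A. I b)"
    unfolding init[symmetric] r' I_def using pq
    by (simp only: init_poly_mult init_poly_power init_poly_prod iX power_one mult_1_right)
  obtain \<zeta> where \<zeta>: "\<zeta> \<noteq> 0" "a = \<zeta> ^ q" using exists_complex_root_nonzero[OF ac(1), of q] pq by auto
  have root: "b = a \<and> p' = p \<and> q' = q" if "b \<in> A" "poly (I b) \<zeta> = 0" for b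
  proof -
    have "b \<noteq> 0" using A(2) that(1) by auto
    then show ?thesis
      using init_poly_binomial_root[OF pq(1,2,4) pq' _ \<zeta>(1), of b] that(2) \<zeta>(2) by (simp add: I_def)
  qed
  have "poly (smult c ([:0, 1:] ^ l * ([:0, 1:] ^ q - [:a:]) ^ s)) \<zeta> = 0"
    using \<zeta>(2) pq(3) by simp
  then have "(\<Prod>b\<in>A. poly (I b) \<zeta>) = 0"
    unfolding init' using c' \<zeta>(1) by (simp add: poly_prod)
  then obtain b where "b \<in> A" "poly (I b) \<zeta> = 0" using A(1) by auto
  then have aA: "a \<in> A" and p'q': "p' = p" "q' = q" using root by auto
  have Ia: "I a = [:0, 1:] ^ q - [:a:]"
  proof -
    have "weighted q p (Rep_cps2 (Y2 ^ q - const2 a * X2 ^ p)) = fps_const ([:0, 1:] ^ q - [:a:]) * fps_X ^ (p * q)"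
      unfolding weighted_binomial[OF pq(1,2)] by (simp add: mult.commute[of q] left_diff_distrib flip: fps_const_sub)
    then show ?thesis unfolding I_def p'q' by (rule init_poly_const_mult_X_power)
  qed
  define R where "R = [:c':] * [:0, 1:] ^ l' * (\<Prod>b\<in>A - {a}. I b)"
  have "poly R \<zeta> \<noteq> 0"
    using c' \<zeta>(1) A(1) root by (auto simp: R_def poly_prod)
  obtain s' where s': "s = Suc s'" using pq(3) by (cases s) auto
  have "I a * (smult c ([:0, 1:] ^ l * I a ^ s')) = I a * R"
    using init' unfolding Ia[symmetric] s' R_def prod.remove[OF A(1) aA] by (simp add: mult_ac)
  moreover have "I a \<noteq> 0"
  proof
    assume "I a = 0"
    then have "poly ([:0, 1:] ^ q - [:a:]) 0 = 0" using Ia by simp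
    then show False using ac(1) pq(2) by (simp add: power_0_left)
  qed
  ultimately have "smult c ([:0, 1:] ^ l * I a ^ s') = R" using mult_left_cancel[of "I a"] by blast
  then have "poly (smult c ([:0, 1:] ^ l * I a ^ s')) \<zeta> \<noteq> 0" using \<open>poly R \<zeta> \<noteq> 0\<close> by simp
  moreover have "poly (I a) \<zeta> = 0" unfolding Ia using \<zeta>(2) by simp
  ultimately have "s' = 0" by (cases s') auto
  then show "s = 1" using s' by simp
qed

section \<open>The discriminant of a branch\<close>

lemma eval2_0_0: "eval2 F 0 0 = coeff2 F 0 0"
proof -
  have "eval2 F 0 0 = (\<Sum>\<^sub>\<infinity>(i, j)\<in>{(0, 0)}. coeff2 F i j * 0 ^ i * 0 ^ j)"
    unfolding eval2_def by (rule infsum_cong_neutral) (auto simp: power_0_left split: if_splits)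
  then show ?thesis by simp
qed

lemma smooth_curveD:
  assumes "smooth_curve l"
  shows "Rep_cps2 l $ 0 $ 0 = 0" "Rep_cps2 l $ 1 $ 0 \<noteq> 0 \<or> Rep_cps2 l $ 0 $ 1 \<noteq> 0"
  using assms by (auto simp: smooth_curve_def singular_at_def eval2_0_0 coeff2.rep_eq deriv_x.rep_eq
      deriv_y.rep_eq fps_deriv_fps_nth)

lemma convergent2_swap: "convergent2 (swap F) \<longleftrightarrow> convergent2 F"
proof -
  have *: "convergent2 (swap F)" if F: "convergent2 F" for F
  proof -
    obtain C R where "C > 0" "R \<ge> 1" "\<And>i j. norm (F $ j $ i) \<le> C * R ^ (i + j)"
      using F by (rule convergent2E) blast
    then show ?thesis by (intro convergent2I[of C R]) (auto simp: add.commute)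
  qed
  then show ?thesis by (metis swap_swap)
qed

text \<open>A smooth l is regular of order 1 in y or in x, so a formal quotient by it converges by
  the bound for Weierstrass division.\<close>

lemma smooth_dvd_Rep_cps2:
  assumes "smooth_curve l" "Rep_cps2 l dvd Rep_cps2 f"
  shows "l dvd f"
proof -
  obtain U where U: "Rep_cps2 f = Rep_cps2 l * U" using assms(2) by (rule dvdE)
  have cl: "convergent2 (Rep_cps2 l)" and cf: "convergent2 (Rep_cps2 f)"
    using Rep_cps2[of l] Rep_cps2[of f] by auto
  note l = smooth_curveD[OF assms(1)]
  have "convergent2 U"
  proof (cases "Rep_cps2 l $ 1 $ 0 \<noteq> 0")
    case True
    then have "regular 1 (Rep_cps2 l)" using l by (simp add: regular_def)
    then show ?thesis by (rule convergent2_quotient[OF _ cf cl]) (simp add: U mult.commute)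
  next
    case False
    then have "regular 1 (swap (Rep_cps2 l))" using l by (simp add: regular_def)
    moreover have "convergent2 (swap (Rep_cps2 f))" "convergent2 (swap (Rep_cps2 l))"
      using cl cf by (simp_all only: convergent2_swap)
    moreover have "(swap (Rep_cps2 f) - swap U * swap (Rep_cps2 l)) $ j = 0" for j
      by (simp add: U swap_mult mult.commute)
    ultimately have "convergent2 (swap U)" by (rule convergent2_quotient)
    then show ?thesis by (simp add: convergent2_swap)
  qed
  then have "f = l * Abs_cps2 U"
    by (simp add: Rep_cps2_inject[symmetric] times_cps2.rep_eq U Abs_cps2_inverse)
  then show ?thesis by simp
qed

lemma Rep_cps2_jacobian:
  "Rep_cps2 (jacobian l f) =
    deriv_inner (Rep_cps2 l) * fps_deriv (Rep_cps2 f) - fps_deriv (Rep_cps2 l) * deriv_inner (Rep_cps2 f)"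
  by (simp add: jacobian_def minus_cps2.rep_eq times_cps2.rep_eq deriv_x.rep_eq deriv_y.rep_eq deriv_inner_def)

text \<open>The zero pair factors through t^2, which primitivity forbids.\<close>

lemma primitive_param_nonzero:
  assumes "primitive_param h a b"
  shows "a \<noteq> 0 \<or> b \<noteq> 0"
proof (rule ccontr)
  assume "\<not> (a \<noteq> 0 \<or> b \<noteq> 0)"
  then have "a = 0 oo fps_X ^ 2" "b = 0 oo fps_X ^ 2" by auto
  moreover have "local_param 0" "local_param (fps_X ^ 2)" "subdegree (fps_X ^ 2 :: complex fps) \<ge> 2"
    by (auto simp: local_param_def)
  ultimately show False using assms unfolding primitive_param_def by blast
qed

text \<open>\<open>g\<close> vanishes along its own parametrization, hence also after the change of
  parameter \<tau>, and the latter arc is the image of the polar arc.\<close>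

lemma direct_image_branch_polar_image:
  assumes d: "direct_image_branch l f h G" and h: "h dvd jacobian l f"
  obtains g n where "irreducible g" "G = g ^ n" "polar_image (Rep_cps2 l) (Rep_cps2 f) (Rep_cps2 g)"
proof -
  obtain a b g A B \<tau> where prim: "primitive_param h a b" and g: "irreducible g" "primitive_param g A B"
    and \<tau>: "local_param \<tau>" and im: "subst2 l a b = A oo \<tau>" "subst2 f a b = B oo \<tau>" and G: "G = g ^ subdegree \<tau>"
    using d unfolding direct_image_branch_def by blast
  have ab: "a $ 0 = 0" "b $ 0 = 0" "psubst (Rep_cps2 h) a b = 0"
    using prim by (auto simp: primitive_param_def local_param_def subst2_eq_psubst)
  have AB: "A $ 0 = 0" "B $ 0 = 0" "psubst (Rep_cps2 g) A B = 0"
    using g(2) by (auto simp: primitive_param_def local_param_def subst2_eq_psubst)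
  have \<tau>0: "\<tau> $ 0 = 0" using \<tau> by (simp add: local_param_def)
  obtain K where "jacobian l f = h * K" using h by (rule dvdE)
  then have J: "psubst (Rep_cps2 (jacobian l f)) a b = 0" using ab by (simp add: times_cps2.rep_eq)
  have "psubst (Rep_cps2 g) A B oo \<tau> = psubst (Rep_cps2 g) (A oo \<tau>) (B oo \<tau>)"
    using AB \<tau>0 by (intro compose_psubst) auto
  then have "psubst (Rep_cps2 g) (psubst (Rep_cps2 l) a b) (psubst (Rep_cps2 f) a b) = 0"
    using AB(3) im by (simp add: subst2_eq_psubst)
  then have "polar_image (Rep_cps2 l) (Rep_cps2 f) (Rep_cps2 g)"
    unfolding polar_image_def using ab J primitive_param_nonzero[OF prim] Rep_cps2_jacobian by metis
  then show ?thesis using that g(1) G by blast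
qed

text \<open>Initial forms are multiplicative and a unit contributes a nonzero constant, so every
  root of the initial form of the discriminant comes from one of its branches.\<close>

lemma discriminant_init_root:
  assumes D: "is_discriminant l f D" and qp: "q \<ge> 1" "p \<ge> 1"
    and \<zeta>: "poly (init_poly q p (Rep_cps2 D)) \<zeta> = 0"
  obtains g where "irreducible g" "polar_image (Rep_cps2 l) (Rep_cps2 f) (Rep_cps2 g)"
    "poly (init_poly q p (Rep_cps2 g)) \<zeta> = 0"
proof -
  obtain hs Gs e e' where e': "e' dvd 1" and J: "jacobian l f = e * prod_list hs" and DG: "D = e' * prod_list Gs"
    and all: "list_all2 (direct_image_branch l f) hs Gs"
    using D unfolding is_discriminant_def direct_image_def by blast
  have "init_poly q p (Rep_cps2 (prod_list Gs)) = prod_list (map (\<lambda>G. init_poly q p (Rep_cps2 G)) Gs)"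
    by (induction Gs) (simp_all add: one_cps2.rep_eq times_cps2.rep_eq init_poly_mult[OF qp])
  moreover have "init_poly q p (Rep_cps2 e') = [:Rep_cps2 e' $ 0 $ 0:]" "Rep_cps2 e' $ 0 $ 0 \<noteq> 0"
    using e' init_poly_unit[OF qp] by (auto simp: dvd_1_iff_cps2)
  ultimately have "poly (prod_list (map (\<lambda>G. init_poly q p (Rep_cps2 G)) Gs)) \<zeta> = 0"
    using \<zeta> by (simp add: DG times_cps2.rep_eq init_poly_mult[OF qp])
  then have "\<exists>G\<in>set Gs. poly (init_poly q p (Rep_cps2 G)) \<zeta> = 0"
    by (induction Gs) auto
  then obtain G where G: "G \<in> set Gs" "poly (init_poly q p (Rep_cps2 G)) \<zeta> = 0" by blast
  then obtain i where i: "i < length Gs" "G = Gs ! i" by (metis in_set_conv_nth)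
  then have d: "direct_image_branch l f (hs ! i) G" and "i < length hs"
    using all by (auto simp: list_all2_conv_all_nth)
  then have "hs ! i dvd prod_list hs" by (simp add: prod_list_dvd)
  then have "hs ! i dvd jacobian l f" unfolding J by (rule dvd_mult)
  from direct_image_branch_polar_image[OF d this] obtain g n where g: "irreducible g" "G = g ^ n"
    "polar_image (Rep_cps2 l) (Rep_cps2 f) (Rep_cps2 g)" .
  have "poly (init_poly q p (Rep_cps2 g)) \<zeta> = 0"
    using G(2) by (simp add: g(2) Rep_cps2_power init_poly_power[OF qp])
  then show ?thesis using that g by blast
qed

theorem theorem1p1:
  fixes l f D :: cps2
  assumes "smooth_curve l"
    and "isolated_singularity f"
    and "\<not> l dvd f"
    and "irreducible f"
    and "is_discriminant l f D"
  shows "non_degenerate D \<longleftrightarrow>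
    (\<forall>S\<in>compact_edges D. rel_interior S \<inter> (\<int> \<times> \<int>) = {})"
proof -
  obtain a0 b0 where root: "a0 $ 0 = 0" "b0 $ 0 = 0" "a0 \<noteq> 0 \<or> b0 \<noteq> 0" "psubst (Rep_cps2 f) a0 b0 = 0"
    using irreducible_Rep_cps2(2)[OF assms(4)] by blast
  have lf: "\<not> Rep_cps2 l dvd Rep_cps2 f" using smooth_dvd_Rep_cps2[OF assms(1)] assms(3) by blast
  \<comment> \<open>The two roots may belong to different branches of the discriminant; each is
    traced back to a polar arc before they are compared.\<close>
  have roots: "\<zeta> ^ q = \<zeta>' ^ q"
    if qp: "p \<ge> 1" "q \<ge> 1" and \<zeta>: "\<zeta> \<noteq> 0" "\<zeta>' \<noteq> 0"
      "poly (init_poly q p (Rep_cps2 D)) \<zeta> = 0" "poly (init_poly q p (Rep_cps2 D)) \<zeta>' = 0" for p q \<zeta> \<zeta>'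
  proof -
    obtain g where g: "irreducible g" "polar_image (Rep_cps2 l) (Rep_cps2 f) (Rep_cps2 g)"
      "poly (init_poly q p (Rep_cps2 g)) \<zeta> = 0"
      by (rule discriminant_init_root[OF assms(5) qp(2,1) \<zeta>(3)])
    obtain g' where g': "irreducible g'" "polar_image (Rep_cps2 l) (Rep_cps2 f) (Rep_cps2 g')"
      "poly (init_poly q p (Rep_cps2 g')) \<zeta>' = 0"
      by (rule discriminant_init_root[OF assms(5) qp(2,1) \<zeta>(4)])
    show ?thesis
      by (rule polar_image_init_roots[OF smooth_curveD[OF assms(1)] irreducible_Rep_cps2(1)[OF assms(4)] lf root
          irreducible_Rep_cps2(1)[OF g(1)] g(2) irreducible_Rep_cps2(1)[OF g'(1)] g'(2) qp(2,1) \<zeta>(1) g(3) \<zeta>(2) g'(3)])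
  qed
  have "non_degenerate_on D S \<longleftrightarrow> rel_interior S \<inter> (\<int> \<times> \<int>) = {}" if S: "S \<in> compact_edges D" for S
  proof (rule edge_restriction[OF S roots])
    fix a c :: complex and k l p q s :: nat
    assume pq: "p \<ge> 1" "q \<ge> 1" "s \<ge> 1" "coprime p q" and ac: "a \<noteq> 0" "c \<noteq> 0"
      and seg: "S = closed_segment (real k, real (l + q * s)) (real (k + p * s), real l)"
      and restr: "restrict_to D S = const2 c * X2 ^ k * Y2 ^ l * (Y2 ^ q - const2 a * X2 ^ p) ^ s"
      and init: "init_poly q p (Rep_cps2 (restrict_to D S)) = smult c ([:0, 1:] ^ l * ([:0, 1:] ^ q - [:a:]) ^ s)"
    show ?thesis
      using non_degenerate_on_iff[OF pq ac restr init] edge_lattice_points[OF pq, of k l] seg by simp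
  qed
  then show ?thesis unfolding non_degenerate_def by blast
qed

end
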